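(* Any conical critical triod is minimal.
   Context: $\phi$ is the norm on $\mathbb{R}^2$ whose closed unit ball (Wulff shape) $B^\phi=\{\phi\le 1\}$ is the regular hexagon circumscribed to the unit circle centered at the origin with two horizontal facets (vertices $(\pm\frac{2}{\sqrt3},0)$, $(\pm\frac1{\sqrt3},\pm1)$). Its dual norm is $\phi^o(\xi)=\sup_{\phi(\eta)=1}\xi\cdot\eta$. A curve is a closed set $\Gamma=\gamma(I)\subset\mathbb{R}^2$, $I\in\{[0,1],[0,1),(0,1)\}$, with $\gamma$ absolutely continuous and injective on $(0,1)$; it is closed if $I=[0,1]$ and $\gamma(0)=\gamma(1)$. It is oriented by the parametrization; $\tau$ is the unit tangent and $\nu$ is $\tau$ rotated by $90^\circ$ counterclockwise (defined $\mathcal{H}^1$-a.e.). A network is a (connected) closed set consisting of finitely many oriented curves with pairwise disjoint relative interiors such that each endpoint of each curve is also an endpoint of at least two other curves (if the curve is not closed) or of another curve (if it is closed); these endpoints are the multiple junctions. For open $\Omega\subseteq\mathbb{R}^2$ the $\phi$-length of a network $\mathscr{S}=\cup_i\Gamma_i$ is $\ell_\phi(\mathscr{S},\Omega)=\sum_i\int_{\Omega\cap\Gamma_i}\phi^o(\nu)\,d\mathcal{H}^1$. A Cahn–Hoffman (CH) field on a network $\mathscr{S}=\cup_i\Gamma_i$ is a family of vector fields $N_i:\Gamma_i\to\partial B^\phi$, Lipschitz along $\Gamma_i$, with $N_i\cdot\nu=\phi^o(\nu)$ a.e. on $\Gamma_i$, such that at each multiple junction $X$ one has $\sum_j(-1)^{\sigma_j}N_{i_j}(X)=0$,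 the sum being over the curves ending at $X$, with $\sigma_j=0$ if $\Gamma_{i_j}$ is oriented from $X$ and $\sigma_j=1$ otherwise. A network is critical if it admits a CH field which is constant on each curve $\Gamma_i$. A conical triod is a network which is the union of three (distinct) half-lines starting from the same point. A polygonal network $\mathscr{S}$ (one made of finitely many segments and half-lines) is a local minimizer in an open set $U$ if $\ell_\phi(\mathscr{S},U)\le\ell_\phi(\mathscr{A},U)$ for every network $\mathscr{A}$ with $\mathscr{S}\Delta\mathscr{A}\Subset U$; it is ($\phi$-)minimal if it is a local minimizer in every bounded open subset of $\mathbb{R}^2$. *)

theory Defs
  imports "HOL-Analysis.Analysis"
begin

section \<open>The hexagonal norm and its dual\<close>

definition wulff :: "(real^2) set" where
  "wulff = convex hull
     {vector [2 / sqrt 3, 0], vector [- (2 / sqrt 3), 0],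
      vector [1 / sqrt 3, 1], vector [1 / sqrt 3, -1],
      vector [- (1 / sqrt 3), 1], vector [- (1 / sqrt 3), -1]}"

text \<open>The norm with closed unit ball \<open>wulff\<close>, as the Minkowski gauge of that set.\<close>

definition phi :: "real^2 \<Rightarrow> real" where
  "phi x = Inf {r. 0 < r \<and> x \<in> (\<lambda>y. r *\<^sub>R y) ` wulff}"

definition phi_dual :: "real^2 \<Rightarrow> real" where
  "phi_dual \<xi> = Sup {\<xi> \<bullet> \<eta> | \<eta>. phi \<eta> = 1}"


section \<open>One-dimensional Hausdorff measure in the plane\<close>

text \<open>The covering sets are required to be bounded because the library's \<open>diameter\<close> is
  a real number, hence meaningless on unbounded sets.\<close>

definition hausdorff1_pre :: "real \<Rightarrow> (real^2) set \<Rightarrow> ennreal" where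
  "hausdorff1_pre \<delta> A =
     Inf {(\<Sum>j. ennreal (diameter (V j))) | V :: nat \<Rightarrow> (real^2) set.
            A \<subseteq> (\<Union>j. V j) \<and> (\<forall>j. bounded (V j) \<and> diameter (V j) \<le> \<delta>)}"

definition hausdorff1_outer :: "(real^2) set \<Rightarrow> ennreal" where
  "hausdorff1_outer A = (SUP \<delta>\<in>{0<..}. hausdorff1_pre \<delta> A)"

definition H1 :: "(real^2) measure" where
  "H1 = measure_of UNIV (sets borel) hausdorff1_outer"


section \<open>Curves\<close>

definition abs_cont :: "real \<Rightarrow> real \<Rightarrow> (real \<Rightarrow> real^2) \<Rightarrow> bool" where
  "abs_cont s t \<gamma> \<longleftrightarrow>
     (\<forall>\<epsilon>>0. \<exists>\<delta>>0. \<forall>(n::nat) a b.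
        (\<forall>i<n. s \<le> a i \<and> a i \<le> b i \<and> b i \<le> t) \<longrightarrow>
        (\<forall>i<n. \<forall>j<n. i \<noteq> j \<longrightarrow> {a i<..<b i} \<inter> {a j<..<b j} = {}) \<longrightarrow>
        (\<Sum>i<n. b i - a i) < \<delta> \<longrightarrow>
        (\<Sum>i<n. dist (\<gamma> (a i)) (\<gamma> (b i))) < \<epsilon>)"

datatype curve = Curve (dom: "real set") (par: "real \<Rightarrow> real^2")

definition carrier :: "curve \<Rightarrow> (real^2) set" where
  "carrier c = par c ` dom c"

text \<open>On a non-compact parameter interval, absolute continuity is understood on every
  compact subinterval: curves such as half-lines are unbounded, so that they have no
  absolutely continuous parametrization over the whole of a bounded interval.\<close>

definition is_curve :: "curve \<Rightarrow> bool" where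
  "is_curve c \<longleftrightarrow>
     dom c \<in> {{0..1}, {0..<1}, {0<..<1}} \<and>
     (\<forall>s t. s \<le> t \<and> {s..t} \<subseteq> dom c \<longrightarrow> abs_cont s t (par c)) \<and>
     inj_on (par c) {0<..<1} \<and>
     closed (carrier c)"

definition closed_curve :: "curve \<Rightarrow> bool" where
  "closed_curve c \<longleftrightarrow> dom c = {0..1} \<and> par c 0 = par c 1"

definition endpoints :: "curve \<Rightarrow> (real^2) set" where
  "endpoints c = par c ` (dom c \<inter> {0, 1})"

definition rot90 :: "real^2 \<Rightarrow> real^2" where
  "rot90 v = vector [- (v $ 2), v $ 1]"

text \<open>Tangent and normal are functions of the point on the curve. They are meaningful where
  the parametrization has a nonzero derivative, hence almost everywhere on the curve with
  respect to \<open>H1\<close>.\<close>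

definition tangent :: "curve \<Rightarrow> real^2 \<Rightarrow> real^2" where
  "tangent c x =
     sgn (vector_derivative (par c) (at (the_inv_into {0<..<1} (par c) x)))"

definition normal :: "curve \<Rightarrow> real^2 \<Rightarrow> real^2" where
  "normal c x = rot90 (tangent c x)"


section \<open>Networks\<close>

definition support :: "curve list \<Rightarrow> (real^2) set" where
  "support S = (\<Union>c\<in>set S. carrier c)"

definition network :: "curve list \<Rightarrow> bool" where
  "network S \<longleftrightarrow>
     (\<forall>c\<in>set S. is_curve c) \<and>
     closed (support S) \<and> connected (support S) \<and>
     (\<forall>i<length S. \<forall>j<length S. i \<noteq> j \<longrightarrow>
        par (S ! i) ` {0<..<1} \<inter> par (S ! j) ` {0<..<1} = {}) \<and>
     (\<forall>i<length S. \<forall>X\<in>endpoints (S ! i).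
        (if closed_curve (S ! i) then 1 else 2)
          \<le> card {j. j < length S \<and> j \<noteq> i \<and> X \<in> endpoints (S ! j)})"

definition junctions :: "curve list \<Rightarrow> (real^2) set" where
  "junctions S = (\<Union>c\<in>set S. endpoints c)"

definition phi_length :: "curve list \<Rightarrow> (real^2) set \<Rightarrow> ennreal" where
  "phi_length S \<Omega> =
     (\<Sum>c\<leftarrow>S. \<integral>\<^sup>+x\<in>\<Omega> \<inter> carrier c. ennreal (phi_dual (normal c x)) \<partial>H1)"


section \<open>Cahn--Hoffman fields and critical networks\<close>

text \<open>Lipschitz continuity along a curve refers to the distance along the curve.\<close>

definition lipschitz_along :: "curve \<Rightarrow> (real^2 \<Rightarrow> real^2) \<Rightarrow> bool" where
  "lipschitz_along c N \<longleftrightarrow>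
     (\<exists>L\<ge>0. \<forall>s t. s \<le> t \<and> {s..t} \<subseteq> dom c \<longrightarrow>
        ennreal (dist (N (par c s)) (N (par c t)))
          \<le> ennreal L * emeasure H1 (par c ` {s..t}))"

text \<open>In the balance condition a curve starting at \<open>X\<close> contributes with sign \<open>+\<close>, a curve
  arriving at \<open>X\<close> with sign \<open>-\<close>; a closed curve based at \<open>X\<close> does both.\<close>

definition CH_field :: "curve list \<Rightarrow> (nat \<Rightarrow> real^2 \<Rightarrow> real^2) \<Rightarrow> bool" where
  "CH_field S N \<longleftrightarrow>
     (\<forall>i<length S.
        N i ` carrier (S ! i) \<subseteq> frontier wulff \<and>
        lipschitz_along (S ! i) (N i) \<and>
        (AE x in H1. x \<in> carrier (S ! i) \<longrightarrow>
           N i x \<bullet> normal (S ! i) x = phi_dual (normal (S ! i) x))) \<and>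
     (\<forall>X\<in>junctions S.
        (\<Sum>i | i < length S \<and> 0 \<in> dom (S ! i) \<and> par (S ! i) 0 = X. N i X) -
        (\<Sum>i | i < length S \<and> 1 \<in> dom (S ! i) \<and> par (S ! i) 1 = X. N i X) = 0)"

definition critical :: "curve list \<Rightarrow> bool" where
  "critical S \<longleftrightarrow>
     network S \<and> (\<exists>N. CH_field S N \<and> (\<forall>i<length S. N i constant_on carrier (S ! i)))"


section \<open>Conical triods and minimality\<close>

definition half_line :: "real^2 \<Rightarrow> real^2 \<Rightarrow> (real^2) set" where
  "half_line X v = {X + s *\<^sub>R v | s. 0 \<le> s}"

definition conical_triod :: "curve list \<Rightarrow> bool" where
  "conical_triod S \<longleftrightarrow>
     network S \<and> length S = 3 \<and> distinct (map carrier S) \<and>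
     (\<exists>X. \<forall>c\<in>set S. \<exists>v. v \<noteq> 0 \<and> carrier c = half_line X v)"

definition polygonal_network :: "curve list \<Rightarrow> bool" where
  "polygonal_network S \<longleftrightarrow>
     network S \<and>
     (\<exists>F. finite F \<and> support S = \<Union>F \<and>
        (\<forall>A\<in>F. (\<exists>a b. a \<noteq> b \<and> A = closed_segment a b) \<or>
               (\<exists>a v. v \<noteq> 0 \<and> A = half_line a v)))"

definition local_minimizer :: "curve list \<Rightarrow> (real^2) set \<Rightarrow> bool" where
  "local_minimizer S U \<longleftrightarrow>
     polygonal_network S \<and> open U \<and>
     (\<forall>A. network A \<and>
          compact (closure (sym_diff (support S) (support A))) \<and>
          closure (sym_diff (support S) (support A)) \<subseteq> U \<longrightarrow>
          phi_length S U \<le> phi_length A U)"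

definition phi_minimal :: "curve list \<Rightarrow> bool" where
  "phi_minimal S \<longleftrightarrow> (\<forall>U. open U \<and> bounded U \<longrightarrow> local_minimizer S U)"

end

theory Submission
  imports Defs
begin

text \<open>The proof is by calibration. The fields of a critical triod with vertex \<open>X\<close> are three constant vectors
  \<open>n 0\<close>, \<open>n 1\<close>, \<open>n 2\<close> of the Wulff shape with sum zero, and \<open>n i \<bullet> \<nu>\<close> equals
  \<open>phi_dual \<nu>\<close> for the normal \<open>\<nu>\<close> of the \<open>i\<close>-th half-line. Since
  \<open>n i \<bullet> rot90 \<tau> = n i \<bullet> \<nu>\<close> for a tangent \<open>\<tau>\<close> and its normal, the linear function
  \<open>x \<mapsto> n i \<bullet> rot90 x\<close> grows along every curve at most as fast as the
  \<open>\<phi>\<close>-length, because \<open>\<bar>N \<bullet> \<xi>\<bar> \<le> phi_dual \<xi>\<close> for \<open>N\<close> in the Wulff shape, and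
  along the \<open>i\<close>-th half-line it grows exactly as fast.

  Let \<open>A\<close> be a network that differs from the triod only inside the bounded open set \<open>U\<close>, and choose a ball around
  \<open>X\<close> that contains \<open>U\<close>. The tips of the three half-lines on the boundary of the ball belong to \<open>A\<close>, and \<open>A\<close> is
  path connected in the ball, as one sees by retracting the rays outside radially (\<open>path_connected_Int_cball_of_radial\<close>).
  Hence the part of \<open>A\<close> in the ball contains three continua that join the three tips to a common point \<open>Y\<close> and meet nowhere
  else (\<open>tripod_exists\<close>). The \<open>i\<close>-th continuum has at least the \<open>\<phi>\<close>-length
  \<open>n i \<bullet> rot90 (tip i - Y)\<close>. In the sum over \<open>i\<close> the point \<open>Y\<close> can be replaced by \<open>X\<close>, because the \<open>n i\<close>
  have sum zero, and what results is the \<open>\<phi>\<close>-length of the triod in the ball. Outside \<open>U\<close> both networks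
  coincide; subtracting their common part gives the inequality in \<open>U\<close> (\<open>phi_length_le_competitor\<close>).

  The continua need not be parametrized by pieces of the curves of \<open>A\<close>, so the lower bound is proved for sets instead of paths:
  for a Borel set \<open>E\<close> in a curve, the one-dimensional measure of the image of \<open>E\<close> under the linear function is at most the integral of
  \<open>phi_dual\<close> of the normal over \<open>E\<close> (\<open>curve_calibration\<close>). A connected set that joins two points has an image at
  least as long as the difference of the values (\<open>dist_le_hausdorff1_outer_connected\<close>). The inequality for sets is
  infinitesimally clear wherever the parametrization is differentiable, and a Vitali covering argument
  (\<open>vitali_comparison_integral\<close>) passes from small intervals to Borel sets. Two facts make this work: \<open>H1\<close> really is
  the Hausdorff measure on Borel sets (\<open>emeasure_H1\<close>), and an absolutely continuous injective arc is differentiable off a null set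
  (\<open>abs_cont_inj_differentiable_off_null\<close>). The second one follows from the differentiability of monotone functions, because the
  coordinates of the arc are differences of monotone functions built from its arc length, that is, from the
  Hausdorff measure of the images of intervals.\<close>

section \<open>One-dimensional Hausdorff measure\<close>

lemma hausdorff1_pre_le:
  assumes "A \<subseteq> (\<Union>j. V j)" "\<And>j. bounded (V j)" "\<And>j. diameter (V j) \<le> \<delta>"
  shows "hausdorff1_pre \<delta> A \<le> (\<Sum>j. ennreal (diameter (V j)))"
  unfolding hausdorff1_pre_def using assms by (intro Inf_lower) blast

lemma hausdorff1_pre_ge:
  assumes "\<And>V. A \<subseteq> (\<Union>j. V j) \<Longrightarrow> (\<forall>j. bounded (V j) \<and> diameter (V j) \<le> \<delta>) \<Longrightarrow>
     c \<le> (\<Sum>j. ennreal (diameter (V j :: (real^2) set)))"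
  shows "c \<le> hausdorff1_pre \<delta> A"
  unfolding hausdorff1_pre_def using assms by (intro Inf_greatest) blast

lemma hausdorff1_pre_antimono: "\<delta> \<le> \<delta>' \<Longrightarrow> hausdorff1_pre \<delta>' A \<le> hausdorff1_pre \<delta> A"
  by (rule hausdorff1_pre_ge, rule hausdorff1_pre_le) (auto intro: order_trans)

lemma hausdorff1_pre_mono: "A \<subseteq> B \<Longrightarrow> hausdorff1_pre \<delta> A \<le> hausdorff1_pre \<delta> B"
  by (rule hausdorff1_pre_ge, rule hausdorff1_pre_le) auto

lemma hausdorff1_pre_le_outer: "0 < \<delta> \<Longrightarrow> hausdorff1_pre \<delta> A \<le> hausdorff1_outer A"
  unfolding hausdorff1_outer_def by (rule SUP_upper) simp

lemma hausdorff1_outer_le: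
  assumes "\<And>\<delta>. 0 < \<delta> \<Longrightarrow> hausdorff1_pre \<delta> A \<le> c"
  shows "hausdorff1_outer A \<le> c"
  unfolding hausdorff1_outer_def using assms by (auto intro: SUP_least)

lemma hausdorff1_outer_mono: "A \<subseteq> B \<Longrightarrow> hausdorff1_outer A \<le> hausdorff1_outer B"
  by (rule hausdorff1_outer_le)
     (meson hausdorff1_pre_le_outer hausdorff1_pre_mono order_trans)

lemma hausdorff1_outer_empty [simp]: "hausdorff1_outer {} = 0"
proof -
  have "hausdorff1_pre \<delta> {} \<le> 0" if "0 < \<delta>" for \<delta>
    using hausdorff1_pre_le[of "{}" "\<lambda>_. {}" \<delta>] that by simp
  then have "hausdorff1_outer {} \<le> 0" by (rule hausdorff1_outer_le)
  then show ?thesis by simp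
qed

lemma hausdorff1_pre_approx:
  assumes "hausdorff1_pre \<delta> A < c"
  obtains V :: "nat \<Rightarrow> (real^2) set" where "A \<subseteq> (\<Union>j. V j)" "\<And>j. bounded (V j)"
    "\<And>j. diameter (V j) \<le> \<delta>" "(\<Sum>j. ennreal (diameter (V j))) \<le> c"
  using assms unfolding hausdorff1_pre_def Inf_less_iff by (force simp: less_imp_le)

lemma hausdorff1_pre_countably_subadditive:
  "hausdorff1_pre \<delta> (\<Union>i. A i) \<le> (\<Sum>i::nat. hausdorff1_pre \<delta> (A i))"
proof (rule ennreal_le_epsilon)
  fix e :: real assume e: "0 < e" and fin: "(\<Sum>i. hausdorff1_pre \<delta> (A i)) < top"
  have "\<exists>V. A i \<subseteq> (\<Union>j. V j) \<and> (\<forall>j. bounded (V j) \<and> diameter (V j) \<le> \<delta>) \<and>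
      (\<Sum>j. ennreal (diameter (V j :: (real^2) set))) \<le> hausdorff1_pre \<delta> (A i) + ennreal e * ennreal ((1/2) ^ Suc i)" for i
  proof -
    have "hausdorff1_pre \<delta> (A i) < top"
      using fin by (auto dest: ennreal_suminf_lessD)
    moreover have "0 < ennreal e * ennreal ((1/2) ^ Suc i)"
      using e by (simp flip: ennreal_mult)
    ultimately have "hausdorff1_pre \<delta> (A i) < hausdorff1_pre \<delta> (A i) + ennreal e * ennreal ((1/2) ^ Suc i)"
      by (simp add: ennreal_add_left_cancel_less less_top)
    then show ?thesis by (rule hausdorff1_pre_approx) blast
  qed
  then obtain V :: "nat \<Rightarrow> nat \<Rightarrow> (real^2) set" where V: "\<And>i. A i \<subseteq> (\<Union>j. V i j)"
    "\<And>i j. bounded (V i j)" "\<And>i j. diameter (V i j) \<le> \<delta>"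
    "\<And>i. (\<Sum>j. ennreal (diameter (V i j))) \<le> hausdorff1_pre \<delta> (A i) + ennreal e * ennreal ((1/2) ^ Suc i)"
    by metis
  define W where "W = case_prod V \<circ> prod_decode"
  have "(\<Union>i. A i) \<subseteq> (\<Union>n. W n)"
  proof
    fix x assume "x \<in> (\<Union>i. A i)"
    then obtain i j where "x \<in> V i j" using V(1) by blast
    then have "x \<in> W (prod_encode (i, j))" by (simp add: W_def)
    then show "x \<in> (\<Union>n. W n)" by blast
  qed
  then have "hausdorff1_pre \<delta> (\<Union>i. A i) \<le> (\<Sum>n. ennreal (diameter (W n)))"
    by (rule hausdorff1_pre_le) (auto simp: W_def V split: prod.split)
  also have "\<dots> = (\<Sum>i. \<Sum>j. ennreal (diameter (V i j)))"
    unfolding W_def comp_def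
    using suminf_ennreal_2dimen[of "\<lambda>i. \<Sum>j. ennreal (diameter (V i j))" "\<lambda>p. ennreal (diameter (case_prod V p))"]
    by simp
  also have "\<dots> \<le> (\<Sum>i. hausdorff1_pre \<delta> (A i) + ennreal e * ennreal ((1/2) ^ Suc i))"
    by (intro suminf_le V) auto
  also have "\<dots> = (\<Sum>i. hausdorff1_pre \<delta> (A i)) + (\<Sum>i. ennreal e * ennreal ((1/2) ^ Suc i))"
    by (subst suminf_add[symmetric]) (auto simp del: ennreal_suminf_cmult)
  also have "\<dots> = (\<Sum>i. hausdorff1_pre \<delta> (A i)) + e"
    unfolding ennreal_suminf_cmult
    by (subst suminf_ennreal_eq[OF zero_le_power power_half_series]) auto
  finally show "hausdorff1_pre \<delta> (\<Union>i. A i) \<le> (\<Sum>i. hausdorff1_pre \<delta> (A i)) + ennreal e" .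
qed

lemma hausdorff1_outer_countably_subadditive:
  "hausdorff1_outer (\<Union>i. A i) \<le> (\<Sum>i::nat. hausdorff1_outer (A i))"
proof (rule hausdorff1_outer_le)
  fix \<delta> :: real assume "0 < \<delta>"
  then have "(\<Sum>i. hausdorff1_pre \<delta> (A i)) \<le> (\<Sum>i. hausdorff1_outer (A i))"
    by (intro suminf_le hausdorff1_pre_le_outer) auto
  then show "hausdorff1_pre \<delta> (\<Union>i. A i) \<le> (\<Sum>i. hausdorff1_outer (A i))"
    using hausdorff1_pre_countably_subadditive order_trans by blast
qed

lemma hausdorff1_outer_Un: "hausdorff1_outer (A \<union> B) \<le> hausdorff1_outer A + hausdorff1_outer B"
proof -
  let ?C = "\<lambda>n::nat. if n = 0 then A else if n = 1 then B else {}"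
  have "A \<union> B = (\<Union>n. ?C n)" by (auto split: if_splits)
  then have "hausdorff1_outer (A \<union> B) \<le> (\<Sum>n. hausdorff1_outer (?C n))"
    using hausdorff1_outer_countably_subadditive[of ?C] by presburger
  also have "\<dots> = (\<Sum>n\<in>{0,1}. hausdorff1_outer (?C n))"
    by (rule suminf_finite) auto
  finally show ?thesis by simp
qed

text \<open>Sets of diameter less than \<open>d\<close> meet at most one of \<open>A\<close> and \<open>B\<close>, so a fine cover of the union splits into covers of the two parts.\<close>

lemma hausdorff1_outer_metric:
  assumes d: "0 < d" and sep: "\<And>x y. x \<in> A \<Longrightarrow> y \<in> B \<Longrightarrow> d \<le> dist x y"
  shows "hausdorff1_outer A + hausdorff1_outer B \<le> hausdorff1_outer (A \<union> B)"
proof -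
  have pre: "hausdorff1_pre \<delta> A + hausdorff1_pre \<delta> B \<le> hausdorff1_pre \<delta> (A \<union> B)" if "0 < \<delta>" "\<delta> < d" for \<delta>
  proof (rule hausdorff1_pre_ge)
    fix V :: "nat \<Rightarrow> (real^2) set"
    assume cov: "A \<union> B \<subseteq> (\<Union>j. V j)" and V: "\<forall>j. bounded (V j) \<and> diameter (V j) \<le> \<delta>"
    \<comment> \<open>Each covering set is handed to the part that it meets.\<close>
    define VA where "VA j = (if V j \<inter> A = {} then {} else V j)" for j
    define VB where "VB j = (if V j \<inter> B = {} then {} else V j)" for j
    have one: "V j \<inter> A = {} \<or> V j \<inter> B = {}" for j
    proof (rule ccontr)
      assume "\<not> ?thesis"
      then obtain x y where "x \<in> V j" "y \<in> V j" "x \<in> A" "y \<in> B" by blast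
      then have "d \<le> diameter (V j)"
        using sep diameter_bounded_bound V by (meson order_trans)
      then show False using V that by (meson leD order_trans)
    qed
    have "hausdorff1_pre \<delta> A \<le> (\<Sum>j. ennreal (diameter (VA j)))"
      by (rule hausdorff1_pre_le) (use cov V that in \<open>auto simp: VA_def\<close>, blast)
    moreover have "hausdorff1_pre \<delta> B \<le> (\<Sum>j. ennreal (diameter (VB j)))"
      by (rule hausdorff1_pre_le) (use cov V that in \<open>auto simp: VB_def\<close>, blast)
    ultimately have "hausdorff1_pre \<delta> A + hausdorff1_pre \<delta> B
        \<le> (\<Sum>j. ennreal (diameter (VA j))) + (\<Sum>j. ennreal (diameter (VB j)))"
      by (rule add_mono)
    also have "\<dots> = (\<Sum>j. ennreal (diameter (VA j)) + ennreal (diameter (VB j)))"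
      by (rule suminf_add) auto
    also have "\<dots> \<le> (\<Sum>j. ennreal (diameter (V j)))"
    proof (rule suminf_le)
      fix j show "ennreal (diameter (VA j)) + ennreal (diameter (VB j)) \<le> ennreal (diameter (V j))"
        using one[of j] by (auto simp: VA_def VB_def)
    qed auto
    finally show "hausdorff1_pre \<delta> A + hausdorff1_pre \<delta> B \<le> (\<Sum>j. ennreal (diameter (V j)))" .
  qed
  have "hausdorff1_pre \<delta>1 A + hausdorff1_pre \<delta>2 B \<le> hausdorff1_outer (A \<union> B)" if "0 < \<delta>1" "0 < \<delta>2" for \<delta>1 \<delta>2
  proof -
    define \<delta> where "\<delta> = min (min \<delta>1 \<delta>2) (d/2)"
    have \<delta>: "0 < \<delta>" "\<delta> < d" "\<delta> \<le> \<delta>1" "\<delta> \<le> \<delta>2" using that d by (auto simp: \<delta>_def)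
    then have "hausdorff1_pre \<delta>1 A + hausdorff1_pre \<delta>2 B \<le> hausdorff1_pre \<delta> A + hausdorff1_pre \<delta> B"
      by (intro add_mono hausdorff1_pre_antimono)
    also have "\<dots> \<le> hausdorff1_outer (A \<union> B)"
      using pre \<delta> hausdorff1_pre_le_outer order_trans by blast
    finally show ?thesis .
  qed
  then have "(SUP \<delta>1\<in>{0<..}. SUP \<delta>2\<in>{0<..}. hausdorff1_pre \<delta>1 A + hausdorff1_pre \<delta>2 B) \<le> hausdorff1_outer (A \<union> B)"
    by (intro SUP_least) auto
  moreover have "(SUP \<delta>1\<in>{0<..}. SUP \<delta>2\<in>{0<..}. hausdorff1_pre \<delta>1 A + hausdorff1_pre \<delta>2 B)
      = hausdorff1_outer A + hausdorff1_outer B"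
    unfolding hausdorff1_outer_def by (simp flip: ennreal_SUP_add_left) (simp add: ennreal_SUP_add_right)
  ultimately show ?thesis by simp
qed

lemma ennreal_suminf_tail_small:
  fixes f :: "nat \<Rightarrow> ennreal"
  assumes "suminf f \<noteq> top" "0 < (e::real)"
  obtains n where "(\<Sum>k. f (k + n)) \<le> ennreal e"
proof -
  have fin: "(\<Sum>j<n. f j) \<noteq> top" for n
  proof -
    have "(\<Sum>j<n. f j) \<le> suminf f" by (rule sum_le_suminf) auto
    then show ?thesis using assms(1) by (metis top_unique)
  qed
  have "suminf f \<le> (SUP n. (\<Sum>j<n. f j))" by (simp add: suminf_eq_SUP)
  moreover have "\<exists>n. suminf f < (\<Sum>j<n. f j) + ennreal e"
  proof (rule ccontr)
    assume "\<not> ?thesis"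
    then have "(SUP n. (\<Sum>j<n. f j) + ennreal e) \<le> suminf f"
      by (intro SUP_least) (auto simp: not_less)
    then have "suminf f + ennreal e \<le> suminf f"
      by (simp add: ennreal_SUP_add_left suminf_eq_SUP)
    then show False using assms
      by (metis add.right_neutral ennreal_add_left_cancel_le ennreal_le_iff2 ennreal_0 infinity_ennreal_def not_le order_refl)
  qed
  then obtain n where n: "suminf f < (\<Sum>j<n. f j) + ennreal e" ..
  have "suminf f = (\<Sum>j<n. f j) + (\<Sum>k. f (k + n))"
    using suminf_offset[OF summableI, of f n] by (simp add: add.commute)
  with n have "(\<Sum>j<n. f j) + (\<Sum>k. f (k + n)) \<le> (\<Sum>j<n. f j) + ennreal e"
    by (metis less_imp_le)
  then have "(\<Sum>k. f (k + n)) \<le> ennreal e"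
    using fin[of n] by (metis ennreal_add_left_cancel_le infinity_ennreal_def)
  then show ?thesis by (rule that)
qed

text \<open>Caratheodory's criterion for metric outer measures. The part of \<open>X\<close> off the closed set \<open>F\<close> is split into layers \<open>R n\<close> by the
  distance to \<open>F\<close>. Layers whose indices differ by two have positive distance, so the sums over the even and over the odd layers are at
  most the measure of \<open>X\<close>; therefore the layers close to \<open>F\<close> contribute arbitrarily little, and the rest of \<open>X - F\<close> has positive
  distance to \<open>F\<close>.\<close>

lemma hausdorff1_closed_caratheodory:
  assumes F: "closed F"
  shows "hausdorff1_outer (F \<inter> X) + hausdorff1_outer ((UNIV - F) \<inter> X) = hausdorff1_outer X"
proof (cases "F = {} \<or> hausdorff1_outer X = top")
  case True
  have "hausdorff1_outer X \<le> hausdorff1_outer ((F \<inter> X) \<union> ((UNIV - F) \<inter> X))"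
    by (rule hausdorff1_outer_mono) auto
  also have "\<dots> \<le> hausdorff1_outer (F \<inter> X) + hausdorff1_outer ((UNIV - F) \<inter> X)"
    by (rule hausdorff1_outer_Un)
  finally show ?thesis using True by (auto simp: top_unique)
next
  case False
  then have ne: "F \<noteq> {}" and fin: "hausdorff1_outer X \<noteq> top" by auto
  let ?H = hausdorff1_outer
  define A where "A n = {x \<in> X. 1 / real (Suc n) \<le> infdist x F}" for n
  \<comment> \<open>The layer of points whose distance to \<open>F\<close> is of order \<open>1 / n\<close>.\<close>
  define R where "R n = {x \<in> X. 1 / real (Suc (Suc n)) \<le> infdist x F \<and> infdist x F < 1 / real (Suc n)}" for n
  have lip: "infdist x F - infdist y F \<le> dist x y" for x y
    using infdist_triangle[of x F y] by simp
  have D: "(UNIV - F) \<inter> X \<subseteq> A n \<union> (\<Union>k. R (k + n))" for n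
  proof
    fix x assume x: "x \<in> (UNIV - F) \<inter> X"
    then have pos: "0 < infdist x F"
      using F ne in_closed_iff_infdist_zero[of F x] infdist_nonneg[of x F] by (simp add: less_le)
    show "x \<in> A n \<union> (\<Union>k. R (k + n))"
    proof (cases "1 / real (Suc n) \<le> infdist x F")
      case False
      obtain m where m: "1 / real (Suc m) \<le> infdist x F"
        using pos by (metis nat_approx_posE less_imp_le)
      define l where "l = (LEAST m. 1 / real (Suc m) \<le> infdist x F)"
      have l1: "1 / real (Suc l) \<le> infdist x F" unfolding l_def by (rule LeastI) (rule m)
      have "l \<noteq> 0 \<and> n < l"
      proof (rule ccontr)
        assume "\<not> ?thesis"
        then have "l \<le> n" by auto
        then have "1 / real (Suc n) \<le> 1 / real (Suc l)" by (simp add: frac_le)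
        then show False using l1 False by linarith
      qed
      moreover then have "\<not> 1 / real (Suc (l - 1)) \<le> infdist x F"
        using not_less_Least[of "l - 1" "\<lambda>m. 1 / real (Suc m) \<le> infdist x F"] unfolding l_def[symmetric] by simp
      ultimately have "x \<in> R ((l - 1 - n) + n)" using x l1 by (simp add: R_def)
      then show ?thesis by blast
    qed (use x in \<open>auto simp: A_def\<close>)
  qed
  have sepR: "?H (\<Union>i<m. R (2 * i + b)) + ?H (R (2 * m + b)) \<le> ?H ((\<Union>i<m. R (2 * i + b)) \<union> R (2 * m + b))" for m b
  proof (rule hausdorff1_outer_metric)
    let ?d = "1 / real (2 * m + b + 1) - 1 / real (2 * m + b + 1 + 1)"
    show "0 < ?d" by (simp add: frac_less2)
    fix x y assume "x \<in> (\<Union>i<m. R (2 * i + b))" "y \<in> R (2 * m + b)"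
    then obtain i where i: "i < m" "x \<in> R (2 * i + b)" by auto
    have "1 / real (2 * m + b) \<le> 1 / real (Suc (Suc (2 * i + b)))"
      using i by (intro frac_le) auto
    then have "1 / real (2 * m + b) \<le> infdist x F" using i by (simp add: R_def)
    moreover have "infdist y F < 1 / real (2 * m + b + 1)"
      using \<open>y \<in> _\<close> by (simp add: R_def)
    moreover have "1 / real (2 * m + b) - 1 / real (2 * m + b + 1) \<ge> ?d"
    proof -
      have gap: "1 / t - 1 / (t + 1) = 1 / (t * (t + 1))" if "0 < t" for t :: real
        using that by (simp add: field_simps)
      define t where "t = real (2 * m + b)"
      have t: "0 < t" using i by (simp add: t_def)
      have "1 / ((t + 1) * (t + 1 + 1)) \<le> 1 / (t * (t + 1))"
        using t by (intro frac_le mult_mono) (auto simp: mult.commute)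
      then have "1 / (t + 1) - 1 / (t + 1 + 1) \<le> 1 / t - 1 / (t + 1)"
        using gap[of t] gap[of "t + 1"] t by simp
      then show ?thesis by (simp add: t_def algebra_simps)
    qed
    ultimately show "?d \<le> dist x y" using lip[of x y] by linarith
  qed
  have fin_sum: "(\<Sum>i<m. ?H (R (2 * i + b))) \<le> ?H (\<Union>i<m. R (2 * i + b))" for m b
  proof (induction m)
    case (Suc m)
    have "(\<Sum>i<Suc m. ?H (R (2 * i + b))) \<le> ?H (\<Union>i<m. R (2 * i + b)) + ?H (R (2 * m + b))"
      using Suc by (simp add: add_right_mono)
    also have "\<dots> \<le> ?H ((\<Union>i<m. R (2 * i + b)) \<union> R (2 * m + b))" by (rule sepR)
    also have "(\<Union>i<m. R (2 * i + b)) \<union> R (2 * m + b) = (\<Union>i<Suc m. R (2 * i + b))"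
      by (auto simp: lessThan_Suc)
    finally show ?case .
  qed simp
  have sum_le: "(\<Sum>i. ?H (R (2 * i + b))) \<le> ?H X" for b
  proof -
    have "(\<Sum>i<m. ?H (R (2 * i + b))) \<le> ?H X" for m
      by (rule order_trans[OF fin_sum hausdorff1_outer_mono]) (auto simp: R_def)
    then show ?thesis unfolding suminf_eq_SUP by (intro SUP_least) auto
  qed
  have half: "(\<Sum>k<2*m. ?H (R k)) = (\<Sum>i<m. ?H (R (2 * i + 0))) + (\<Sum>i<m. ?H (R (2 * i + 1)))" for m
    by (induction m) (auto simp: algebra_simps)
  have "(\<Sum>k<n. ?H (R k)) \<le> ?H X + ?H X" for n
  proof -
    have "(\<Sum>k<n. ?H (R k)) \<le> (\<Sum>k<2*n. ?H (R k))" by (rule sum_mono2) auto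
    also have "\<dots> \<le> (\<Sum>i. ?H (R (2 * i + 0))) + (\<Sum>i. ?H (R (2 * i + 1)))"
      unfolding half by (intro add_mono sum_le_suminf summableI) auto
    also have "\<dots> \<le> ?H X + ?H X" by (intro add_mono sum_le)
    finally show ?thesis .
  qed
  then have "(\<Sum>k. ?H (R k)) \<le> ?H X + ?H X" unfolding suminf_eq_SUP by (intro SUP_least) auto
  then have finR: "(\<Sum>k. ?H (R k)) \<noteq> top"
    using fin by (auto simp: top_unique ennreal_add_eq_top)
  have "?H (F \<inter> X) + ?H ((UNIV - F) \<inter> X) \<le> ?H X"
  proof (rule ennreal_le_epsilon)
    fix e :: real assume "0 < e"
    with finR obtain n where n: "(\<Sum>k. ?H (R (k + n))) \<le> ennreal e" by (rule ennreal_suminf_tail_small)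
    have "?H ((UNIV - F) \<inter> X) \<le> ?H (A n) + ?H (\<Union>k. R (k + n))"
      using D[of n] hausdorff1_outer_mono hausdorff1_outer_Un order_trans by blast
    also have "\<dots> \<le> ?H (A n) + ennreal e"
      using n hausdorff1_outer_countably_subadditive[of "\<lambda>k. R (k + n)"] by (intro add_left_mono) simp
    finally have "?H (F \<inter> X) + ?H ((UNIV - F) \<inter> X) \<le> ?H (F \<inter> X) + ?H (A n) + ennreal e"
      by (simp add: add.assoc add_left_mono)
    also have "?H (F \<inter> X) + ?H (A n) \<le> ?H (F \<inter> X \<union> A n)"
    proof (rule hausdorff1_outer_metric)
      show "0 < 1 / real (Suc n)" by simp
      fix x y assume "x \<in> F \<inter> X" "y \<in> A n"
      then show "1 / real (Suc n) \<le> dist x y"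
        using infdist_le[of x F y] by (simp add: A_def dist_commute)
    qed
    also have "\<dots> \<le> ?H X" by (rule hausdorff1_outer_mono) (auto simp: A_def)
    finally show "?H (F \<inter> X) + ?H ((UNIV - F) \<inter> X) \<le> ?H X + ennreal e"
      by (simp add: add_right_mono)
  qed
  moreover have "?H X \<le> ?H (F \<inter> X) + ?H ((UNIV - F) \<inter> X)"
    by (rule order_trans[OF hausdorff1_outer_mono hausdorff1_outer_Un]) auto
  ultimately show ?thesis by (rule antisym)
qed

lemma space_H1 [simp]: "space H1 = UNIV"
  by (simp add: H1_def space_measure_of_conv)

lemma sets_H1 [simp, measurable_cong]: "sets H1 = sets borel"
  by (simp add: H1_def sets_measure_of_conv) (metis sets.sigma_sets_eq space_borel)

text \<open>\<open>H1\<close> is introduced by \<open>measure_of\<close>, which yields the zero measure unless the set function is countably additive on Borel sets;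
  the criterion above supplies this.\<close>

lemma emeasure_H1:
  assumes "E \<in> sets borel"
  shows "emeasure H1 E = hausdorff1_outer E"
proof -
  let ?L = "lambda_system UNIV (Pow UNIV) hausdorff1_outer"
  have "outer_measure_space (Pow UNIV) hausdorff1_outer"
    unfolding outer_measure_space_def positive_def increasing_def countably_subadditive_def
    using hausdorff1_outer_mono hausdorff1_outer_countably_subadditive by auto
  then have ms: "measure_space UNIV ?L hausdorff1_outer"
    using sigma_algebra.caratheodory_lemma[OF sigma_algebra_Pow] by blast
  then have sa: "sigma_algebra UNIV ?L" by (simp add: measure_space_def)
  have "Collect closed \<subseteq> ?L"
    using hausdorff1_closed_caratheodory by (auto simp: lambda_system_def)
  then have "sigma_sets UNIV (Collect closed) \<subseteq> ?L"
    by (rule sigma_algebra.sigma_sets_subset[OF sa])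
  moreover have "sigma_sets UNIV (Collect closed) = sets (borel :: (real^2) measure)"
    by (simp add: borel_eq_closed)
  ultimately have sub: "sets (borel :: (real^2) measure) \<subseteq> ?L" by simp
  have "measure_space UNIV (sets borel) hausdorff1_outer"
    by (rule measure_down[OF ms _ sub]) (metis sets.sigma_algebra_axioms space_borel)
  then show ?thesis
    unfolding H1_def using assms sets.sigma_sets_eq[of "borel :: (real^2) measure"]
    by (subst emeasure_measure_of_sigma) (auto simp: measure_space_def)
qed

section \<open>Length of Lipschitz images, segments and connected sets\<close>

lemma hausdorff1_outer_singleton [simp]: "hausdorff1_outer {x} = 0"
proof -
  have "hausdorff1_outer {x} \<le> 0"
  proof (rule hausdorff1_outer_le)
    fix \<delta> :: real assume "0 < \<delta>"
    then have "hausdorff1_pre \<delta> {x} \<le> (\<Sum>j. ennreal (diameter ((\<lambda>_::nat. {x}) j)))"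
      by (intro hausdorff1_pre_le) auto
    then show "hausdorff1_pre \<delta> {x} \<le> 0" by simp
  qed
  then show ?thesis by simp
qed

lemma hausdorff1_outer_lipschitz_image:
  assumes L: "0 \<le> L" and lip: "\<And>x y. x \<in> A \<Longrightarrow> y \<in> A \<Longrightarrow> dist (f x) (f y) \<le> L * dist x y"
  shows "hausdorff1_outer (f ` A) \<le> ennreal L * hausdorff1_outer A"
proof (cases "L = 0")
  case True
  have "f ` A \<subseteq> {f a}" if "a \<in> A" for a
    using lip[OF _ that] True by auto
  then have "hausdorff1_outer (f ` A) \<le> 0"
    using hausdorff1_outer_mono by (cases "A = {}") (auto, metis all_not_in_conv hausdorff1_outer_singleton nle_le zero_le)
  then show ?thesis by simp
next
  case False
  with L have L: "0 < L" by simp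
  show ?thesis
  proof (rule hausdorff1_outer_le)
    fix \<delta> :: real assume \<delta>: "0 < \<delta>"
    show "hausdorff1_pre \<delta> (f ` A) \<le> ennreal L * hausdorff1_outer A"
    proof (rule ennreal_le_epsilon)
      fix e :: real assume e: "0 < e" and fin: "ennreal L * hausdorff1_outer A < top"
      then have finA: "hausdorff1_outer A < top"
        using L by (auto simp: ennreal_mult_less_top)
      have "hausdorff1_pre (\<delta> / L) A \<le> hausdorff1_outer A"
        using \<delta> L by (intro hausdorff1_pre_le_outer) simp
      also have "\<dots> < hausdorff1_outer A + ennreal (e / L)"
        using finA e L by (simp add: ennreal_add_left_cancel_less less_top)
      finally obtain V :: "nat \<Rightarrow> (real^2) set" where V: "A \<subseteq> (\<Union>j. V j)" "\<And>j. bounded (V j)"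
        "\<And>j. diameter (V j) \<le> \<delta> / L" "(\<Sum>j. ennreal (diameter (V j))) \<le> hausdorff1_outer A + ennreal (e / L)"
        by (rule hausdorff1_pre_approx) blast
      have dist_le: "dist (f x) (f y) \<le> L * diameter (V j)" if "x \<in> V j \<inter> A" "y \<in> V j \<inter> A" for x y j
        using lip[of x y] diameter_bounded_bound[OF V(2), of x j y] that L
        by (meson IntD1 IntD2 mult_left_mono order_trans less_imp_le)
      have diam: "diameter (f ` (V j \<inter> A)) \<le> L * diameter (V j)" for j
        by (rule diameter_le) (use dist_le L diameter_ge_0[OF V(2)] in \<open>auto simp: dist_norm\<close>)
      have bdd: "bounded (f ` (V j \<inter> A))" for j
      proof (cases "V j \<inter> A = {}")
        case False
        then obtain x where x: "x \<in> V j \<inter> A" by blast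
        show ?thesis
          unfolding bounded_def by (intro exI[of _ "f x"] exI[of _ "L * diameter (V j)"]) (use dist_le x in blast)
      qed simp
      have "hausdorff1_pre \<delta> (f ` A) \<le> (\<Sum>j. ennreal (diameter (f ` (V j \<inter> A))))"
      proof (rule hausdorff1_pre_le)
        show "f ` A \<subseteq> (\<Union>j. f ` (V j \<inter> A))" using V(1) by blast
        show "bounded (f ` (V j \<inter> A))" for j by (rule bdd)
        show "diameter (f ` (V j \<inter> A)) \<le> \<delta>" for j
          using diam[of j] V(3)[of j] L by (simp add: field_simps)
      qed
      also have "\<dots> \<le> (\<Sum>j. ennreal L * ennreal (diameter (V j)))"
        using diam L by (intro suminf_le) (auto simp flip: ennreal_mult' intro!: ennreal_leI)
      also have "\<dots> = ennreal L * (\<Sum>j. ennreal (diameter (V j)))" by simp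
      also have "\<dots> \<le> ennreal L * (hausdorff1_outer A + ennreal (e / L))"
        by (intro mult_left_mono V) auto
      also have "\<dots> = ennreal L * hausdorff1_outer A + ennreal e"
        using L e by (simp add: distrib_left flip: ennreal_mult')
      finally show "hausdorff1_pre \<delta> (f ` A) \<le> ennreal L * hausdorff1_outer A + ennreal e" .
    qed
  qed
qed

lemma hausdorff1_outer_segment_le: "hausdorff1_outer (closed_segment a b) \<le> ennreal (dist a b)"
proof (rule hausdorff1_outer_le)
  fix \<delta> :: real assume \<delta>: "0 < \<delta>"
  obtain n :: nat where n: "0 < n" "dist a b / real n \<le> \<delta>"
  proof -
    obtain n :: nat where "dist a b / \<delta> \<le> real n" using real_arch_simple by blast
    then have "dist a b / real (Suc n) \<le> \<delta>" using \<delta> by (simp add: field_simps)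
    then show ?thesis using that[of "Suc n"] by simp
  qed
  define f where "f t = a + t *\<^sub>R (b - a)" for t :: real
  define V where "V j = (if j < n then f ` {real j / real n .. real (Suc j) / real n} else {})" for j
  have df: "norm (f s - f t) = \<bar>s - t\<bar> * dist a b" for s t
    by (simp add: f_def dist_norm norm_minus_commute flip: scaleR_diff_left)
  have diam: "diameter (V j) \<le> (if j < n then dist a b / real n else 0)" for j
  proof (cases "j < n")
    case True
    have "norm (x - y) \<le> dist a b / real n" if "x \<in> V j" "y \<in> V j" for x y
    proof -
      have "x \<in> f ` {real j / real n .. real (Suc j) / real n}" "y \<in> f ` {real j / real n .. real (Suc j) / real n}"
        using that True unfolding V_def by simp_all
      then obtain s t where "x = f s" "y = f t" "s \<in> {real j / real n .. real (Suc j) / real n}"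
        "t \<in> {real j / real n .. real (Suc j) / real n}"
        by blast
      moreover then have "\<bar>s - t\<bar> \<le> 1 / real n" by (auto simp: abs_le_iff add_divide_distrib)
      ultimately show ?thesis using mult_right_mono[of "\<bar>s - t\<bar>" "1 / real n" "dist a b"] by (simp add: df)
    qed
    then show ?thesis using True by (intro diameter_le) auto
  qed (simp add: V_def)
  have "hausdorff1_pre \<delta> (closed_segment a b) \<le> (\<Sum>j. ennreal (diameter (V j)))"
  proof (rule hausdorff1_pre_le)
    show "closed_segment a b \<subseteq> (\<Union>j. V j)"
    proof
      fix x assume "x \<in> closed_segment a b"
      then obtain t where t: "0 \<le> t" "t \<le> 1" "x = f t"
        by (auto simp: closed_segment_def f_def algebra_simps)
      define j where "j = (if t = 1 then n - 1 else nat \<lfloor>t * real n\<rfloor>)"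
      have "j < n \<and> real j \<le> t * real n \<and> t * real n \<le> real (Suc j)"
      proof (cases "t = 1")
        case False
        then have "t * real n < real n" "0 \<le> t * real n" using t n by auto
        moreover have "j = nat \<lfloor>t * real n\<rfloor>" using False by (simp add: j_def)
        ultimately show ?thesis by (auto simp: nat_less_iff floor_less_iff) linarith+
      qed (use n in \<open>auto simp: j_def of_nat_diff\<close>)
      then have "x \<in> V j" using t n by (auto simp: V_def field_simps)
      then show "x \<in> (\<Union>j. V j)" by blast
    qed
    show "bounded (V j)" for j
    proof -
      have "compact (f ` {real j / real n .. real (Suc j) / real n})"
        unfolding f_def by (intro compact_continuous_image continuous_intros compact_Icc)
      then show ?thesis by (auto simp: V_def compact_imp_bounded)
    qed
    show "diameter (V j) \<le> \<delta>" for j using diam[of j] n \<delta> by (auto split: if_splits)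
  qed
  also have "\<dots> \<le> (\<Sum>j. ennreal (if j < n then dist a b / real n else 0))"
    by (intro suminf_le ennreal_leI diam) auto
  also have "\<dots> = (\<Sum>j<n. ennreal (if j < n then dist a b / real n else 0))"
    by (rule suminf_finite) auto
  also have "\<dots> = ennreal (dist a b)"
    using n by (subst sum_ennreal) auto
  finally show "hausdorff1_pre \<delta> (closed_segment a b) \<le> ennreal (dist a b)" .
qed

text \<open>The distance to \<open>P\<close> maps \<open>C\<close> onto a set that contains \<open>{0..dist P Q}\<close>, and maps a covering set into an interval that is
  no longer than its diameter.\<close>

lemma dist_le_hausdorff1_outer_connected:
  assumes C: "connected C" "P \<in> C" "Q \<in> C"
  shows "ennreal (dist P Q) \<le> hausdorff1_outer C"
proof -
  have "ennreal (dist P Q) \<le> hausdorff1_pre 1 C"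
  proof (rule hausdorff1_pre_ge)
    fix V :: "nat \<Rightarrow> (real^2) set"
    assume cov: "C \<subseteq> (\<Union>j. V j)" and V: "\<forall>j. bounded (V j) \<and> diameter (V j) \<le> 1"
    define c where "c j = Inf (dist P ` V j)" for j
    have int: "dist P y \<in> {c j .. c j + diameter (V j)}" if "y \<in> V j" for y j
    proof -
      have "c j \<le> dist P y" unfolding c_def using that by (intro cInf_lower) (auto intro!: bdd_belowI)
      moreover have "dist P y - diameter (V j) \<le> c j" unfolding c_def
      proof (rule cInf_greatest)
        fix r assume "r \<in> dist P ` V j"
        then obtain x where "x \<in> V j" "r = dist P x" by blast
        then show "dist P y - diameter (V j) \<le> r"
          using diameter_bounded_bound[of "V j" x y] that V dist_triangle[of P y x] by (simp add: dist_commute)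
      qed (use that in auto)
      ultimately show ?thesis by simp
    qed
    have "connected (dist P ` C)" by (intro connected_continuous_image C continuous_intros)
    then have "{0 .. dist P Q} \<subseteq> dist P ` C"
      using C by (intro connected_contains_Icc) (auto simp: image_iff intro: bexI[of _ P])
    also have "\<dots> \<subseteq> (\<Union>j. {c j .. c j + diameter (V j)})" using cov int by blast
    finally have "emeasure lborel {0 .. dist P Q} \<le> emeasure lborel (\<Union>j. {c j .. c j + diameter (V j)})"
      by (intro emeasure_mono) auto
    also have "\<dots> \<le> (\<Sum>j. emeasure lborel {c j .. c j + diameter (V j)})"
      by (intro emeasure_subadditive_countably) auto
    also have "\<dots> = (\<Sum>j. ennreal (diameter (V j)))"
    proof (rule suminf_cong)
      fix j have "0 \<le> diameter (V j)" using V diameter_ge_0 by blast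
      then show "emeasure lborel {c j .. c j + diameter (V j)} = ennreal (diameter (V j))" by simp
    qed
    finally show "ennreal (dist P Q) \<le> (\<Sum>j. ennreal (diameter (V j)))" by simp
  qed
  also have "\<dots> \<le> hausdorff1_outer C" by (rule hausdorff1_pre_le_outer) simp
  finally show ?thesis .
qed

section \<open>Absolutely continuous arcs\<close>

text \<open>An enumeration with the empty set as filler, so that no member of the family is listed twice.\<close>

lemma countable_family_seq:
  assumes "countable D"
  obtains K :: "nat \<Rightarrow> 'a set" where "(\<Union>n. K n) = \<Union>D" "\<And>n. K n \<in> D \<or> K n = {}"
    "\<And>m n. m \<noteq> n \<Longrightarrow> K m = K n \<Longrightarrow> K m = {}"
proof
  define K where "K n = (if n \<in> to_nat_on D ` D then from_nat_into D n else {})" for n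
  show "K n \<in> D \<or> K n = {}" for n using assms by (auto simp: K_def)
  have K_to: "K (to_nat_on D A) = A" if "A \<in> D" for A using assms that by (auto simp: K_def)
  show "(\<Union>n. K n) = \<Union>D"
  proof
    show "(\<Union>n. K n) \<subseteq> \<Union>D" using \<open>\<And>n. K n \<in> D \<or> K n = {}\<close> by blast
    show "\<Union>D \<subseteq> (\<Union>n. K n)" using K_to by blast
  qed
  show "K m = {}" if "m \<noteq> n" "K m = K n" for m n
    using that assms by (auto simp: K_def split: if_splits)
qed

text \<open>A real version of \<open>covering_lemma\<close> with the cover indexed by the natural numbers. It serves to pass from finite families of
  intervals, for which absolute continuity is stated, to null sets.\<close>

lemma nonoverlapping_interval_cover:
  fixes T :: "real set"
  assumes U: "open U" "T \<subseteq> U" and T: "T \<subseteq> {a..b}" and \<eta>: "0 < \<eta>"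
  obtains K :: "nat \<Rightarrow> real set" where "T \<subseteq> (\<Union>n. K n)" "\<And>n. K n \<subseteq> U"
    "\<And>n. K n = {} \<or> (\<exists>c d. c \<le> d \<and> d - c < \<eta> \<and> K n = {c..d} \<and> K n \<inter> T \<noteq> {})"
    "disjoint_family (\<lambda>n. interior (K n))"
proof (cases "T = {}")
  case True
  then show thesis using that[of "\<lambda>_. {}"] by (simp add: disjoint_family_on_def)
next
  case False
  then have ab: "a \<le> b" using T by auto
  define g where "g x = (if x \<in> U then U \<inter> ball x (\<eta>/2) else ball x (\<eta>/2))" for x
  have gg: "gauge g" using U(1) \<eta> by (auto simp: gauge_def g_def)
  have TS: "T \<subseteq> cbox (a-1) (b+1)" and ne: "box (a-1) (b+1) \<noteq> {}" using T ab by (auto simp: box_real)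
  obtain D where D: "countable D" "\<Union>D \<subseteq> cbox (a-1) (b+1)"
      "\<And>K. K \<in> D \<Longrightarrow> interior K \<noteq> {} \<and> (\<exists>c d. K = cbox c d)"
      "pairwise (\<lambda>A B. interior A \<inter> interior B = {}) D"
      "\<And>K. K \<in> D \<Longrightarrow> \<exists>x \<in> T \<inter> K. K \<subseteq> g x"
      "\<And>u v. cbox u v \<in> D \<Longrightarrow> \<exists>n. \<forall>i \<in> Basis. v \<bullet> i - u \<bullet> i = ((b+1) \<bullet> i - (a-1) \<bullet> i) / 2^n"
      "T \<subseteq> \<Union>D"
  proof (rule covering_lemma[OF TS ne gg], goal_cases)
    case (1 D)
    show thesis by (rule 1(1)) (fact 1)+
  qed
  obtain K :: "nat \<Rightarrow> real set" where K: "(\<Union>n. K n) = \<Union>D" "\<And>n. K n \<in> D \<or> K n = {}"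
      "\<And>m n. m \<noteq> n \<Longrightarrow> K m = K n \<Longrightarrow> K m = {}"
    using countable_family_seq[OF D(1)] by blast
  show thesis
  proof (rule that)
    show "T \<subseteq> (\<Union>n. K n)" using D(7) K(1) by simp
    show "K n \<subseteq> U" for n
    proof (cases "K n = {}")
      case False
      then obtain x where "x \<in> T" "K n \<subseteq> g x" using K(2) D(5) by blast
      then show ?thesis using U(2) by (auto simp: g_def split: if_splits)
    qed simp
    show "K n = {} \<or> (\<exists>c d. c \<le> d \<and> d - c < \<eta> \<and> K n = {c..d} \<and> K n \<inter> T \<noteq> {})" for n
    proof (cases "K n = {}")
      case False
      then have KD: "K n \<in> D" using K(2) by blast
      then obtain c d x where c: "K n = {c..d}" and x: "x \<in> T" "x \<in> K n" "K n \<subseteq> g x"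
        using D(3,5) by (metis IntD1 IntD2 cbox_interval)
      have cd: "c \<le> d" using False c by simp
      have "K n \<subseteq> ball x (\<eta>/2)" using x by (auto simp: g_def split: if_splits)
      then have "c \<in> ball x (\<eta>/2)" "d \<in> ball x (\<eta>/2)" using c cd by auto
      then have "d - c < \<eta>" unfolding mem_ball dist_real_def by linarith
      with c cd x show ?thesis by blast
    qed simp
    show "disjoint_family (\<lambda>n. interior (K n))"
      unfolding disjoint_family_on_def
    proof (intro ballI impI)
      fix i j :: nat assume ij: "i \<noteq> j"
      show "interior (K i) \<inter> interior (K j) = {}"
      proof (cases "K i = {} \<or> K j = {}")
        case False
        then have "K i \<noteq> K j" "K i \<in> D" "K j \<in> D" using K(2)[of i] K(2)[of j] K(3)[OF ij] by auto
        then show ?thesis using D(4) by (auto simp: pairwise_def)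
      qed auto
    qed
  qed
qed

lemma abs_contE:
  assumes "abs_cont a b \<gamma>" "0 < e"
  obtains d where "0 < d" "\<forall>(n::nat) p q. (\<forall>i<n. a \<le> p i \<and> p i \<le> q i \<and> q i \<le> b) \<longrightarrow>
        (\<forall>i<n. \<forall>j<n. i \<noteq> j \<longrightarrow> {p i<..<q i} \<inter> {p j<..<q j} = {}) \<longrightarrow>
        (\<Sum>i<n. q i - p i) < d \<longrightarrow> (\<Sum>i<n. dist (\<gamma> (p i)) (\<gamma> (q i))) < e"
  using assms(1)[unfolded abs_cont_def, THEN spec, THEN mp, OF assms(2)] that by (elim exE conjE)

lemma abs_cont_continuous_on:
  assumes ac: "abs_cont a b \<gamma>"
  shows "continuous_on {a..b} \<gamma>"
  unfolding continuous_on_iff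
proof (intro ballI allI impI)
  fix x e :: real assume x: "x \<in> {a..b}" and e: "0 < e"
  obtain d where d: "d > 0" and H0: "\<forall>(n::nat) p q. (\<forall>i<n. a \<le> p i \<and> p i \<le> q i \<and> q i \<le> b) \<longrightarrow>
        (\<forall>i<n. \<forall>j<n. i \<noteq> j \<longrightarrow> {p i<..<q i} \<inter> {p j<..<q j} = {}) \<longrightarrow>
        (\<Sum>i<n. q i - p i) < d \<longrightarrow> (\<Sum>i<n. dist (\<gamma> (p i)) (\<gamma> (q i))) < e"
    by (rule abs_contE[OF ac e])
  note H = H0[THEN spec, THEN spec, THEN spec, THEN mp, THEN mp, THEN mp]
  have "dist (\<gamma> y) (\<gamma> x) < e" if "y \<in> {a..b}" "dist y x < d" for y
  proof -
    have "(\<Sum>i<(1::nat). dist (\<gamma> ((\<lambda>_. min x y) i)) (\<gamma> ((\<lambda>_. max x y) i))) < e"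
      by (rule H) (use x that in \<open>auto simp: dist_real_def min_def max_def\<close>)
    then show ?thesis by (auto simp: min_def max_def dist_commute split: if_splits)
  qed
  with d show "\<exists>d>0. \<forall>y\<in>{a..b}. dist y x < d \<longrightarrow> dist (\<gamma> y) (\<gamma> x) < e" by blast
qed

text \<open>On an interval of a fine cover of \<open>T\<close> the diameter of the image is the length of a single chord, so absolute continuity bounds the
  sum of the diameters.\<close>

lemma abs_cont_hausdorff1_small:
  assumes ac: "abs_cont a b \<gamma>" and e: "0 < e"
  obtains d where "0 < d"
    "\<And>T. T \<in> sets borel \<Longrightarrow> T \<subseteq> {a..b} \<Longrightarrow> emeasure lborel T < ennreal d \<Longrightarrow> hausdorff1_outer (\<gamma> ` T) \<le> ennreal e"
proof -
  obtain d where d: "d > 0" and H0: "\<forall>(n::nat) p q. (\<forall>i<n. a \<le> p i \<and> p i \<le> q i \<and> q i \<le> b) \<longrightarrow>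
        (\<forall>i<n. \<forall>j<n. i \<noteq> j \<longrightarrow> {p i<..<q i} \<inter> {p j<..<q j} = {}) \<longrightarrow>
        (\<Sum>i<n. q i - p i) < d \<longrightarrow> (\<Sum>i<n. dist (\<gamma> (p i)) (\<gamma> (q i))) < e"
    by (rule abs_contE[OF ac e])
  note H = H0[THEN spec, THEN spec, THEN spec, THEN mp, THEN mp, THEN mp]
  have cont: "continuous_on {a..b} \<gamma>" by (rule abs_cont_continuous_on[OF ac])
  show ?thesis
  proof
    show "0 < d" by fact
    fix T :: "real set" assume T: "T \<in> sets borel" "T \<subseteq> {a..b}" and small: "emeasure lborel T < ennreal d"
    show "hausdorff1_outer (\<gamma> ` T) \<le> ennreal e"
    proof (cases "T = {}")
      case False
      then have ab: "a \<le> b" using T by auto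
      have "\<exists>t. 0 \<le> t \<and> t < d \<and> emeasure lborel T = ennreal t"
        using small by (cases "emeasure lborel T") (auto simp: ennreal_less_iff)
      then obtain t where t: "0 \<le> t" "t < d" "emeasure lborel T = ennreal t" by blast
      obtain U where U: "open U" "T \<subseteq> U" "emeasure lborel (U - T) < ennreal (d - t)"
        using outer_regular_lborel[OF T(1), of "d - t"] t by auto
      have "emeasure lborel U = emeasure lborel T + emeasure lborel (U - T)"
        using U T by (subst plus_emeasure) (auto intro!: arg_cong[of _ _ "emeasure lborel"])
      also have "\<dots> < ennreal t + ennreal (d - t)"
        unfolding t(3) using U(3) by (simp add: ennreal_add_left_cancel_less)
      finally have Ud: "emeasure lborel U < ennreal d" using t by (simp flip: ennreal_plus)
      show ?thesis
      proof (rule hausdorff1_outer_le)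
        fix \<delta> :: real assume \<delta>: "0 < \<delta>"
        have "uniformly_continuous_on {a..b} \<gamma>"
          by (intro compact_uniformly_continuous cont compact_Icc)
        then obtain \<eta> where \<eta>: "0 < \<eta>"
          "\<And>x y. x \<in> {a..b} \<Longrightarrow> y \<in> {a..b} \<Longrightarrow> dist y x < \<eta> \<Longrightarrow> dist (\<gamma> y) (\<gamma> x) < \<delta>"
          using \<delta> unfolding uniformly_continuous_on_def by meson
        obtain K :: "nat \<Rightarrow> real set" where K: "T \<subseteq> (\<Union>n. K n)" "\<And>n. K n \<subseteq> U"
            "\<And>n. K n = {} \<or> (\<exists>c d. c \<le> d \<and> d - c < \<eta> \<and> K n = {c..d} \<and> K n \<inter> T \<noteq> {})"
            "disjoint_family (\<lambda>n. interior (K n))"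
        proof (rule nonoverlapping_interval_cover[OF U(1,2) T(2) \<eta>(1)], goal_cases)
          case (1 K)
          show thesis by (rule 1(1)) (fact 1)+
        qed
        define V where "V n = \<gamma> ` (K n \<inter> {a..b})" for n
        have "\<exists>p q. a \<le> p \<and> p \<le> q \<and> q \<le> b \<and> (K n = {} \<and> p = q \<or> {p..q} \<subseteq> K n) \<and> bounded (V n) \<and> diameter (V n) = dist (\<gamma> p) (\<gamma> q)
               \<and> q - p < \<eta>" for n
        proof (cases "K n = {}")
          case True
          then show ?thesis using ab \<eta>(1) by (intro exI[of _ a]) (auto simp: V_def)
        next
          case False
          then obtain c c' x where c: "K n = {c..c'}" "c' - c < \<eta>" and x: "x \<in> T" "x \<in> K n"
            using K(3)[of n] by blast
          have cpt: "compact (K n \<inter> {a..b})" unfolding c(1) by auto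
          then have "compact (V n)" unfolding V_def
            by (intro compact_continuous_image continuous_on_subset[OF cont]) auto
          moreover have "V n \<noteq> {}" using x T by (auto simp: V_def)
          ultimately obtain y z where yz: "y \<in> V n" "z \<in> V n" "dist y z = diameter (V n)"
            using diameter_compact_attained by blast
          then obtain p q where pq: "p \<in> K n" "p \<in> {a..b}" "q \<in> K n" "q \<in> {a..b}" "y = \<gamma> p" "z = \<gamma> q"
            by (auto simp: V_def)
          have pqd: "\<bar>p - q\<bar> < \<eta>" using pq(1,3) c by auto
          show ?thesis
            by (rule exI[of _ "min p q"], rule exI[of _ "max p q"])
               (use pq pqd yz c(1) \<open>compact (V n)\<close> in \<open>auto simp: min_def max_def dist_commute compact_imp_bounded\<close>)
        qed
        then obtain p q where pq: "\<And>n. a \<le> p n" "\<And>n. p n \<le> q n" "\<And>n. q n \<le> b"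
          "\<And>n. K n = {} \<and> p n = q n \<or> {p n..q n} \<subseteq> K n" "\<And>n. bounded (V n)"
          "\<And>n. diameter (V n) = dist (\<gamma> (p n)) (\<gamma> (q n))" "\<And>n. q n - p n < \<eta>"
          by metis
        have sub: "{p n<..<q n} \<subseteq> K n" for n
        proof -
          have "{p n<..<q n} \<subseteq> {p n..q n}" by auto
          then show ?thesis using pq(4)[of n] by auto
        qed
        have disj: "{p i<..<q i} \<inter> {p j<..<q j} = {}" if "i \<noteq> j" for i j
        proof -
          have "{p n<..<q n} \<subseteq> interior (K n)" for n
            by (intro interior_maximal sub) auto
          then show ?thesis using disjoint_family_onD[OF K(4) _ _ that] by blast
        qed
        have "ennreal (\<Sum>i<N. q i - p i) < ennreal d" for N
        proof -
          have "ennreal (\<Sum>i<N. q i - p i) = (\<Sum>i<N. emeasure lborel {p i<..<q i})"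
            using pq(2) by (simp add: sum_ennreal)
          also have "\<dots> = emeasure lborel (\<Union>i<N. {p i<..<q i})"
            using disj by (intro sum_emeasure) (auto simp: disjoint_family_on_def)
          also have "\<dots> \<le> emeasure lborel U"
          proof (rule emeasure_mono)
            show "(\<Union>i<N. {p i<..<q i}) \<subseteq> U" using sub K(2) by blast
          qed (use U(1) in auto)
          finally show ?thesis using Ud by (rule le_less_trans)
        qed
        then have len: "(\<Sum>i<N. q i - p i) < d" for N
          using pq(2) by (subst (asm) ennreal_less_iff) (auto intro!: sum_nonneg)
        have fin: "(\<Sum>i<N. dist (\<gamma> (p i)) (\<gamma> (q i))) < e" for N
          using pq disj len by (intro H) auto
        have "hausdorff1_pre \<delta> (\<gamma> ` T) \<le> (\<Sum>j. ennreal (diameter (V j)))"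
        proof (rule hausdorff1_pre_le)
          have "T \<subseteq> (\<Union>j. K j \<inter> {a..b})" using K(1) T(2) by auto
          then show "\<gamma> ` T \<subseteq> (\<Union>j. V j)" unfolding V_def image_UN[symmetric] by (rule image_mono)
          show "bounded (V j)" for j by (rule pq)
          show "diameter (V j) \<le> \<delta>" for j
          proof -
            have "p j \<in> {a..b}" "q j \<in> {a..b}" using pq(1-3)[of j] by auto
            moreover have "dist (p j) (q j) < \<eta>" using pq(2,7)[of j] by (simp add: dist_real_def)
            ultimately show ?thesis using \<eta>(2)[of "q j" "p j"] by (simp add: pq(6))
          qed
        qed
        also have "\<dots> \<le> ennreal e" unfolding suminf_eq_SUP
        proof (rule SUP_least)
          fix N
          have "(\<Sum>j<N. ennreal (diameter (V j))) = ennreal (\<Sum>i<N. dist (\<gamma> (p i)) (\<gamma> (q i)))"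
            by (simp add: pq(6) sum_ennreal)
          then show "(\<Sum>j<N. ennreal (diameter (V j))) \<le> ennreal e"
            using fin[of N] by (simp add: ennreal_leI)
        qed
        finally show "hausdorff1_pre \<delta> (\<gamma> ` T) \<le> ennreal e" .
      qed
    qed simp
  qed
qed

lemma abs_cont_null_image:
  assumes ac: "abs_cont a b \<gamma>" and T: "T \<in> null_sets lborel" "T \<subseteq> {a..b}"
  shows "hausdorff1_outer (\<gamma> ` T) = 0"
proof -
  have "hausdorff1_outer (\<gamma> ` T) \<le> 0"
  proof (rule ennreal_le_epsilon)
    fix e :: real assume "0 < e"
    then obtain d where "0 < d" "\<And>T. T \<in> sets borel \<Longrightarrow> T \<subseteq> {a..b} \<Longrightarrow> emeasure lborel T < ennreal d \<Longrightarrow> hausdorff1_outer (\<gamma> ` T) \<le> ennreal e"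
      by (rule abs_cont_hausdorff1_small[OF ac]) blast
    then show "hausdorff1_outer (\<gamma> ` T) \<le> 0 + ennreal e" using T by (auto simp: null_sets_def)
  qed
  then show ?thesis by simp
qed

text \<open>Finitely many intervals of length at most \<open>d / 2\<close> cover the parameter interval, and each has an image of measure at most one.\<close>

lemma abs_cont_finite_length:
  assumes ac: "abs_cont a b \<gamma>"
  shows "hausdorff1_outer (\<gamma> ` {a..b}) < top"
proof (cases "a < b")
  case True
  obtain d where d: "0 < d" "\<And>T. T \<in> sets borel \<Longrightarrow> T \<subseteq> {a..b} \<Longrightarrow> emeasure lborel T < ennreal d \<Longrightarrow> hausdorff1_outer (\<gamma> ` T) \<le> ennreal 1"
    by (rule abs_cont_hausdorff1_small[OF ac zero_less_one]) blast
  have step: "hausdorff1_outer (\<gamma> ` {a..min b (a + real n * (d/2))}) < top" for n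
  proof (induction n)
    case 0
    have "hausdorff1_outer (\<gamma> ` {a..min b (a + real 0 * (d/2))}) \<le> hausdorff1_outer {\<gamma> a}"
      by (rule hausdorff1_outer_mono) (use True in auto)
    then show ?case by simp
  next
    case (Suc n)
    let ?m = "min b (a + real n * (d/2))" and ?m' = "min b (a + real (Suc n) * (d/2))"
    define t where "t = a + real n * (d/2)"
    have t: "a + real n * (d/2) = t" "a + real (Suc n) * (d/2) = t + d/2"
      unfolding t_def of_nat_Suc distrib_right by linarith+
    have le: "?m \<le> ?m'" "?m' - ?m < d" unfolding t using d(1) by (auto simp: min_def)
    have am: "a \<le> ?m" using True d(1) by auto
    have "{a..?m'} \<subseteq> {a..?m} \<union> {?m..?m'}" unfolding t by auto
    then have "\<gamma> ` {a..?m'} \<subseteq> \<gamma> ` {a..?m} \<union> \<gamma> ` {?m..?m'}" by (metis image_Un image_mono)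
    then have "hausdorff1_outer (\<gamma> ` {a..?m'}) \<le> hausdorff1_outer (\<gamma> ` {a..?m}) + hausdorff1_outer (\<gamma> ` {?m..?m'})"
      using hausdorff1_outer_mono hausdorff1_outer_Un order_trans by blast
    also have "\<dots> \<le> hausdorff1_outer (\<gamma> ` {a..?m}) + ennreal 1"
    proof (intro add_left_mono d(2))
      show "{?m..?m'} \<subseteq> {a..b}" using am by auto
      show "emeasure lborel {?m..?m'} < ennreal d"
        unfolding emeasure_lborel_Icc[OF le(1)] using le d(1) by (intro ennreal_lessI)
    qed auto
    also have "\<dots> < top" using Suc by simp
    finally show ?case .
  qed
  obtain n :: nat where "(b - a) / (d/2) \<le> real n" using real_arch_simple by blast
  then have "b \<le> a + real n * (d/2)" using d(1) by (simp add: field_simps)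
  then show ?thesis using step[of n] by (simp add: min_absorb1)
next
  case False
  then have "{a..b} \<subseteq> {a}" by auto
  then have "hausdorff1_outer (\<gamma> ` {a..b}) \<le> hausdorff1_outer {\<gamma> a}"
    by (intro hausdorff1_outer_mono) auto
  then show ?thesis by simp
qed

section \<open>Comparison of set functions by Vitali coverings\<close>

text \<open>What the covering argument uses of the smaller side of a comparison. Additivity is not assumed, because \<open>\<kappa>\<close> will be the
  measure of the image of a set under a map that is not injective.\<close>

locale lebesgue_null_premeasure =
  fixes \<kappa> :: "real set \<Rightarrow> ennreal"
  assumes mono: "\<And>A B. A \<in> sets borel \<Longrightarrow> B \<in> sets borel \<Longrightarrow> A \<subseteq> B \<Longrightarrow> \<kappa> A \<le> \<kappa> B"
    and subadd: "\<And>A. range A \<subseteq> sets borel \<Longrightarrow> \<kappa> (\<Union>i::nat. A i) \<le> (\<Sum>i. \<kappa> (A i))"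
    and null: "\<And>N. N \<in> null_sets lborel \<Longrightarrow> \<kappa> N = 0"
begin

lemma empty [simp]: "\<kappa> {} = 0" by (rule null) simp

lemma Un: "A \<in> sets borel \<Longrightarrow> B \<in> sets borel \<Longrightarrow> \<kappa> (A \<union> B) \<le> \<kappa> A + \<kappa> B"
proof -
  assume AB: "A \<in> sets borel" "B \<in> sets borel"
  let ?C = "\<lambda>n::nat. if n = 0 then A else if n = 1 then B else {}"
  have "A \<union> B = (\<Union>n. ?C n)" by (auto split: if_splits)
  moreover have "range ?C \<subseteq> sets borel" using AB by auto
  ultimately have "\<kappa> (A \<union> B) \<le> (\<Sum>n. \<kappa> (?C n))" using subadd[of ?C] by presburger
  also have "\<dots> = (\<Sum>n\<in>{0,1}. \<kappa> (?C n))" by (rule suminf_finite) auto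
  finally show ?thesis by simp
qed

text \<open>Choose an open set around \<open>E\<close> that is only slightly larger for \<open>\<mu>\<close> and for Lebesgue measure. By Vitali's theorem,
  disjoint intervals inside it that satisfy the hypothesis cover \<open>E\<close> up to a null set, which \<open>\<kappa>\<close> ignores.\<close>

lemma vitali_comparison:
  assumes \<mu>: "sets \<mu> = sets borel" "emeasure \<mu> UNIV \<noteq> \<infinity>" and E: "E \<in> sets borel"
    and c: "0 \<le> c1" "0 \<le> c2"
    and cov: "\<And>x d. x \<in> E \<Longrightarrow> 0 < d \<Longrightarrow> \<exists>u v. u \<le> x \<and> x \<le> v \<and> u < v \<and> v - u < d \<and>
        \<kappa> {u..v} \<le> ennreal c1 * emeasure \<mu> {u..v} + ennreal c2 * ennreal (v - u)"
  shows "\<kappa> E \<le> ennreal c1 * emeasure \<mu> E + ennreal c2 * emeasure lborel E"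
proof (rule ennreal_le_epsilon)
  have [measurable_cong]: "sets \<mu> = sets borel" by (rule \<mu>(1))
  fix e :: real assume e: "0 < e"
  define e' where "e' = e / (c1 + c2 + 1)"
  have e': "0 < e'" using e c by (simp add: e'_def)
  have "(INF U \<in> {U. E \<subseteq> U \<and> open U}. emeasure \<mu> U) = emeasure \<mu> E"
    using outer_regular[OF \<mu>(1) _ E] \<mu>(2) sets_eq_imp_space_eq[OF \<mu>(1)] by simp
  moreover have "emeasure \<mu> E < emeasure \<mu> E + ennreal e'"
  proof -
    have "emeasure \<mu> E \<le> emeasure \<mu> UNIV" by (rule emeasure_mono) (auto simp: \<mu>)
    then have "emeasure \<mu> E \<noteq> top" using \<mu>(2) by (auto simp: top_unique)
    then show ?thesis using e' by (simp add: ennreal_add_left_cancel_less)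
  qed
  ultimately obtain O1 where O1: "open O1" "E \<subseteq> O1" "emeasure \<mu> O1 \<le> emeasure \<mu> E + ennreal e'"
    by (metis (mono_tags, lifting) INF_less_iff less_imp_le mem_Collect_eq)
  obtain O2 where O2: "open O2" "E \<subseteq> O2" "emeasure lborel (O2 - E) < ennreal e'"
    using outer_regular_lborel[OF E e'] by auto
  have lO2: "emeasure lborel O2 \<le> emeasure lborel E + ennreal e'"
  proof -
    have "emeasure lborel O2 = emeasure lborel E + emeasure lborel (O2 - E)"
      using O2 E by (subst plus_emeasure) (auto intro!: arg_cong[of _ _ "emeasure lborel"])
    then show ?thesis using O2(3) by (simp add: add_left_mono less_imp_le)
  qed
  define O' where "O' = O1 \<inter> O2"
  have O': "open O'" "E \<subseteq> O'" using O1 O2 by (auto simp: O'_def)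
  \<comment> \<open>Intervals are indexed by their end points and presented to Vitali's theorem as balls.\<close>
  define F where "F = {(u, v). u < v \<and> {u..v} \<subseteq> O' \<and>
     \<kappa> {u..v} \<le> ennreal c1 * emeasure \<mu> {u..v} + ennreal c2 * ennreal (v - u)}"
  let ?m = "\<lambda>(u::real, v). (u + v) / 2" and ?r = "\<lambda>(u::real, v). (v - u) / 2"
  have cb: "cball (?m i) (?r i) = {fst i..snd i}" for i
    by (cases i) (auto simp: cball_eq_atLeastAtMost field_simps)
  obtain C where C: "countable C" "C \<subseteq> F"
     "pairwise (\<lambda>i j. disjnt (cball (?m i) (?r i)) (cball (?m j) (?r j))) C"
     "negligible (E - (\<Union>i\<in>C. cball (?m i) (?r i)))"
  proof (rule Vitali_covering_theorem_cballs[where a="?m" and r="?r" and K=F and S=E])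
    show "0 < ?r i" if "i \<in> F" for i using that by (auto simp: F_def)
    fix x d :: real assume x: "x \<in> E" and d: "0 < d"
    then obtain \<eta> where \<eta>: "0 < \<eta>" "ball x \<eta> \<subseteq> O'" using O' by (meson openE subsetD)
    obtain u v where uv: "u \<le> x" "x \<le> v" "u < v" "v - u < min d \<eta>"
       "\<kappa> {u..v} \<le> ennreal c1 * emeasure \<mu> {u..v} + ennreal c2 * ennreal (v - u)"
      using cov[OF x, of "min d \<eta>"] d \<eta> by auto
    have "{u..v} \<subseteq> ball x \<eta>" using uv by (auto simp: dist_real_def)
    then have "(u, v) \<in> F" using uv \<eta> by (auto simp: F_def)
    then show "\<exists>i. i \<in> F \<and> x \<in> cball (?m i) (?r i) \<and> ?r i < d"
      unfolding cb using uv by (intro exI[of _ "(u, v)"]) auto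
  qed
  define D where "D = (\<lambda>i. {fst i..snd i}) ` C"
  have D: "countable D" "disjoint D"
    using C(1,3) by (auto simp: D_def cb pairwise_def disjnt_def disjoint_def)
  obtain K :: "nat \<Rightarrow> real set" where K: "(\<Union>n. K n) = \<Union>D" "\<And>n. K n \<in> D \<or> K n = {}"
            "\<And>m n. m \<noteq> n \<Longrightarrow> K m = K n \<Longrightarrow> K m = {}"
    using countable_family_seq[OF D(1)] by blast
  have Kprop: "K n \<in> sets borel \<and> K n \<subseteq> O' \<and> \<kappa> (K n) \<le> ennreal c1 * emeasure \<mu> (K n) + ennreal c2 * emeasure lborel (K n)" for n
  proof (cases "K n = {}")
    case False
    then have "K n \<in> D" using K(2)[of n] by simp
    then obtain i where i: "i \<in> C" "K n = {fst i..snd i}" unfolding D_def by blast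
    then have "(fst i, snd i) \<in> F" using C(2) by auto
    with i(2) obtain u v where "(u, v) \<in> F" "K n = {u..v}" by blast
    then show ?thesis by (auto simp: F_def)
  qed simp
  have disjK: "disjoint_family K"
    unfolding disjoint_family_on_def using K(2,3) D(2) by (metis disjointD inf_bot_left inf_bot_right)
  have Km: "K n \<in> sets borel" for n using Kprop by blast
  then have U: "(\<Union>n. K n) \<in> sets borel" by auto
  have "negligible (E - (\<Union>n. K n))" using C(4) unfolding cb K(1) D_def by simp
  then have "E - (\<Union>n. K n) \<in> null_sets lborel"
    using E U by (simp add: negligible_iff_null_sets null_sets_def)
  then have z: "\<kappa> (E - (\<Union>n. K n)) = 0" by (rule null)
  have "\<kappa> E \<le> \<kappa> ((E - (\<Union>n. K n)) \<union> (\<Union>n. K n))" using E U by (intro mono) auto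
  also have "\<dots> \<le> \<kappa> (\<Union>n. K n)" using Un[of "E - (\<Union>n. K n)" "\<Union>n. K n"] E U z by simp
  also have "\<dots> \<le> (\<Sum>n. \<kappa> (K n))" using Km by (intro subadd) auto
  also have "\<dots> \<le> (\<Sum>n. ennreal c1 * emeasure \<mu> (K n) + ennreal c2 * emeasure lborel (K n))"
    using Kprop by (intro suminf_le) auto
  also have "\<dots> = ennreal c1 * (\<Sum>n. emeasure \<mu> (K n)) + ennreal c2 * (\<Sum>n. emeasure lborel (K n))"
    by (simp flip: suminf_add)
  also have "\<dots> = ennreal c1 * emeasure \<mu> (\<Union>n. K n) + ennreal c2 * emeasure lborel (\<Union>n. K n)"
    using Km disjK \<mu>(1) by (subst (1 2) suminf_emeasure) auto
  also have "\<dots> \<le> ennreal c1 * emeasure \<mu> O1 + ennreal c2 * emeasure lborel O2"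
    using Kprop O1(1) O2(1) \<mu>(1) by (intro add_mono mult_left_mono emeasure_mono) (auto simp: O'_def)
  also have "\<dots> \<le> ennreal c1 * (emeasure \<mu> E + ennreal e') + ennreal c2 * (emeasure lborel E + ennreal e')"
    using O1 lO2 by (intro add_mono mult_left_mono) auto
  also have "\<dots> = (ennreal c1 * emeasure \<mu> E + ennreal c2 * emeasure lborel E) + ennreal ((c1 + c2) * e')"
    using c e' by (simp add: algebra_simps ennreal_mult)
  also have "\<dots> \<le> (ennreal c1 * emeasure \<mu> E + ennreal c2 * emeasure lborel E) + ennreal e"
    using c e by (intro add_left_mono ennreal_leI) (simp add: e'_def field_simps)
  finally show "\<kappa> E \<le> ennreal c1 * emeasure \<mu> E + ennreal c2 * emeasure lborel E + ennreal e" .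
qed

text \<open>On the level sets \<open>L k\<close> the density is constant up to \<open>\<epsilon>\<close>, so the comparison with a constant factor applies.\<close>

lemma vitali_comparison_integral:
  assumes \<mu>: "sets \<mu> = sets borel" "emeasure \<mu> UNIV \<noteq> \<infinity>" and E: "E \<in> sets borel" "emeasure lborel E < \<infinity>"
    and G: "G \<in> borel_measurable borel" "\<And>x. 0 \<le> G x"
    and cov: "\<And>x d \<epsilon>. x \<in> E \<Longrightarrow> 0 < d \<Longrightarrow> 0 < \<epsilon> \<Longrightarrow> \<exists>u v. u \<le> x \<and> x \<le> v \<and> u < v \<and> v - u < d \<and>
        \<kappa> {u..v} \<le> ennreal (G x) * emeasure \<mu> {u..v} + ennreal \<epsilon> * ennreal (v - u)"
  shows "\<kappa> E \<le> (\<integral>\<^sup>+x\<in>E. ennreal (G x) \<partial>\<mu>)"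
proof (rule ennreal_le_epsilon)
  note [measurable] = G(1) E(1) and [measurable_cong] = \<mu>(1)
  fix e :: real assume e: "0 < e"
  have finE: "emeasure \<mu> E < top" "emeasure lborel E < top"
    using E(2) emeasure_mono[of E UNIV \<mu>] \<mu> by (auto simp: top_unique less_top)
  define m where "m = enn2real (emeasure \<mu> E) + enn2real (emeasure lborel E)"
  have m: "emeasure \<mu> E + emeasure lborel E = ennreal m" "0 \<le> m"
    using finE by (auto simp: m_def ennreal_enn2real_if)
  define \<epsilon> where "\<epsilon> = e / (m + 1)"
  have \<epsilon>: "0 < \<epsilon>" using e m by (simp add: \<epsilon>_def)
  define L where "L k = {x \<in> E. real k * \<epsilon> \<le> G x \<and> G x < real (Suc k) * \<epsilon>}" for k
  have Lm[measurable]: "L k \<in> sets borel" for k unfolding L_def by measurable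
  have EL: "E = (\<Union>k. L k)"
  proof -
    have "x \<in> L (nat \<lfloor>G x / \<epsilon>\<rfloor>)" if "x \<in> E" for x
    proof -
      have "0 \<le> G x / \<epsilon>" using G(2)[of x] \<epsilon> by simp
      then have "real (nat \<lfloor>G x / \<epsilon>\<rfloor>) \<le> G x / \<epsilon>" "G x / \<epsilon> < real (Suc (nat \<lfloor>G x / \<epsilon>\<rfloor>))" by linarith+
      then show ?thesis using that \<epsilon> by (simp add: L_def field_simps)
    qed
    then show ?thesis by (auto simp: L_def)
  qed
  have disjL: "disjoint_family L"
  proof -
    have "j \<le> k" if "x \<in> L j" "x \<in> L k" for x j k
    proof -
      have "real j * \<epsilon> < real (Suc k) * \<epsilon>" using that by (auto simp: L_def)
      then show ?thesis using \<epsilon> by simp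
    qed
    then show ?thesis unfolding disjoint_family_on_def by (blast intro: antisym)
  qed
  have "\<kappa> (L k) \<le> (\<integral>\<^sup>+x\<in>L k. ennreal (G x) \<partial>\<mu>) + ennreal \<epsilon> * (emeasure \<mu> (L k) + emeasure lborel (L k))" for k
  proof -
    have "\<kappa> (L k) \<le> ennreal (real (Suc k) * \<epsilon>) * emeasure \<mu> (L k) + ennreal \<epsilon> * emeasure lborel (L k)"
    proof (rule vitali_comparison[OF \<mu> Lm])
      fix x d :: real assume x: "x \<in> L k" and d: "0 < d"
      then have "x \<in> E" "G x \<le> real (Suc k) * \<epsilon>" by (auto simp: L_def)
      then obtain u v where uv: "u \<le> x" "x \<le> v" "u < v" "v - u < d"
        "\<kappa> {u..v} \<le> ennreal (G x) * emeasure \<mu> {u..v} + ennreal \<epsilon> * ennreal (v - u)"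
        using cov[of x d \<epsilon>] d \<epsilon> by blast
      moreover have "ennreal (G x) * emeasure \<mu> {u..v} \<le> ennreal (real (Suc k) * \<epsilon>) * emeasure \<mu> {u..v}"
        using \<open>G x \<le> _\<close> by (intro mult_right_mono ennreal_leI) auto
      ultimately show "\<exists>u v. u \<le> x \<and> x \<le> v \<and> u < v \<and> v - u < d \<and>
        \<kappa> {u..v} \<le> ennreal (real (Suc k) * \<epsilon>) * emeasure \<mu> {u..v} + ennreal \<epsilon> * ennreal (v - u)"
        by (meson add_right_mono order_trans)
    qed (use \<epsilon> in auto)
    also have "ennreal (real (Suc k) * \<epsilon>) * emeasure \<mu> (L k) = ennreal (real k * \<epsilon>) * emeasure \<mu> (L k) + ennreal \<epsilon> * emeasure \<mu> (L k)"
      using \<epsilon> by (simp add: distrib_right flip: ennreal_plus) (simp add: algebra_simps)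
    also have "ennreal (real k * \<epsilon>) * emeasure \<mu> (L k) = (\<integral>\<^sup>+x\<in>L k. ennreal (real k * \<epsilon>) \<partial>\<mu>)"
      by (simp add: nn_integral_cmult_indicator)
    also have "\<dots> \<le> (\<integral>\<^sup>+x\<in>L k. ennreal (G x) \<partial>\<mu>)"
      by (intro nn_integral_mono) (auto simp: L_def indicator_def intro: ennreal_leI)
    finally show ?thesis by (simp add: distrib_left add.assoc add_right_mono)
  qed
  then have "(\<Sum>k. \<kappa> (L k)) \<le> (\<Sum>k. (\<integral>\<^sup>+x\<in>L k. ennreal (G x) \<partial>\<mu>) + ennreal \<epsilon> * (emeasure \<mu> (L k) + emeasure lborel (L k)))"
    by (intro suminf_le) auto
  also have "\<dots> = (\<Sum>k. \<integral>\<^sup>+x\<in>L k. ennreal (G x) \<partial>\<mu>) + ennreal \<epsilon> * ((\<Sum>k. emeasure \<mu> (L k)) + (\<Sum>k. emeasure lborel (L k)))"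
    by (simp flip: suminf_add)
  also have "(\<Sum>k. emeasure \<mu> (L k)) = emeasure \<mu> E"
    unfolding EL using disjL by (intro suminf_emeasure) (auto simp: \<mu>)
  also have "(\<Sum>k. emeasure lborel (L k)) = emeasure lborel E"
    unfolding EL using disjL by (intro suminf_emeasure) auto
  also have "(\<Sum>k. \<integral>\<^sup>+x\<in>L k. ennreal (G x) \<partial>\<mu>) = (\<Sum>k. emeasure (density \<mu> (\<lambda>x. ennreal (G x))) (L k))"
    by (subst emeasure_density) auto
  also have "\<dots> = emeasure (density \<mu> (\<lambda>x. ennreal (G x))) E"
    unfolding EL using disjL by (intro suminf_emeasure) (auto simp: \<mu>)
  also have "\<dots> = (\<integral>\<^sup>+x\<in>E. ennreal (G x) \<partial>\<mu>)"
    by (subst emeasure_density) auto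
  also have "ennreal \<epsilon> * (emeasure \<mu> E + emeasure lborel E) \<le> ennreal e"
    unfolding m using e m \<epsilon> by (simp flip: ennreal_mult) (simp add: \<epsilon>_def field_simps)
  finally have "(\<Sum>k. \<kappa> (L k)) \<le> (\<integral>\<^sup>+x\<in>E. ennreal (G x) \<partial>\<mu>) + ennreal e"
    by (simp add: add_left_mono)
  moreover have "\<kappa> E \<le> (\<Sum>k. \<kappa> (L k))" unfolding EL using Lm by (intro subadd) auto
  ultimately show "\<kappa> E \<le> (\<integral>\<^sup>+x\<in>E. ennreal (G x) \<partial>\<mu>) + ennreal e" by (rule order_trans[rotated])
qed

end

lemma lebesgue_null_premeasure_measure:
  assumes "sets M = sets borel" "\<And>N. N \<in> null_sets lborel \<Longrightarrow> emeasure M N = 0"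
  shows "lebesgue_null_premeasure (emeasure M)"
  using assms by unfold_locales (auto intro!: emeasure_mono emeasure_subadditive_countably)

section \<open>Differentiability of monotone functions\<close>

text \<open>Such a set is a countable intersection of unions of open intervals, whatever the condition \<open>Q\<close>.\<close>

lemma small_interval_limsup_borel:
  "{x::real. \<forall>d>0. \<exists>u v. u < x \<and> x < v \<and> v - u < d \<and> Q u v} \<in> sets borel"
proof -
  let ?W = "\<lambda>n. (\<Union>(u, v)\<in>{(u, v). v - u < 1 / real (Suc n) \<and> Q u v}. {u<..<v})"
  have "{x. \<forall>d>0. \<exists>u v. u < x \<and> x < v \<and> v - u < d \<and> Q u v} = (\<Inter>n. ?W n)"
  proof (intro equalityI subsetI)
    fix x assume "x \<in> {x. \<forall>d>0. \<exists>u v. u < x \<and> x < v \<and> v - u < d \<and> Q u v}"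
    then have H: "\<And>d. 0 < d \<Longrightarrow> \<exists>u v. u < x \<and> x < v \<and> v - u < d \<and> Q u v" by blast
    show "x \<in> (\<Inter>n. ?W n)"
    proof
      fix n show "x \<in> ?W n" using H[of "1 / real (Suc n)"] by fastforce
    qed
  next
    fix x assume x: "x \<in> (\<Inter>n. ?W n)"
    show "x \<in> {x. \<forall>d>0. \<exists>u v. u < x \<and> x < v \<and> v - u < d \<and> Q u v}"
    proof (intro CollectI allI impI)
      fix d :: real assume "0 < d"
      then obtain n where n: "1 / real (Suc n) < d" using nat_approx_posE by blast
      have "x \<in> ?W n" using x by blast
      then obtain u v where "v - u < 1 / real (Suc n)" "Q u v" "u < x" "x < v" by auto
      then show "\<exists>u v. u < x \<and> x < v \<and> v - u < d \<and> Q u v" using n by (meson order_less_trans)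
    qed
  qed
  moreover have "?W n \<in> sets borel" for n by (intro borel_open open_UN) auto
  then have "(\<Inter>n. ?W n) \<in> sets borel" by (intro sets.countable_INT) auto
  ultimately show ?thesis by simp
qed

lemma emeasure_interval_measure_bounded:
  assumes F: "mono F" "continuous_on UNIV F" and bdd: "\<And>x. \<bar>F x\<bar> \<le> C"
  shows "emeasure (interval_measure F) UNIV \<le> ennreal (2 * C)"
proof -
  have "(\<Union>n. {- real n .. real n}) = UNIV"
    by (auto simp: set_eq_iff) (metis abs_le_iff minus_le_iff real_arch_simple)
  moreover have "(SUP n. emeasure (interval_measure F) {- real n .. real n}) = emeasure (interval_measure F) (\<Union>n. {- real n .. real n})"
    by (rule SUP_emeasure_incseq) (auto simp: incseq_def)
  moreover have "emeasure (interval_measure F) {- real n .. real n} \<le> ennreal (2 * C)" for n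
    using F bdd[of "real n"] bdd[of "- real n"]
    by (subst emeasure_interval_measure_Icc) (auto simp: mono_def intro!: ennreal_leI)
  ultimately show ?thesis by (metis (mono_tags, lifting) SUP_least)
qed

text \<open>Lebesgue's theorem, for continuous functions whose Stieltjes measure vanishes on null sets. \<open>U q\<close> and \<open>L p\<close> are the sets where
  the upper and the lower derivative pass \<open>q\<close> and \<open>p\<close>. The covering comparison in its two directions gives
  \<open>q * \<lambda> E \<le> \<mu> E\<close> and \<open>\<mu> E \<le> p * \<lambda> E\<close> on subsets of \<open>U q \<inter> L p\<close>, so this set
  is null if \<open>p < q\<close>. The quotients are taken over intervals with \<open>x\<close> in the interior; by continuity this gives the ordinary derivative.\<close>

lemma lebesgue_differentiation_monotone:
  fixes F :: "real \<Rightarrow> real"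
  assumes F: "mono F" "continuous_on UNIV F" and bdd: "\<And>x. \<bar>F x\<bar> \<le> C"
    and null: "\<And>N. N \<in> null_sets lborel \<Longrightarrow> emeasure (interval_measure F) N = 0"
  shows "\<exists>N\<in>null_sets lborel. \<forall>x. x \<notin> N \<longrightarrow> F differentiable (at x)"
proof -
  let ?\<mu> = "interval_measure F"
  have \<mu>: "sets ?\<mu> = sets borel" "emeasure ?\<mu> UNIV \<noteq> \<infinity>"
    using emeasure_interval_measure_bounded[OF F bdd] by (auto simp: top_unique)
  have Icc: "emeasure ?\<mu> {u..v} = ennreal (F v - F u)" if "u < v" for u v
    using F that by (intro emeasure_interval_measure_Icc) (auto simp: mono_def)
  have Fmono: "F u \<le> F v" if "u < v" for u v using F(1) that by (simp add: mono_def)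
  interpret lam: lebesgue_null_premeasure "emeasure lborel"
    by (rule lebesgue_null_premeasure_measure) auto
  interpret mu: lebesgue_null_premeasure "emeasure ?\<mu>"
    by (rule lebesgue_null_premeasure_measure) (use null in auto)
  define U where "U q = {x. \<forall>d>0. \<exists>u v. u < x \<and> x < v \<and> v - u < d \<and> q * (v - u) < F v - F u}" for q
  define L where "L p = {x. \<forall>d>0. \<exists>u v. u < x \<and> x < v \<and> v - u < d \<and> F v - F u < p * (v - u)}" for p
  have Um: "U q \<in> sets borel" and Lm: "L q \<in> sets borel" for q
    unfolding U_def L_def by (rule small_interval_limsup_borel)+
  have Ubound: "emeasure lborel E \<le> ennreal (1 / q) * emeasure ?\<mu> E" if q: "0 < q" and E: "E \<in> sets borel" "E \<subseteq> U q" for E q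
  proof -
    have "emeasure lborel E \<le> ennreal (1 / q) * emeasure ?\<mu> E + ennreal 0 * emeasure lborel E"
    proof (rule lam.vitali_comparison[OF \<mu> E(1)])
      fix x d :: real assume "x \<in> E" and d: "0 < d"
      then have "x \<in> U q" using E(2) by blast
      then obtain u v where uv: "u < x" "x < v" "v - u < d" "q * (v - u) < F v - F u"
        using d unfolding U_def by blast
      then have "v - u \<le> 1 / q * (F v - F u)" using q by (simp add: field_simps)
      then have "emeasure lborel {u..v} \<le> ennreal (1 / q) * emeasure ?\<mu> {u..v}"
        using uv q Icc[of u v] by (simp add: ennreal_leI flip: ennreal_mult')
      then show "\<exists>u v. u \<le> x \<and> x \<le> v \<and> u < v \<and> v - u < d \<and>
          emeasure lborel {u..v} \<le> ennreal (1 / q) * emeasure ?\<mu> {u..v} + ennreal 0 * ennreal (v - u)"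
        using uv by (intro exI[of _ u] exI[of _ v]) auto
    qed (use q in auto)
    then show ?thesis by simp
  qed
  have UL: "U q \<inter> L p \<in> null_sets lborel" if pq: "0 < p" "p < q" for p q
  proof -
    let ?E = "U q \<inter> L p"
    have E: "?E \<in> sets borel" using Um Lm by auto
    have "emeasure ?\<mu> ?E \<le> ennreal 0 * emeasure ?\<mu> ?E + ennreal p * emeasure lborel ?E"
    proof (rule mu.vitali_comparison[OF \<mu> E])
      fix x d :: real assume "x \<in> ?E" "0 < d"
      then obtain u v where uv: "u < x" "x < v" "v - u < d" "F v - F u < p * (v - u)"
        unfolding L_def by blast
      then have "emeasure ?\<mu> {u..v} \<le> ennreal p * ennreal (v - u)"
        using Icc[of u v] pq by (simp add: ennreal_leI flip: ennreal_mult')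
      then show "\<exists>u v. u \<le> x \<and> x \<le> v \<and> u < v \<and> v - u < d \<and>
          emeasure ?\<mu> {u..v} \<le> ennreal 0 * emeasure ?\<mu> {u..v} + ennreal p * ennreal (v - u)"
        using uv by (intro exI[of _ u] exI[of _ v]) auto
    qed (use pq in auto)
    then have 1: "emeasure ?\<mu> ?E \<le> ennreal p * emeasure lborel ?E" by simp
    have 2: "emeasure lborel ?E \<le> ennreal (1 / q) * emeasure ?\<mu> ?E"
      using pq E by (intro Ubound) auto
    have "emeasure ?\<mu> ?E \<le> emeasure ?\<mu> UNIV" by (rule emeasure_mono) auto
    then have "emeasure ?\<mu> ?E < top" using \<mu>(2) by (auto simp: less_top top_unique)
    then have "emeasure lborel ?E < top"
      by (intro le_less_trans[OF 2]) (simp add: ennreal_mult_less_top)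
    then obtain l where l: "emeasure lborel ?E = ennreal l" "0 \<le> l" by (auto simp: less_top_ennreal)
    have "ennreal l \<le> ennreal (1 / q) * (ennreal p * ennreal l)"
      using order_trans[OF 2 mult_left_mono[OF 1]] l by simp
    also have "\<dots> = ennreal (p / q * l)" using pq l by (simp flip: ennreal_mult')
    finally have "l \<le> p / q * l" using l pq by (subst (asm) ennreal_le_iff) auto
    moreover have "p / q * l < l" if "0 < l" using mult_strict_right_mono[of "p / q" 1 l] that pq by simp
    ultimately have "l = 0" using l(2) by (cases "0 < l") auto
    then show ?thesis using l E by (simp add: null_sets_def)
  qed
  have Uinf: "(\<Inter>n. U (real (Suc n))) \<in> null_sets lborel"
  proof -
    let ?E = "\<Inter>n. U (real (Suc n))"
    have E: "?E \<in> sets borel" using Um by auto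
    have le: "emeasure lborel ?E \<le> ennreal (1 / real (Suc n)) * emeasure ?\<mu> UNIV" for n
    proof -
      have "emeasure lborel ?E \<le> ennreal (1 / real (Suc n)) * emeasure ?\<mu> ?E"
        using E by (intro Ubound) auto
      also have "\<dots> \<le> ennreal (1 / real (Suc n)) * emeasure ?\<mu> UNIV"
        by (intro mult_left_mono emeasure_mono) auto
      finally show ?thesis .
    qed
    obtain m where m: "emeasure ?\<mu> UNIV = ennreal m" "0 \<le> m"
      using \<mu>(2) by (cases "emeasure ?\<mu> UNIV") auto
    have "emeasure lborel ?E \<le> 0"
    proof (rule ennreal_le_epsilon)
      fix e :: real assume e: "0 < e"
      obtain n :: nat where "m / e \<le> real n" using real_arch_simple by blast
      then have "1 / real (Suc n) * m \<le> e" using e m by (simp add: field_simps)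
      then have "ennreal (1 / real (Suc n)) * ennreal m \<le> ennreal e"
        using m(2) by (simp add: ennreal_leI flip: ennreal_mult')
      then show "emeasure lborel ?E \<le> 0 + ennreal e" using le[of n] m by simp
    qed
    then show ?thesis using E by (simp add: null_sets_def)
  qed
  define N where "N = (\<Inter>n. U (real (Suc n))) \<union> (\<Union>(p, q)\<in>{(p, q). p \<in> \<rat> \<and> q \<in> \<rat> \<and> 0 < p \<and> p < q}. U q \<inter> L p)"
  have "countable {(p::real, q::real). p \<in> \<rat> \<and> q \<in> \<rat> \<and> 0 < p \<and> p < q}"
    by (rule countable_subset[of _ "\<rat> \<times> \<rat>"]) (auto intro: countable_rat)
  then have N: "N \<in> null_sets lborel"
    unfolding N_def by (intro null_sets.Un Uinf null_sets_UN') (auto simp: UL)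
  have antiU: "x \<in> U q" if "x \<in> U q'" "q \<le> q'" for x q q'
  proof -
    have "\<exists>u v. u < x \<and> x < v \<and> v - u < d \<and> q * (v - u) < F v - F u" if d: "0 < d" for d
    proof -
      obtain u v where uv: "u < x" "x < v" "v - u < d" "q' * (v - u) < F v - F u"
        using \<open>x \<in> U q'\<close> d unfolding U_def by blast
      moreover have "q * (v - u) \<le> q' * (v - u)" using uv \<open>q \<le> q'\<close> by (intro mult_right_mono) auto
      ultimately show ?thesis by (meson order_le_less_trans)
    qed
    then show ?thesis by (simp add: U_def)
  qed
  have "F differentiable (at x)" if x: "x \<notin> N" for x
  proof -
    obtain n0 where n0: "x \<notin> U (real (Suc n0))" using x by (auto simp: N_def)
    \<comment> \<open>The supremum \<open>D\<close> is the upper derivative; the value 0 is inserted because \<open>U q\<close> is only considered for positive \<open>q\<close>.\<close>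
    define Q where "Q = insert 0 {q. 0 < q \<and> x \<in> U q}"
    define D where "D = Sup Q"
    have bQ: "bdd_above Q"
    proof (rule bdd_aboveI)
      fix q assume "q \<in> Q"
      then show "q \<le> real (Suc n0)"
        using n0 antiU[where x=x and q'=q and q="real (Suc n0)"] by (cases "q \<le> real (Suc n0)") (auto simp: Q_def simp del: of_nat_Suc)
    qed
    have D0: "0 \<le> D" unfolding D_def by (rule cSup_upper[OF _ bQ]) (simp add: Q_def)
    have main: "\<exists>d>0. \<forall>u v. u < x \<and> x < v \<and> v - u < d \<longrightarrow> \<bar>(F v - F u) - D * (v - u)\<bar> \<le> e * (v - u)" if e: "0 < e" for e
    proof -
      have "x \<notin> U (D + e)"
      proof
        assume "x \<in> U (D + e)"
        then have "D + e \<le> D" using D0 e unfolding D_def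
          by (intro cSup_upper bQ) (auto simp: Q_def D_def[symmetric])
        then show False using e by simp
      qed
      then obtain d1 where d1': "0 < d1" "\<not> (\<exists>u v. u < x \<and> x < v \<and> v - u < d1 \<and> (D + e) * (v - u) < F v - F u)"
        unfolding U_def by blast
      have d1: "0 < d1" "\<And>u v. u < x \<Longrightarrow> x < v \<Longrightarrow> v - u < d1 \<Longrightarrow> F v - F u \<le> (D + e) * (v - u)"
        using d1' not_less by blast+
      have "\<exists>d>0. \<forall>u v. u < x \<and> x < v \<and> v - u < d \<longrightarrow> (D - e) * (v - u) \<le> F v - F u"
      proof (cases "D - e < 0")
        case True
        have "(D - e) * (v - u) \<le> F v - F u" if "u < x" "x < v" for u v
          using mult_nonpos_nonneg[of "D - e" "v - u"] Fmono[of u v] True that by simp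
        then show ?thesis by (intro exI[of _ 1]) auto
      next
        case False
        have "Q \<noteq> {}" by (simp add: Q_def)
        moreover have "D - e < Sup Q" using e by (simp add: D_def)
        ultimately obtain s where s: "s \<in> Q" "D - e < s"
          using less_cSup_iff[OF _ bQ] by blast
        then have s': "x \<in> U s" using False by (auto simp: Q_def)
        obtain q where q: "q \<in> \<rat>" "D - e < q" "q < s" using Rats_dense_in_real[OF s(2)] by blast
        obtain p where p: "p \<in> \<rat>" "D - e < p" "p < q" using Rats_dense_in_real[OF q(2)] by blast
        have "x \<in> U q" using antiU s' q by auto
        then have "x \<notin> L p" using x p q False by (auto simp: N_def)
        then obtain d where d': "0 < d" "\<not> (\<exists>u v. u < x \<and> x < v \<and> v - u < d \<and> F v - F u < p * (v - u))"
          unfolding L_def by blast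
        have d: "0 < d" "\<And>u v. u < x \<Longrightarrow> x < v \<Longrightarrow> v - u < d \<Longrightarrow> p * (v - u) \<le> F v - F u"
          using d' not_less by blast+
        have "(D - e) * (v - u) \<le> F v - F u" if "u < x" "x < v" "v - u < d" for u v
        proof -
          have "(D - e) * (v - u) \<le> p * (v - u)" using p that by (intro mult_right_mono) auto
          then show ?thesis using d(2)[OF that] by linarith
        qed
        then show ?thesis using d(1) by blast
      qed
      then obtain d2 where d2: "0 < d2" "\<And>u v. u < x \<Longrightarrow> x < v \<Longrightarrow> v - u < d2 \<Longrightarrow> (D - e) * (v - u) \<le> F v - F u"
        by blast
      show ?thesis
      proof (intro exI[of _ "min d1 d2"] conjI allI impI)
        fix u v assume uv: "u < x \<and> x < v \<and> v - u < min d1 d2"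
        then have "F v - F u \<le> (D + e) * (v - u)" "(D - e) * (v - u) \<le> F v - F u" using d1 d2 by auto
        then show "\<bar>(F v - F u) - D * (v - u)\<bar> \<le> e * (v - u)" by (simp add: abs_le_iff algebra_simps)
      qed (use d1 d2 in auto)
    qed
    have cont: "(F \<longlongrightarrow> F y) (at y within S)" for y S
      using F(2) by (meson continuous_on_def continuous_on_subset UNIV_I subset_UNIV tendsto_within_subset)
    have one: "\<bar>F y - F x - D * (y - x)\<bar> \<le> e * \<bar>y - x\<bar>"
      if d: "0 < d" "\<forall>u v. u < x \<and> x < v \<and> v - u < d \<longrightarrow> \<bar>(F v - F u) - D * (v - u)\<bar> \<le> e * (v - u)"
        and y: "\<bar>y - x\<bar> < d" for y d e
    proof (cases y x rule: linorder_cases)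
      case greater
      have "((\<lambda>u. \<bar>(F y - F u) - D * (y - u)\<bar> - e * (y - u)) \<longlongrightarrow> \<bar>(F y - F x) - D * (y - x)\<bar> - e * (y - x)) (at_left x)"
        by (intro tendsto_intros cont)
      moreover have "eventually (\<lambda>u. u \<in> {y - d<..<x}) (at_left x)"
        using greater y by (intro eventually_at_leftI[of "y - d"]) auto
      then have "eventually (\<lambda>u. \<bar>(F y - F u) - D * (y - u)\<bar> - e * (y - u) \<le> 0) (at_left x)"
        by eventually_elim (use d greater in auto)
      ultimately have "\<bar>(F y - F x) - D * (y - x)\<bar> - e * (y - x) \<le> 0"
        by (rule tendsto_upperbound) simp
      then show ?thesis using greater by simp
    next
      case less
      have "((\<lambda>v. \<bar>(F v - F y) - D * (v - y)\<bar> - e * (v - y)) \<longlongrightarrow> \<bar>(F x - F y) - D * (x - y)\<bar> - e * (x - y)) (at_right x)"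
        by (intro tendsto_intros cont)
      moreover have "eventually (\<lambda>v. v \<in> {x<..<y + d}) (at_right x)"
        using less y by (intro eventually_at_rightI[of _ "y + d"]) auto
      then have "eventually (\<lambda>v. \<bar>(F v - F y) - D * (v - y)\<bar> - e * (v - y) \<le> 0) (at_right x)"
        by eventually_elim (use d less in auto)
      ultimately have "\<bar>(F x - F y) - D * (x - y)\<bar> - e * (x - y) \<le> 0"
        by (rule tendsto_upperbound) simp
      then show ?thesis using less by (simp add: abs_if algebra_simps split: if_splits)
    qed simp
    have "(F has_derivative (\<lambda>h. D * h)) (at x)"
      unfolding has_derivative_at_alt
    proof (intro conjI allI impI)
      show "bounded_linear ((*) D)" by (rule bounded_linear_mult_right)
      fix e :: real assume "0 < e"
      from main[OF this] obtain d where "0 < d" "\<forall>u v. u < x \<and> x < v \<and> v - u < d \<longrightarrow> \<bar>(F v - F u) - D * (v - u)\<bar> \<le> e * (v - u)"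
        by blast
      then show "\<exists>d>0. \<forall>y. norm (y - x) < d \<longrightarrow> norm (F y - F x - D * (y - x)) \<le> e * norm (y - x)"
        using one by (intro exI[of _ d]) auto
    qed
    then show ?thesis by (auto simp: differentiable_def)
  qed
  with N show ?thesis by blast
qed

text \<open>A null set has an open neighbourhood of small \<open>\<mu>\<close>-measure, and the hypothesis compares the two measures on the intervals that
  make it up; the end points do not matter because \<open>\<mu>\<close> has no atoms.\<close>

lemma interval_measure_null_of_dominated:
  assumes F: "mono F" "continuous_on UNIV F"
    and \<mu>: "sets \<mu> = sets borel" "emeasure \<mu> UNIV \<noteq> \<infinity>"
    and null: "\<And>N. N \<in> null_sets lborel \<Longrightarrow> emeasure \<mu> N = 0"
    and dom: "\<And>u v. u \<le> v \<Longrightarrow> ennreal (F v - F u) \<le> ennreal K * emeasure \<mu> {u..v}"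
    and N: "N \<in> null_sets lborel"
  shows "emeasure (interval_measure F) N = 0"
proof -
  let ?\<kappa> = "interval_measure F"
  have Nb: "N \<in> sets borel" using N by auto
  have bounded_part: "emeasure ?\<kappa> (N \<inter> {- real m .. real m}) = 0" for m
  proof -
    define S where "S = N \<inter> {- real m .. real m}"
    have Sb: "S \<in> sets borel" using Nb by (auto simp: S_def)
    have "emeasure \<mu> N = 0" by (rule null[OF N])
    have "emeasure ?\<kappa> S \<le> 0"
    proof (rule ennreal_le_epsilon)
      fix e :: real assume e: "0 < e"
      define e' where "e' = e / (\<bar>K\<bar> + 1)"
      have e': "0 < e'" using e by (simp add: e'_def)
      have "(INF U \<in> {U. N \<subseteq> U \<and> open U}. emeasure \<mu> U) = emeasure \<mu> N"
        using outer_regular[OF \<mu>(1) _ Nb] \<mu>(2) sets_eq_imp_space_eq[OF \<mu>(1)] by simp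
      then have "(INF U \<in> {U. N \<subseteq> U \<and> open U}. emeasure \<mu> U) < ennreal e'"
        using e' \<open>emeasure \<mu> N = 0\<close> by simp
      then obtain U where U: "N \<subseteq> U" "open U" "emeasure \<mu> U < ennreal e'"
        unfolding INF_less_iff by blast
      have SU: "S \<subseteq> U" and Sm: "S \<subseteq> {- real m..real m}" using U(1) by (auto simp: S_def)
      obtain J :: "nat \<Rightarrow> real set" where J: "S \<subseteq> (\<Union>n. J n)" "\<And>n. J n \<subseteq> U"
          "\<And>n. J n = {} \<or> (\<exists>c d. c \<le> d \<and> d - c < 1 \<and> J n = {c..d} \<and> J n \<inter> S \<noteq> {})"
          "disjoint_family (\<lambda>n. interior (J n))"
      proof (rule nonoverlapping_interval_cover[OF U(2) SU Sm zero_less_one], goal_cases)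
        case (1 J)
        show thesis by (rule 1(1)) (fact 1)+
      qed
      have J': "J n \<in> sets borel \<and> emeasure ?\<kappa> (J n) \<le> ennreal \<bar>K\<bar> * emeasure \<mu> (interior (J n))" for n
      proof (cases "J n = {}")
        case False
        then obtain c d where cd: "J n = {c..d}" and le: "c \<le> d" using J(3)[of n] by blast
        have "emeasure ?\<kappa> (J n) = ennreal (F d - F c)"
          unfolding cd using F le by (intro emeasure_interval_measure_Icc) (auto simp: mono_def)
        also have "\<dots> \<le> ennreal K * emeasure \<mu> {c..d}" by (rule dom[OF le])
        also have "\<dots> \<le> ennreal \<bar>K\<bar> * emeasure \<mu> {c..d}" by (intro mult_right_mono ennreal_leI) auto
        also have "emeasure \<mu> {c..d} \<le> emeasure \<mu> ({c<..<d} \<union> {c} \<union> {d})"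
          using \<mu>(1) by (intro emeasure_mono) auto
        also have "emeasure \<mu> ({c<..<d} \<union> {c} \<union> {d}) \<le> emeasure \<mu> {c<..<d} + emeasure \<mu> {c} + emeasure \<mu> {d}"
          using \<mu>(1) by (intro order_trans[OF emeasure_subadditive] add_mono emeasure_subadditive) auto
        also have "\<dots> = emeasure \<mu> (interior (J n))"
          unfolding cd using null[of "{c}"] null[of "{d}"] by (simp add: null_sets_def)
        finally show ?thesis using cd by (simp add: mult_left_mono)
      qed simp
      have "emeasure ?\<kappa> S \<le> emeasure ?\<kappa> (\<Union>n. J n)"
      proof (rule emeasure_mono)
        show "S \<subseteq> (\<Union>n. J n)" by (rule J(1))
        show "(\<Union>n. J n) \<in> sets ?\<kappa>" using J' by auto
      qed
      also have "\<dots> \<le> (\<Sum>n. emeasure ?\<kappa> (J n))"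
        using J' by (intro emeasure_subadditive_countably) auto
      also have "\<dots> \<le> (\<Sum>n. ennreal \<bar>K\<bar> * emeasure \<mu> (interior (J n)))"
        using J' by (intro suminf_le) auto
      also have "\<dots> = ennreal \<bar>K\<bar> * (\<Sum>n. emeasure \<mu> (interior (J n)))" by simp
      also have "(\<Sum>n. emeasure \<mu> (interior (J n))) = emeasure \<mu> (\<Union>n. interior (J n))"
      proof (rule suminf_emeasure)
        have "interior (J n) \<in> sets \<mu>" for n unfolding \<mu>(1) by (intro borel_open open_interior)
        then show "range (\<lambda>n. interior (J n)) \<subseteq> sets \<mu>" by blast
      qed (rule J(4))
      also have "ennreal \<bar>K\<bar> * emeasure \<mu> (\<Union>n. interior (J n)) \<le> ennreal \<bar>K\<bar> * emeasure \<mu> U"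
      proof (intro mult_left_mono emeasure_mono)
        show "(\<Union>n. interior (J n)) \<subseteq> U" using J(2) interior_subset by blast
      qed (use U(2) \<mu>(1) in auto)
      also have "\<dots> \<le> ennreal \<bar>K\<bar> * ennreal e'" using U(3) by (intro mult_left_mono) auto
      also have "\<dots> \<le> ennreal e"
        using e e' by (simp add: e'_def field_simps ennreal_leI flip: ennreal_mult')
      finally show "emeasure ?\<kappa> S \<le> 0 + ennreal e" by simp
    qed
    then show ?thesis by (simp add: S_def)
  qed
  have "\<exists>m. x \<in> {- real m .. real m}" for x
    using real_arch_simple[of "\<bar>x\<bar>"] by (auto simp: abs_le_iff minus_le_iff)
  then have "N = (\<Union>m. N \<inter> {- real m .. real m})" by blast
  then have "emeasure ?\<kappa> N = emeasure ?\<kappa> (\<Union>m. N \<inter> {- real m .. real m})" by (rule arg_cong)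
  also have "\<dots> \<le> (\<Sum>m. emeasure ?\<kappa> (N \<inter> {- real m .. real m}))"
    using Nb by (intro emeasure_subadditive_countably) auto
  finally show ?thesis by (simp add: bounded_part)
qed

section \<open>Arc length and differentiability of arcs\<close>

lemma inj_arc_inverse_measurable:
  fixes \<gamma> :: "real \<Rightarrow> real^2"
  assumes cont: "continuous_on {a..b} \<gamma>" and inj: "inj_on \<gamma> {a..b}"
  shows "the_inv_into {a..b} \<gamma> \<in> borel_measurable (restrict_space borel (\<gamma> ` {a..b}))"
  by (intro borel_measurable_continuous_on_restrict continuous_on_inv_into cont inj compact_Icc)

text \<open>The inverse of an injective continuous map on a compact interval is continuous, so images of Borel sets are preimages.\<close>

lemma inj_arc_image_borel:
  fixes \<gamma> :: "real \<Rightarrow> real^2"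
  assumes cont: "continuous_on {a..b} \<gamma>" and inj: "inj_on \<gamma> {a..b}" and T: "T \<in> sets borel" "T \<subseteq> {a..b}"
  shows "\<gamma> ` T \<in> sets borel"
proof -
  let ?i = "the_inv_into {a..b} \<gamma>"
  have \<Gamma>: "\<gamma> ` {a..b} \<in> sets borel"
    by (intro borel_closed compact_imp_closed compact_continuous_image cont compact_Icc)
  have "?i -` T \<inter> space (restrict_space borel (\<gamma> ` {a..b})) \<in> sets (restrict_space borel (\<gamma> ` {a..b}))"
    by (rule measurable_sets[OF inj_arc_inverse_measurable[OF cont inj] T(1)])
  then have "?i -` T \<inter> \<gamma> ` {a..b} \<in> sets borel"
    using \<Gamma> by (simp add: space_restrict_space sets_restrict_space_iff)
  moreover have "?i -` T \<inter> \<gamma> ` {a..b} = \<gamma> ` T"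
    using T(2) inj by (auto simp: the_inv_into_f_f)
  ultimately show ?thesis by simp
qed

text \<open>The Hausdorff measure on the arc, transported to the parameter interval.\<close>

definition arc_length_measure :: "real \<Rightarrow> real \<Rightarrow> (real \<Rightarrow> real^2) \<Rightarrow> real measure" where
  "arc_length_measure a b \<gamma> = distr (restrict_space H1 (\<gamma> ` {a..b})) borel (the_inv_into {a..b} \<gamma>)"

lemma sets_arc_length_measure [simp, measurable_cong]: "sets (arc_length_measure a b \<gamma>) = sets borel"
  by (simp add: arc_length_measure_def)

lemma space_arc_length_measure [simp]: "space (arc_length_measure a b \<gamma>) = UNIV"
  by (simp add: arc_length_measure_def)

lemma the_inv_into_measurable_H1:
  fixes \<gamma> :: "real \<Rightarrow> real^2"
  assumes "continuous_on {a..b} \<gamma>" "inj_on \<gamma> {a..b}"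
  shows "the_inv_into {a..b} \<gamma> \<in> borel_measurable (restrict_space H1 (\<gamma> ` {a..b}))"
proof -
  have "sets (restrict_space H1 (\<gamma> ` {a..b})) = sets (restrict_space borel (\<gamma> ` {a..b}))"
    by (rule sets_restrict_space_cong) simp
  then show ?thesis
    using inj_arc_inverse_measurable[OF assms] measurable_cong_sets[OF _ refl] by blast
qed

lemma emeasure_arc_length_measure:
  assumes cont: "continuous_on {a..b} \<gamma>" and inj: "inj_on \<gamma> {a..b}" and T: "T \<in> sets borel"
  shows "emeasure (arc_length_measure a b \<gamma>) T = hausdorff1_outer (\<gamma> ` (T \<inter> {a..b}))"
proof -
  let ?i = "the_inv_into {a..b} \<gamma>" and ?\<Gamma> = "\<gamma> ` {a..b}"
  have \<Gamma>: "?\<Gamma> \<in> sets borel"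
    by (intro borel_closed compact_imp_closed compact_continuous_image cont compact_Icc)
  have eq: "?i -` T \<inter> ?\<Gamma> = \<gamma> ` (T \<inter> {a..b})"
    using inj by (auto simp: the_inv_into_f_f)
  have "emeasure (arc_length_measure a b \<gamma>) T = emeasure (restrict_space H1 ?\<Gamma>) (\<gamma> ` (T \<inter> {a..b}))"
    unfolding arc_length_measure_def
    by (subst emeasure_distr[OF the_inv_into_measurable_H1[OF cont inj] T]) (simp add: space_restrict_space eq)
  also have "\<dots> = emeasure H1 (\<gamma> ` (T \<inter> {a..b}))"
    using \<Gamma> by (intro emeasure_restrict_space) auto
  also have "\<dots> = hausdorff1_outer (\<gamma> ` (T \<inter> {a..b}))"
    using T by (intro emeasure_H1 inj_arc_image_borel[OF cont inj]) auto
  finally show ?thesis .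
qed

lemma arc_length_measure_null:
  assumes ac: "abs_cont a b \<gamma>" and inj: "inj_on \<gamma> {a..b}" and N: "N \<in> null_sets lborel"
  shows "emeasure (arc_length_measure a b \<gamma>) N = 0"
proof -
  have "emeasure (arc_length_measure a b \<gamma>) N = hausdorff1_outer (\<gamma> ` (N \<inter> {a..b}))"
    using N by (intro emeasure_arc_length_measure abs_cont_continuous_on[OF ac] inj) auto
  also have "\<dots> = 0"
    using N by (intro abs_cont_null_image[OF ac] null_set_Int2) auto
  finally show ?thesis .
qed

lemma finite_measure_arc_length_measure:
  assumes ac: "abs_cont a b \<gamma>" and inj: "inj_on \<gamma> {a..b}"
  shows "finite_measure (arc_length_measure a b \<gamma>)"
proof
  have "emeasure (arc_length_measure a b \<gamma>) UNIV = hausdorff1_outer (\<gamma> ` (UNIV \<inter> {a..b}))"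
    by (intro emeasure_arc_length_measure abs_cont_continuous_on[OF ac] inj) auto
  then show "emeasure (arc_length_measure a b \<gamma>) (space (arc_length_measure a b \<gamma>)) \<noteq> \<infinity>"
    using abs_cont_finite_length[OF ac] by simp
qed

lemma chord_le_arc_length_measure:
  assumes ac: "abs_cont a b \<gamma>" and inj: "inj_on \<gamma> {a..b}" and uv: "a \<le> u" "u \<le> v" "v \<le> b"
  shows "ennreal (dist (\<gamma> u) (\<gamma> v)) \<le> emeasure (arc_length_measure a b \<gamma>) {u..v}"
proof -
  have cont: "continuous_on {a..b} \<gamma>" by (rule abs_cont_continuous_on[OF ac])
  have "connected (\<gamma> ` {u..v})"
    by (intro connected_continuous_image continuous_on_subset[OF cont]) (use uv in auto)
  then have "ennreal (dist (\<gamma> u) (\<gamma> v)) \<le> hausdorff1_outer (\<gamma> ` {u..v})"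
    by (rule dist_le_hausdorff1_outer_connected) (use uv in auto)
  also have "{u..v} = {u..v} \<inter> {a..b}" using uv by auto
  also have "hausdorff1_outer (\<gamma> ` ({u..v} \<inter> {a..b})) = emeasure (arc_length_measure a b \<gamma>) {u..v}"
    by (rule emeasure_arc_length_measure[OF cont inj, symmetric]) auto
  finally show ?thesis by simp
qed

text \<open>With \<open>M\<close> the distribution function of \<open>\<mu>\<close>, the function \<open>f\<close> is the difference of the monotone functions \<open>M + f\<close> and \<open>M\<close>,
  and both have Stieltjes measures dominated by a multiple of \<open>\<mu>\<close>.\<close>

lemma differentiable_off_null_of_dominated:
  fixes f :: "real \<Rightarrow> real"
  assumes "finite_measure \<mu>" and \<mu>: "sets \<mu> = sets borel"
    and null: "\<And>N. N \<in> null_sets lborel \<Longrightarrow> emeasure \<mu> N = 0"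
    and f: "continuous_on UNIV f" "\<And>u v. u \<le> v \<Longrightarrow> ennreal \<bar>f v - f u\<bar> \<le> emeasure \<mu> {u..v}" "\<And>x. \<bar>f x\<bar> \<le> C"
  shows "\<exists>N\<in>null_sets lborel. \<forall>x. x \<notin> N \<longrightarrow> f differentiable (at x)"
proof -
  interpret finite_measure \<mu> by fact
  have sp: "space \<mu> = UNIV" using sets_eq_imp_space_eq[OF \<mu>] by simp
  have fin: "emeasure \<mu> UNIV \<noteq> \<infinity>" by simp
  define M where "M t = measure \<mu> {..t}" for t
  have single: "measure \<mu> {x} = 0" for x
    using null[of "{x}"] by (simp add: measure_def null_sets_def)
  have M_diff: "M v - M u = measure \<mu> {u..v}" if "u \<le> v" for u v
  proof -
    have "measure \<mu> {..v} = measure \<mu> ({..u} \<union> {u<..v})"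
      using that by (intro arg_cong[of _ _ "measure \<mu>"]) auto
    also have "\<dots> = measure \<mu> {..u} + measure \<mu> {u<..v}"
      by (rule finite_measure_Union) (auto simp: \<mu>)
    finally have "M v - M u = measure \<mu> {u<..v}" by (simp add: M_def)
    moreover have "measure \<mu> {u..v} = measure \<mu> ({u} \<union> {u<..v})"
      using that by (intro arg_cong[of _ _ "measure \<mu>"]) auto
    moreover have "measure \<mu> ({u} \<union> {u<..v}) = measure \<mu> {u} + measure \<mu> {u<..v}"
      by (rule finite_measure_Union) (auto simp: \<mu>)
    ultimately show ?thesis by (simp add: single)
  qed
  have Mmono: "mono M" unfolding mono_def using M_diff by (metis diff_ge_0_iff_ge measure_nonneg)
  have Mcont: "continuous_on UNIV M"
  proof -
    have "isCont M x" for x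
    proof -
      have "(M \<longlongrightarrow> M x) (at_right x)"
      proof (rule tendsto_at_right_sequentially[of x "x + 1"])
        fix S assume S: "\<And>n. x < S n" "decseq S" "S \<longlonglongrightarrow> x"
        have "(\<lambda>n. measure \<mu> {..S n}) \<longlonglongrightarrow> measure \<mu> (\<Inter>n. {..S n})"
          using S(2) by (intro finite_Lim_measure_decseq) (auto simp: \<mu> decseq_def intro: order_trans)
        also have "(\<Inter>n. {..S n}) = {..x}"
          using S(1,3) by (auto intro: less_imp_le order_trans LIMSEQ_le_const)
        finally show "(\<lambda>n. M (S n)) \<longlonglongrightarrow> M x" by (simp add: M_def)
      qed simp
      moreover have "(M \<longlongrightarrow> M x) (at_left x)"
      proof (rule tendsto_at_left_sequentially[of "x - 1"])
        fix S assume S: "\<And>n. S n < x" "incseq S" "S \<longlonglongrightarrow> x"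
        have "(\<lambda>n. measure \<mu> {..S n}) \<longlonglongrightarrow> measure \<mu> (\<Union>n. {..S n})"
          using S(2) by (intro finite_Lim_measure_incseq) (auto simp: \<mu> incseq_def intro: order_trans)
        also have "(\<Union>n. {..S n}) = {..<x}"
        proof (intro equalityI subsetI)
          fix y assume "y \<in> {..<x}"
          then have "eventually (\<lambda>n. y < S n) sequentially" using S(3) by (simp add: order_tendstoD)
          then show "y \<in> (\<Union>n. {..S n})" by (auto simp: eventually_sequentially intro: less_imp_le)
        qed (use S(1) in \<open>auto intro: le_less_trans\<close>)
        also have "measure \<mu> {..<x} = measure \<mu> {..x}"
        proof -
          have "measure \<mu> {..x} = measure \<mu> ({..<x} \<union> {x})"
            by (intro arg_cong[of _ _ "measure \<mu>"]) auto
          also have "\<dots> = measure \<mu> {..<x} + measure \<mu> {x}"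
            by (rule finite_measure_Union) (auto simp: \<mu>)
          finally show ?thesis by (simp add: single)
        qed
        finally show "(\<lambda>n. M (S n)) \<longlonglongrightarrow> M x" by (simp add: M_def)
      qed simp
      ultimately show ?thesis by (simp add: continuous_within filterlim_split_at)
    qed
    then show ?thesis by (simp add: continuous_at_imp_continuous_on)
  qed
  have Mbdd: "\<bar>M x\<bar> \<le> measure \<mu> UNIV" for x
    unfolding M_def using finite_measure_mono[of "{..x}" UNIV] by (simp add: \<mu>)
  have f_le: "\<bar>f v - f u\<bar> \<le> M v - M u" if "u \<le> v" for u v
    using f(2)[OF that] by (simp add: M_diff[OF that] emeasure_eq_measure)
  define F where "F t = M t + f t" for t
  have Fmono: "mono F"
    unfolding mono_def F_def using f_le by (smt (verit))
  have Fcont: "continuous_on UNIV F" unfolding F_def by (intro continuous_intros Mcont f)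
  have domM: "ennreal (M v - M u) \<le> ennreal 1 * emeasure \<mu> {u..v}" if "u \<le> v" for u v
    by (simp add: M_diff[OF that] emeasure_eq_measure)
  have domF: "ennreal (F v - F u) \<le> ennreal 2 * emeasure \<mu> {u..v}" if "u \<le> v" for u v
  proof -
    have "F v - F u \<le> 2 * measure \<mu> {u..v}"
      using f_le[OF that] M_diff[OF that] by (simp add: F_def)
    then have "ennreal (F v - F u) \<le> ennreal (2 * measure \<mu> {u..v})" by (rule ennreal_leI)
    also have "\<dots> = ennreal 2 * emeasure \<mu> {u..v}" unfolding emeasure_eq_measure by (rule ennreal_mult) auto
    finally show ?thesis .
  qed
  have Fbdd: "\<bar>F x\<bar> \<le> measure \<mu> UNIV + C" for x
    unfolding F_def using Mbdd[of x] f(3)[of x] by linarith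
  obtain N1 where N1: "N1 \<in> null_sets lborel" "\<And>x. x \<notin> N1 \<Longrightarrow> M differentiable (at x)"
    using lebesgue_differentiation_monotone[OF Mmono Mcont Mbdd]
      interval_measure_null_of_dominated[OF Mmono Mcont \<mu> fin null domM] by blast
  obtain N2 where N2: "N2 \<in> null_sets lborel" "\<And>x. x \<notin> N2 \<Longrightarrow> F differentiable (at x)"
    using lebesgue_differentiation_monotone[OF Fmono Fcont Fbdd]
      interval_measure_null_of_dominated[OF Fmono Fcont \<mu> fin null domF] by blast
  have "f differentiable (at x)" if "x \<notin> N1 \<union> N2" for x
  proof -
    have "(\<lambda>t. F t - M t) differentiable (at x)"
      using that N1(2) N2(2) by (intro differentiable_diff) auto
    moreover have "(\<lambda>t. F t - M t) = f" by (simp add: F_def fun_eq_iff)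
    ultimately show ?thesis by simp
  qed
  then show ?thesis using N1(1) N2(1) by (intro bexI[of _ "N1 \<union> N2"] null_sets.Un) auto
qed

text \<open>The chord between two parameters is at most the arc length between them, so every coordinate is dominated by the arc length measure.
  The arc is extended by constants in order to have functions on the whole line.\<close>

lemma abs_cont_inj_differentiable_off_null:
  fixes \<gamma> :: "real \<Rightarrow> real^2"
  assumes ac: "abs_cont a b \<gamma>" and inj: "inj_on \<gamma> {a..b}" and ab: "a \<le> b"
  shows "\<exists>N\<in>null_sets lborel. \<forall>t\<in>{a<..<b}. t \<notin> N \<longrightarrow> \<gamma> differentiable (at t)"
proof -
  let ?\<mu> = "arc_length_measure a b \<gamma>"
  have cont: "continuous_on {a..b} \<gamma>" by (rule abs_cont_continuous_on[OF ac])
  define cl where "cl t = max a (min b t)" for t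
  have cl: "cl t \<in> {a..b}" for t using ab by (auto simp: cl_def)
  have clcont: "continuous_on UNIV cl" unfolding cl_def by (intro continuous_intros)
  have gcont: "continuous_on UNIV (\<lambda>t. \<gamma> (cl t))"
    by (rule continuous_on_compose2[OF cont clcont]) (use cl in auto)
  have "bounded (\<gamma> ` {a..b})"
    by (intro compact_imp_bounded compact_continuous_image cont compact_Icc)
  then obtain C where C: "\<And>t. t \<in> {a..b} \<Longrightarrow> norm (\<gamma> t) \<le> C" unfolding bounded_iff by blast
  have "\<exists>N\<in>null_sets lborel. \<forall>x. x \<notin> N \<longrightarrow> (\<lambda>t. \<gamma> (cl t) \<bullet> e) differentiable (at x)" if e: "e \<in> Basis" for e
  proof (rule differentiable_off_null_of_dominated[of ?\<mu>])
    show "finite_measure ?\<mu>" by (rule finite_measure_arc_length_measure[OF ac inj])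
    show "emeasure ?\<mu> N = 0" if "N \<in> null_sets lborel" for N
      by (rule arc_length_measure_null[OF ac inj that])
    show "continuous_on UNIV (\<lambda>t. \<gamma> (cl t) \<bullet> e)" by (intro continuous_intros gcont)
    show "\<bar>\<gamma> (cl x) \<bullet> e\<bar> \<le> C" for x
      using Basis_le_norm[OF e, of "\<gamma> (cl x)"] C[OF cl[of x]] by linarith
    fix u v :: real assume uv: "u \<le> v"
    have "\<bar>\<gamma> (cl v) \<bullet> e - \<gamma> (cl u) \<bullet> e\<bar> \<le> dist (\<gamma> (cl u)) (\<gamma> (cl v))"
      using Basis_le_norm[OF e, of "\<gamma> (cl v) - \<gamma> (cl u)"] by (simp add: dist_norm inner_diff_left norm_minus_commute)
    then have "ennreal \<bar>\<gamma> (cl v) \<bullet> e - \<gamma> (cl u) \<bullet> e\<bar> \<le> ennreal (dist (\<gamma> (cl u)) (\<gamma> (cl v)))" by (rule ennreal_leI)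
    also have "\<dots> \<le> emeasure ?\<mu> {u..v}"
    proof (cases "{u..v} \<inter> {a..b} = {}")
      case True
      then have "v < a \<or> b < u" using uv ab by (auto simp: not_le)
      then have "cl u = cl v" using uv ab by (auto simp: cl_def)
      then show ?thesis by simp
    next
      case False
      have le: "a \<le> cl u" "cl u \<le> cl v" "cl v \<le> b" using uv ab by (auto simp: cl_def)
      then have "ennreal (dist (\<gamma> (cl u)) (\<gamma> (cl v))) \<le> emeasure ?\<mu> {cl u..cl v}"
        by (rule chord_le_arc_length_measure[OF ac inj])
      also have "\<dots> \<le> emeasure ?\<mu> {u..v}"
      proof (rule emeasure_mono)
        have "u \<le> b" "a \<le> v" using False by auto
        then have "u \<le> cl u" "cl v \<le> v" by (auto simp: cl_def le_max_iff_disj)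
        then show "{cl u..cl v} \<subseteq> {u..v}" by auto
      qed simp
      finally show ?thesis .
    qed
    finally show "ennreal \<bar>\<gamma> (cl v) \<bullet> e - \<gamma> (cl u) \<bullet> e\<bar> \<le> emeasure ?\<mu> {u..v}" .
  qed simp
  then obtain N where N: "\<And>e. e \<in> Basis \<Longrightarrow> N e \<in> null_sets lborel"
    "\<And>e x. e \<in> Basis \<Longrightarrow> x \<notin> N e \<Longrightarrow> (\<lambda>t. \<gamma> (cl t) \<bullet> e) differentiable (at x)"
    by metis
  have "\<gamma> differentiable (at t)" if t: "t \<in> {a<..<b}" "t \<notin> (\<Union>e\<in>Basis. N e)" for t
  proof -
    have "(\<lambda>t. \<gamma> (cl t)) differentiable (at t)"
      using N(2) t(2) by (subst differentiable_componentwise_within) auto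
    then obtain D where D: "((\<lambda>t. \<gamma> (cl t)) has_derivative D) (at t)" by (auto simp: differentiable_def)
    have "eventually (\<lambda>s. s \<in> {a<..<b}) (at t)"
      using t(1) by (intro eventually_at_in_open') auto
    then have "eventually (\<lambda>s. \<gamma> (cl s) = \<gamma> s) (at t)"
      by eventually_elim (auto simp: cl_def)
    then have "(\<gamma> has_derivative D) (at t)"
      by (rule has_derivative_transform_eventually[OF D]) (use t(1) in \<open>auto simp: cl_def\<close>)
    then show ?thesis by (auto simp: differentiable_def)
  qed
  moreover have "(\<Union>e\<in>Basis. N e) \<in> null_sets lborel"
    using N(1) by (intro null_sets_UN') (auto simp: countable_finite)
  ultimately show ?thesis by blast
qed

section \<open>The hexagonal norm and its dual\<close>

lemma vector2_simps [simp]: "(vector [a, b] :: real^2) $ 1 = a" "(vector [a, b] :: real^2) $ 2 = b"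
  by simp_all

lemma compact_wulff: "compact wulff"
  unfolding wulff_def by (intro finite_imp_compact_convex_hull) auto

lemma wulff_norm_le: "N \<in> wulff \<Longrightarrow> norm N \<le> 2"
proof -
  have s: "1 \<le> sqrt 3" by simp
  have n: "norm (vector [a, b] :: real^2) \<le> \<bar>a\<bar> + \<bar>b\<bar>" for a b
    using norm_le_l1_cart[of "vector [a, b] :: real^2"] by (simp add: sum_2)
  have v: "norm (vector [a, b] :: real^2) \<le> 2" if "\<bar>a\<bar> + \<bar>b\<bar> \<le> 2" for a b using n[of a b] that by linarith
  have "\<bar>2 / sqrt 3\<bar> + \<bar>0\<bar> \<le> 2" "\<bar>- (2 / sqrt 3)\<bar> + \<bar>0\<bar> \<le> 2"
    "\<bar>1 / sqrt 3\<bar> + \<bar>1\<bar> \<le> 2" "\<bar>1 / sqrt 3\<bar> + \<bar>-1\<bar> \<le> 2"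
    "\<bar>- (1 / sqrt 3)\<bar> + \<bar>1\<bar> \<le> 2" "\<bar>- (1 / sqrt 3)\<bar> + \<bar>-1\<bar> \<le> 2"
    using s by (simp_all add: field_simps)
  note v' = this[THEN v]
  have "wulff \<subseteq> cball 0 2"
    unfolding wulff_def
  proof (rule hull_minimal)
    show "{vector [2 / sqrt 3, 0], vector [- (2 / sqrt 3), 0],
      vector [1 / sqrt 3, 1], vector [1 / sqrt 3, -1],
      vector [- (1 / sqrt 3), 1], vector [- (1 / sqrt 3), -1]} \<subseteq> cball (0 :: real^2) 2"
      unfolding insert_subset mem_cball dist_0_norm using v' by blast
  qed (rule convex_cball)
  then show "N \<in> wulff \<Longrightarrow> norm N \<le> 2" by auto
qed

lemma uminus_wulff: "- N \<in> wulff \<longleftrightarrow> N \<in> wulff"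
proof -
  have neg: "- (vector [a, b] :: real^2) = vector [- a, - b]" for a b by (simp add: vec_eq_iff forall_2)
  have "uminus ` (convex hull V) = convex hull (uminus ` V)" for V :: "(real^2) set"
    by (rule convex_hull_linear_image) (auto simp: linear_iff)
  then have "uminus ` wulff = wulff"
    unfolding wulff_def by (simp add: neg insert_commute)
  then show ?thesis by (metis image_eqI minus_minus imageE)
qed

lemma zero_in_wulff: "0 \<in> wulff"
proof -
  let ?p = "vector [2 / sqrt 3, 0] :: real^2"
  have p: "?p \<in> wulff" unfolding wulff_def by (intro hull_inc) auto
  then have "(1/2) *\<^sub>R ?p + (1/2) *\<^sub>R (- ?p) \<in> wulff"
    using uminus_wulff[of ?p] unfolding wulff_def by (intro convexD convex_convex_hull) auto
  then show ?thesis by simp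
qed

text \<open>Every point is a combination of two vertices that are linearly independent. Without this the infimum in \<open>phi\<close> could be taken over the
  empty set, where it has no meaning.\<close>

lemma wulff_absorbing: "\<exists>r>0. x \<in> (\<lambda>y. r *\<^sub>R y) ` wulff"
proof -
  let ?K = "{x. \<exists>r>0. x \<in> (\<lambda>y. r *\<^sub>R y) ` wulff}"
  have add: "x + y \<in> ?K" if xy: "x \<in> ?K" "y \<in> ?K" for x y
  proof -
    obtain r s v w where H: "0 < r" "0 < s" "v \<in> wulff" "w \<in> wulff" "x = r *\<^sub>R v" "y = s *\<^sub>R w"
      using xy unfolding mem_Collect_eq image_iff by blast
    have "(r / (r + s)) *\<^sub>R v + (s / (r + s)) *\<^sub>R w \<in> wulff"
      using H unfolding wulff_def by (intro convexD convex_convex_hull) (auto simp flip: add_divide_distrib)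
    moreover have "x + y = (r + s) *\<^sub>R ((r / (r + s)) *\<^sub>R v + (s / (r + s)) *\<^sub>R w)"
      using H by (simp add: scaleR_add_right)
    ultimately show ?thesis using H(1,2) by (intro CollectI exI[of _ "r + s"]) auto
  qed
  have scale: "a *\<^sub>R v \<in> ?K" if v: "v \<in> wulff" for a v
  proof (cases a "0 :: real" rule: linorder_cases)
    case less
    have "(- a) *\<^sub>R (- v) \<in> (\<lambda>y. (- a) *\<^sub>R y) ` wulff" using v uminus_wulff[of v] by (intro imageI) simp
    moreover have "(- a) *\<^sub>R (- v) = a *\<^sub>R v" by simp
    moreover have "0 < - a" using less by simp
    ultimately show ?thesis unfolding mem_Collect_eq by metis
  next
    case equal
    then have "a *\<^sub>R v = 1 *\<^sub>R 0" by simp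
    then show ?thesis using zero_in_wulff by (intro CollectI exI[of _ 1]) force
  next
    case greater
    then show ?thesis using v by (intro CollectI exI[of _ a]) auto
  qed
  let ?p = "vector [2 / sqrt 3, 0] :: real^2" and ?q = "vector [1 / sqrt 3, 1] :: real^2"
  have "?p \<in> wulff" "?q \<in> wulff" unfolding wulff_def by (intro hull_inc, simp)+
  then have "((x $ 1 - x $ 2 / sqrt 3) * sqrt 3 / 2) *\<^sub>R ?p + (x $ 2) *\<^sub>R ?q \<in> ?K"
    by (intro add scale)
  moreover have "((x $ 1 - x $ 2 / sqrt 3) * sqrt 3 / 2) *\<^sub>R ?p + (x $ 2) *\<^sub>R ?q = x"
    by (simp add: vec_eq_iff forall_2 field_simps)
  ultimately show ?thesis by simp
qed

definition wulff_scales :: "real^2 \<Rightarrow> real set" where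
  "wulff_scales x = {r. 0 < r \<and> x \<in> (\<lambda>y. r *\<^sub>R y) ` wulff}"

lemma phi_eq: "phi x = Inf (wulff_scales x)"
  by (simp add: phi_def wulff_scales_def)

lemma wulff_scales_nonempty: "wulff_scales x \<noteq> {}"
  using wulff_absorbing[of x] by (auto simp: wulff_scales_def)

lemma bdd_below_wulff_scales: "bdd_below (wulff_scales x)"
  by (rule bdd_belowI[of _ 0]) (auto simp: wulff_scales_def)

lemma norm_le_phi: "norm x \<le> 2 * phi x"
proof -
  have "norm x / 2 \<le> phi x"
    unfolding phi_eq
  proof (rule cInf_greatest[OF wulff_scales_nonempty])
    fix r assume "r \<in> wulff_scales x"
    then obtain y where "0 < r" "y \<in> wulff" "x = r *\<^sub>R y" by (auto simp: wulff_scales_def)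
    then show "norm x / 2 \<le> r" using wulff_norm_le[of y] by simp
  qed
  then show ?thesis by simp
qed

lemma phi_scale_le: "0 < t \<Longrightarrow> phi (t *\<^sub>R x) \<le> t * phi x"
proof -
  assume t: "0 < t"
  have "phi (t *\<^sub>R x) / t \<le> phi x"
    unfolding phi_eq[of x]
  proof (rule cInf_greatest[OF wulff_scales_nonempty])
    fix r assume "r \<in> wulff_scales x"
    then have "t * r \<in> wulff_scales (t *\<^sub>R x)" using t by (auto simp: wulff_scales_def)
    then have "phi (t *\<^sub>R x) \<le> t * r" unfolding phi_eq by (rule cInf_lower[OF _ bdd_below_wulff_scales])
    then show "phi (t *\<^sub>R x) / t \<le> r" using t by (simp add: field_simps)
  qed
  then show ?thesis using t by (simp add: field_simps)
qed

lemma phi_scale: "0 < t \<Longrightarrow> phi (t *\<^sub>R x) = t * phi x"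
  using phi_scale_le[of t x] phi_scale_le[of "1 / t" "t *\<^sub>R x"] by (simp add: field_simps)

lemma phi_minus: "phi (- x) = phi x"
proof -
  have "wulff_scales (- x) \<subseteq> wulff_scales x" for x
  proof
    fix r assume "r \<in> wulff_scales (- x)"
    then obtain y where y: "0 < r" "y \<in> wulff" "- x = r *\<^sub>R y" by (auto simp: wulff_scales_def)
    then have x: "x = r *\<^sub>R (- y)" by (metis minus_minus scaleR_minus_right)
    have "r *\<^sub>R (- y) \<in> (\<lambda>y. r *\<^sub>R y) ` wulff" using y(2) uminus_wulff[of y] by (intro imageI) simp
    then show "r \<in> wulff_scales x" unfolding wulff_scales_def using y(1) x by blast
  qed
  from this[of x] this[of "- x"] show ?thesis by (simp add: phi_eq subset_antisym)
qed

lemma phi_dual_upper: "phi \<eta> = 1 \<Longrightarrow> \<xi> \<bullet> \<eta> \<le> phi_dual \<xi>"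
proof -
  assume \<eta>: "phi \<eta> = 1"
  have "bdd_above {\<xi> \<bullet> \<eta> | \<eta>. phi \<eta> = 1}"
  proof (rule bdd_aboveI)
    fix r assume "r \<in> {\<xi> \<bullet> \<eta> | \<eta>. phi \<eta> = 1}"
    then obtain \<eta> where "r = \<xi> \<bullet> \<eta>" "phi \<eta> = 1" by blast
    then show "r \<le> norm \<xi> * 2"
      using norm_le_phi[of \<eta>] norm_cauchy_schwarz[of \<xi> \<eta>] mult_left_mono[of "norm \<eta>" 2 "norm \<xi>"] by auto
  qed
  then show ?thesis unfolding phi_dual_def using \<eta> by (intro cSup_upper) auto
qed

lemma phi_unit_exists: obtains \<eta> where "phi \<eta> = 1"
proof -
  let ?p = "vector [1, 0] :: real^2"
  have "norm ?p > 0" by (simp add: vec_eq_iff forall_2)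
  then have "0 < phi ?p" using norm_le_phi[of ?p] by linarith
  then have "phi ((1 / phi ?p) *\<^sub>R ?p) = 1" by (subst phi_scale) auto
  then show ?thesis by (rule that)
qed

lemma phi_dual_least:
  assumes "\<And>\<eta>. phi \<eta> = 1 \<Longrightarrow> \<xi> \<bullet> \<eta> \<le> c"
  shows "phi_dual \<xi> \<le> c"
  unfolding phi_dual_def
proof (rule cSup_least)
  obtain \<eta> where "phi \<eta> = 1" by (rule phi_unit_exists)
  then show "{\<xi> \<bullet> \<eta> |\<eta>. phi \<eta> = 1} \<noteq> {}" by blast
qed (use assms in blast)

lemma phi_dual_nonneg: "0 \<le> phi_dual \<xi>"
proof -
  obtain \<eta> where \<eta>: "phi \<eta> = 1" by (rule phi_unit_exists)
  then show ?thesis using phi_dual_upper[of \<eta> \<xi>] phi_dual_upper[of "- \<eta>" \<xi>] by (simp add: phi_minus)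
qed

text \<open>Only vectors with \<open>phi \<eta> = 1\<close> enter \<open>phi_dual\<close>. A vector of the Wulff shape with positive pairing has \<open>phi N \<le> 1\<close>,
  and rescaling it to \<open>phi \<eta> = 1\<close> increases the pairing.\<close>

lemma wulff_inner_le_phi_dual: "N \<in> wulff \<Longrightarrow> N \<bullet> \<xi> \<le> phi_dual \<xi>"
proof (cases "N \<bullet> \<xi> \<le> 0")
  case True
  then show ?thesis using phi_dual_nonneg[of \<xi>] by linarith
next
  case False
  assume N: "N \<in> wulff"
  have "1 \<in> wulff_scales N" using N by (auto simp: wulff_scales_def image_iff intro: bexI[of _ N])
  then have le: "phi N \<le> 1" unfolding phi_eq by (rule cInf_lower[OF _ bdd_below_wulff_scales])
  have "0 < norm N" using False by auto
  then have pos: "0 < phi N" using norm_le_phi[of N] by linarith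
  then have "phi ((1 / phi N) *\<^sub>R N) = 1" by (subst phi_scale) auto
  then have "\<xi> \<bullet> ((1 / phi N) *\<^sub>R N) \<le> phi_dual \<xi>" by (rule phi_dual_upper)
  moreover have "N \<bullet> \<xi> \<le> (N \<bullet> \<xi>) / phi N" using False le pos by (simp add: field_simps)
  ultimately show ?thesis by (simp add: inner_commute)
qed

lemma abs_wulff_inner_le_phi_dual: "N \<in> wulff \<Longrightarrow> \<bar>N \<bullet> \<xi>\<bar> \<le> phi_dual \<xi>"
  using wulff_inner_le_phi_dual[of N \<xi>] wulff_inner_le_phi_dual[of "- N" \<xi>] by (simp add: uminus_wulff)

lemma phi_dual_minus: "phi_dual (- \<xi>) = phi_dual \<xi>"
proof -
  have "phi_dual (- \<xi>) \<le> phi_dual \<xi>" for \<xi>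
  proof (rule phi_dual_least)
    fix \<eta> assume "phi \<eta> = 1"
    then show "- \<xi> \<bullet> \<eta> \<le> phi_dual \<xi>" using phi_dual_upper[of "- \<eta>" \<xi>] by (simp add: phi_minus)
  qed
  from this[of \<xi>] this[of "- \<xi>"] show ?thesis by simp
qed

lemma phi_dual_zero [simp]: "phi_dual 0 = 0"
  using phi_dual_least[of 0 0] phi_dual_nonneg[of 0] by simp

lemma phi_dual_lipschitz: "\<bar>phi_dual \<xi> - phi_dual \<zeta>\<bar> \<le> 2 * norm (\<xi> - \<zeta>)"
proof -
  have "phi_dual \<xi> \<le> phi_dual \<zeta> + 2 * norm (\<xi> - \<zeta>)" for \<xi> \<zeta>
  proof (rule phi_dual_least)
    fix \<eta> assume \<eta>: "phi \<eta> = 1"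
    have "(\<xi> - \<zeta>) \<bullet> \<eta> \<le> norm (\<xi> - \<zeta>) * norm \<eta>" by (rule norm_cauchy_schwarz)
    also have "\<dots> \<le> norm (\<xi> - \<zeta>) * 2" using norm_le_phi[of \<eta>] \<eta> by (intro mult_left_mono) auto
    finally show "\<xi> \<bullet> \<eta> \<le> phi_dual \<zeta> + 2 * norm (\<xi> - \<zeta>)"
      using phi_dual_upper[OF \<eta>, of \<zeta>] by (simp add: inner_diff_left)
  qed
  from this[of \<xi> \<zeta>] this[of \<zeta> \<xi>] show ?thesis by (simp add: norm_minus_commute abs_le_iff)
qed

lemma phi_dual_continuous: "continuous_on UNIV phi_dual"
  unfolding continuous_on_iff
proof (intro ballI allI impI)
  fix x :: "real^2" and e :: real assume "0 < e"
  then have "dist (phi_dual y) (phi_dual x) < e" if "dist y x < e / 2" for y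
    using phi_dual_lipschitz[of y x] that by (simp add: dist_norm)
  then show "\<exists>d>0. \<forall>y\<in>UNIV. dist y x < d \<longrightarrow> dist (phi_dual y) (phi_dual x) < e"
    using \<open>0 < e\<close> by (intro exI[of _ "e / 2"]) auto
qed

lemma phi_dual_measurable [measurable]: "phi_dual \<in> borel_measurable borel"
  by (rule borel_measurable_continuous_onI[OF phi_dual_continuous])

section \<open>The calibration inequality along an arc\<close>

lemma linear_rot90: "linear rot90"
  by (rule linearI) (auto simp: rot90_def vec_eq_iff forall_2)

lemma rot90_measurable [measurable]: "rot90 \<in> borel_measurable borel"
  by (rule borel_measurable_continuous_onI[OF linear_continuous_on[OF linear_conv_bounded_linear[THEN iffD1, OF linear_rot90]]])

lemma rot90_minus: "rot90 (- v) = - rot90 v" by (rule linear_neg[OF linear_rot90])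
lemma rot90_scaleR: "rot90 (c *\<^sub>R v) = c *\<^sub>R rot90 v" by (rule linear_scale[OF linear_rot90])
lemma rot90_diff: "rot90 (u - v) = rot90 u - rot90 v" by (rule linear_diff[OF linear_rot90])
lemma rot90_add: "rot90 (u + v) = rot90 u + rot90 v" by (rule linear_add[OF linear_rot90])
lemma rot90_zero [simp]: "rot90 0 = 0" by (rule linear_0[OF linear_rot90])

lemma norm_rot90: "norm (rot90 v) = norm v"
  by (simp add: norm_vec_def L2_set_def sum_2 rot90_def add.commute)

text \<open>The linear function \<open>x \<mapsto> N \<bullet> rot90 x\<close>, placed on a line of the plane so that the measure of its images is measured by the same
  \<open>hausdorff1_outer\<close>.\<close>

definition potential :: "real^2 \<Rightarrow> real^2 \<Rightarrow> real^2" where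
  "potential N x = (N \<bullet> rot90 x) *\<^sub>R axis 1 1"

lemma dist_potential: "dist (potential N x) (potential N y) = \<bar>N \<bullet> rot90 (x - y)\<bar>"
  by (simp add: potential_def dist_norm rot90_diff inner_diff_right flip: scaleR_diff_left)

lemma wulff_potential_lipschitz: "N \<in> wulff \<Longrightarrow> dist (potential N x) (potential N y) \<le> 2 * dist x y"
  using Cauchy_Schwarz_ineq2[of N "rot90 (x - y)"] wulff_norm_le[of N] norm_rot90[of "x - y"]
    mult_right_mono[of "norm N" 2 "norm (x - y)"] by (simp add: dist_potential dist_norm[of x y])

lemma continuous_on_potential: "continuous_on S (potential N)"
  unfolding potential_def
  by (intro continuous_intros linear_continuous_on linear_conv_bounded_linear[THEN iffD1] linear_rot90)

lemma hausdorff1_potential_null: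
  assumes "N \<in> wulff" "hausdorff1_outer A = 0"
  shows "hausdorff1_outer (potential N ` A) = 0"
proof -
  have "hausdorff1_outer (potential N ` A) \<le> ennreal 2 * hausdorff1_outer A"
    by (rule hausdorff1_outer_lipschitz_image) (auto intro: wulff_potential_lipschitz assms)
  then show ?thesis using assms by simp
qed

text \<open>The calibration inequality for a single velocity \<open>v\<close>, in a homogeneous form that includes \<open>v = 0\<close>.\<close>

lemma potential_le_phi_dual_speed:
  assumes "N \<in> wulff"
  shows "\<bar>N \<bullet> rot90 v\<bar> \<le> norm v * phi_dual (rot90 (sgn v))"
proof -
  have "v = norm v *\<^sub>R sgn v" by (cases "v = 0") (simp_all add: sgn_div_norm)
  then have "N \<bullet> rot90 v = norm v * (N \<bullet> rot90 (sgn v))" by (metis inner_scaleR_right rot90_scaleR)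
  then show ?thesis using mult_left_mono[OF abs_wulff_inner_le_phi_dual[OF assms, of "rot90 (sgn v)"], of "norm v"]
    by (simp add: abs_mult)
qed

text \<open>At a parameter \<open>t\<close> with derivative \<open>v\<close>, the potential oscillates on \<open>{t - h..t + h}\<close> by about \<open>2 * h * \<bar>N \<bullet> rot90 v\<bar>\<close>,
  which is at most \<open>phi_dual\<close> of the unit normal times \<open>2 * h * norm v\<close>; and \<open>2 * h * norm v\<close> is about the chord, hence at most the arc length. The covering
  comparison turns this into the inequality for Borel sets. The normal of a curve is an unspecified vector where the parametrization has no
  derivative, so the integrand is replaced by a Borel function \<open>g\<close> below it that vanishes at such points.\<close>

lemma arc_calibration:
  fixes \<gamma> :: "real \<Rightarrow> real^2"
  assumes ac: "abs_cont a b \<gamma>" and inj: "inj_on \<gamma> {a..b}" and ab: "a < b"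
  obtains g where "g \<in> borel_measurable borel" "\<And>x. 0 \<le> g x" "\<And>x. x \<notin> \<gamma> ` {a..b} \<Longrightarrow> g x = 0"
    "\<And>t. t \<in> {a..b} \<Longrightarrow> g (\<gamma> t) \<le> phi_dual (rot90 (sgn (vector_derivative \<gamma> (at t))))"
    "\<And>N E. N \<in> wulff \<Longrightarrow> E \<in> sets borel \<Longrightarrow> E \<subseteq> \<gamma> ` {a..b} \<Longrightarrow>
       hausdorff1_outer (potential N ` E) \<le> (\<integral>\<^sup>+x\<in>E. ennreal (g x) \<partial>H1)"
proof -
  have cont: "continuous_on {a..b} \<gamma>" by (rule abs_cont_continuous_on[OF ac])
  let ?\<Gamma> = "\<gamma> ` {a..b}" and ?i = "the_inv_into {a..b} \<gamma>" and ?\<mu> = "arc_length_measure a b \<gamma>"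
  have \<Gamma>: "?\<Gamma> \<in> sets borel"
    by (intro borel_closed compact_imp_closed compact_continuous_image cont compact_Icc)
  obtain Z where Z: "Z \<in> null_sets lborel" "\<And>t. t \<in> {a<..<b} \<Longrightarrow> t \<notin> Z \<Longrightarrow> \<gamma> differentiable (at t)"
    using abs_cont_inj_differentiable_off_null[OF ac inj] ab by auto
  have Zb [measurable]: "Z \<in> sets borel" using Z(1) by auto
  define cl where "cl t = max a (min b t)" for t
  have cl: "cl t \<in> {a..b}" for t using ab by (auto simp: cl_def)
  have cl_id: "cl t = t" if "t \<in> {a..b}" for t using that by (auto simp: cl_def)
  have clcont: "continuous_on UNIV cl" unfolding cl_def by (intro continuous_intros)
  have gcont: "continuous_on UNIV (\<lambda>t. \<gamma> (cl t))"
    by (rule continuous_on_compose2[OF cont clcont]) (use cl in auto)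
  have gm [measurable]: "(\<lambda>t. \<gamma> (cl t)) \<in> borel_measurable borel"
    by (rule borel_measurable_continuous_onI[OF gcont])
  \<comment> \<open>The derivative as a limit of continuous functions, which makes it Borel measurable.\<close>
  define Dq where "Dq n t = real (Suc n) *\<^sub>R (\<gamma> (cl (t + 1 / real (Suc n))) - \<gamma> (cl t))" for n t
  have Dqm [measurable]: "Dq n \<in> borel_measurable borel" for n
    unfolding Dq_def using measurable_compose[OF _ gm, of "\<lambda>t. t + 1 / real (Suc n)" borel] by measurable
  define V where "V t = lim (\<lambda>n. Dq n t)" for t
  have Vm [measurable]: "V \<in> borel_measurable borel" unfolding V_def by measurable
  have V: "V t = vector_derivative \<gamma> (at t)" "(\<gamma> has_vector_derivative V t) (at t)"
    if t: "t \<in> {a<..<b}" "t \<notin> Z" for t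
  proof -
    have der: "(\<gamma> has_vector_derivative vector_derivative \<gamma> (at t)) (at t)"
      using Z(2)[OF t] vector_derivative_works by blast
    let ?v = "vector_derivative \<gamma> (at t)"
    have "((\<lambda>h. norm (\<gamma> (t + h) - \<gamma> t - h *\<^sub>R ?v) / norm h) \<longlongrightarrow> 0) (at 0)"
      using der by (simp add: has_vector_derivative_def has_derivative_at)
    moreover have "norm (\<gamma> (t + h) - \<gamma> t - h *\<^sub>R ?v) / norm h = norm ((\<gamma> (t + h) - \<gamma> t) /\<^sub>R h - ?v)" if "h \<noteq> 0" for h
    proof -
      have "(\<gamma> (t + h) - \<gamma> t) /\<^sub>R h - ?v = (\<gamma> (t + h) - \<gamma> t - h *\<^sub>R ?v) /\<^sub>R h"
        using that by (simp add: scaleR_diff_right)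
      then show ?thesis by (simp add: divide_inverse mult.commute)
    qed
    then have "eventually (\<lambda>h. norm (\<gamma> (t + h) - \<gamma> t - h *\<^sub>R ?v) / norm h = norm ((\<gamma> (t + h) - \<gamma> t) /\<^sub>R h - ?v)) (at 0)"
      by (simp add: eventually_at_filter)
    ultimately have "((\<lambda>h. norm ((\<gamma> (t + h) - \<gamma> t) /\<^sub>R h - ?v)) \<longlongrightarrow> 0) (at 0)"
      by (rule Lim_transform_eventually)
    then have "((\<lambda>h. (\<gamma> (t + h) - \<gamma> t) /\<^sub>R h) \<longlongrightarrow> ?v) (at 0)"
      by (rule LIM_zero_cancel[OF tendsto_norm_zero_cancel])
    moreover have "filterlim (\<lambda>n. 1 / real (Suc n)) (at 0) sequentially"
      by (intro filterlim_atI LIMSEQ_Suc lim_1_over_n) auto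
    ultimately have lim0: "(\<lambda>n. (\<gamma> (t + 1 / real (Suc n)) - \<gamma> t) /\<^sub>R (1 / real (Suc n))) \<longlonglongrightarrow> vector_derivative \<gamma> (at t)"
      by (rule filterlim_compose)
    have "eventually (\<lambda>n. 1 / real (Suc n) < b - t) sequentially"
      using t by (intro order_tendstoD(2)[OF LIMSEQ_Suc[OF lim_1_over_n]]) auto
    then have "eventually (\<lambda>n. (\<gamma> (t + 1 / real (Suc n)) - \<gamma> t) /\<^sub>R (1 / real (Suc n)) = Dq n t) sequentially"
    proof eventually_elim
      case (elim n)
      moreover have "0 \<le> 1 / real (Suc n)" by simp
      ultimately have "t + 1 / real (Suc n) \<in> {a..b}" "t \<in> {a..b}"
        using t(1) unfolding atLeastAtMost_iff greaterThanLessThan_iff by linarith+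
      then have "cl (t + 1 / real (Suc n)) = t + 1 / real (Suc n)" "cl t = t"
        by (simp_all only: cl_id)
      then show ?case by (simp add: Dq_def)
    qed
    with lim0 have "(\<lambda>n. Dq n t) \<longlonglongrightarrow> vector_derivative \<gamma> (at t)" by (rule Lim_transform_eventually)
    then show "V t = vector_derivative \<gamma> (at t)" unfolding V_def by (rule limI)
    with der show "(\<gamma> has_vector_derivative V t) (at t)" by simp
  qed
  define G where "G t = indicator ({a<..<b} - Z) t * phi_dual (rot90 (sgn (V t)))" for t
  have sgnm: "(\<lambda>t. sgn (V t)) \<in> borel_measurable borel"
    unfolding sgn_div_norm by measurable
  have Gm [measurable]: "G \<in> borel_measurable borel"
    unfolding G_def
    using measurable_compose[OF measurable_compose[OF sgnm rot90_measurable] phi_dual_measurable] by measurable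
  have G0: "0 \<le> G t" for t by (simp add: G_def phi_dual_nonneg)
  define g where "g x = indicator ?\<Gamma> x *\<^sub>R G (?i x)" for x
  have im: "?i \<in> borel_measurable (restrict_space borel ?\<Gamma>)"
    by (rule inj_arc_inverse_measurable[OF cont inj])
  have "(\<lambda>x. G (?i x)) \<in> borel_measurable (restrict_space borel ?\<Gamma>)"
    by (rule measurable_compose[OF im Gm])
  then have gmeas: "g \<in> borel_measurable borel"
    unfolding g_def using \<Gamma> by (subst (asm) borel_measurable_restrict_space_iff) auto
  have g_val: "g (\<gamma> t) = G t" if "t \<in> {a..b}" for t
    using that inj by (simp add: g_def the_inv_into_f_f)
  show thesis
  proof (rule that[OF gmeas])
    show "0 \<le> g x" for x by (simp add: g_def G0)
    show "g x = 0" if "x \<notin> ?\<Gamma>" for x using that by (simp add: g_def)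
    show "g (\<gamma> t) \<le> phi_dual (rot90 (sgn (vector_derivative \<gamma> (at t))))" if "t \<in> {a..b}" for t
      unfolding g_val[OF that] using V(1)[of t] phi_dual_nonneg by (simp add: G_def indicator_def)
    fix N E assume N: "N \<in> wulff" and E: "E \<in> sets borel" "E \<subseteq> ?\<Gamma>"
    define \<kappa> where "\<kappa> T = hausdorff1_outer (potential N ` \<gamma> ` (T \<inter> {a..b}))" for T
    interpret \<kappa>: lebesgue_null_premeasure \<kappa>
    proof
      show "\<kappa> A \<le> \<kappa> B" if "A \<subseteq> B" for A B
        unfolding \<kappa>_def using that by (intro hausdorff1_outer_mono image_mono) auto
      show "\<kappa> (\<Union>i::nat. A i) \<le> (\<Sum>i. \<kappa> (A i))" for A
      proof -
        have "potential N ` \<gamma> ` ((\<Union>i. A i) \<inter> {a..b}) = (\<Union>i. potential N ` \<gamma> ` (A i \<inter> {a..b}))" by blast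
        then show ?thesis unfolding \<kappa>_def by (simp only: hausdorff1_outer_countably_subadditive)
      qed
      show "\<kappa> A = 0" if "A \<in> null_sets lborel" for A
        unfolding \<kappa>_def using that
        by (intro hausdorff1_potential_null[OF N] abs_cont_null_image[OF ac] null_set_Int2) auto
    qed
    define T0 where "T0 = (\<lambda>t. \<gamma> (cl t)) -` E \<inter> {a..b}"
    have "(\<lambda>t. \<gamma> (cl t)) -` E \<in> sets borel" using measurable_sets[OF gm E(1)] by simp
    then have T0m [measurable]: "T0 \<in> sets borel" by (auto simp: T0_def)
    have T0: "T0 = {t \<in> {a..b}. \<gamma> t \<in> E}" by (auto simp: T0_def cl_id)
    define T where "T = T0 \<inter> ({a<..<b} - Z)"
    have Tm [measurable]: "T \<in> sets borel" unfolding T_def by measurable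
    have "\<gamma> ` T0 = E" using E(2) by (auto simp: T0)
    then have "hausdorff1_outer (potential N ` E) = \<kappa> T0"
      unfolding \<kappa>_def by (metis T0_def inf.orderE inf_le2)
    also have "\<dots> \<le> \<kappa> (T \<union> (Z \<union> {a, b}))"
    proof (rule \<kappa>.mono[OF T0m])
      show "T0 \<subseteq> T \<union> (Z \<union> {a, b})" by (auto simp: T_def T0)
    qed measurable
    also have "\<dots> \<le> \<kappa> T + \<kappa> (Z \<union> {a, b})" by (rule \<kappa>.Un) auto
    also have "\<kappa> (Z \<union> {a, b}) = 0"
      by (intro \<kappa>.null null_sets.Un Z(1)) (auto simp: null_sets_def emeasure_lborel_countable)
    also have "\<kappa> T + 0 \<le> (\<integral>\<^sup>+t\<in>T. ennreal (G t) \<partial>?\<mu>)"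
      unfolding add_0_right
    proof (rule \<kappa>.vitali_comparison_integral)
      show "emeasure ?\<mu> UNIV \<noteq> \<infinity>"
        using finite_measure.emeasure_finite[OF finite_measure_arc_length_measure[OF ac inj], of UNIV] by simp
      have "emeasure lborel T \<le> emeasure lborel {a..b}" by (rule emeasure_mono) (auto simp: T_def T0)
      then show "emeasure lborel T < \<infinity>" using ab by (simp add: le_less_trans)
      fix t d \<epsilon> :: real assume tT: "t \<in> T" and d: "0 < d" and \<epsilon>: "0 < \<epsilon>"
      have t: "t \<in> {a<..<b}" "t \<notin> Z" using tT by (auto simp: T_def)
      have Gt: "G t = phi_dual (rot90 (sgn (V t)))" using t by (simp add: G_def)
      \<comment> \<open>The linearization error \<open>\<eta>\<close> enters with the factor \<open>G t\<close> through the chord and with the factor 2 through the potential, as vectors of the Wulff shape have norm at most 2.\<close>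
      define \<eta> where "\<eta> = \<epsilon> / (G t + 2)"
      have \<eta>: "0 < \<eta>" "\<eta> * (G t + 2) = \<epsilon>" using \<epsilon> G0[of t] by (auto simp: \<eta>_def)
      have "\<exists>\<delta>>0. \<forall>s. norm (s - t) < \<delta> \<longrightarrow> norm (\<gamma> s - \<gamma> t - (s - t) *\<^sub>R V t) \<le> \<eta> * norm (s - t)"
        using V(2)[OF t] \<eta>(1) unfolding has_vector_derivative_def has_derivative_at_alt by blast
      then obtain \<delta> where \<delta>: "0 < \<delta>" "\<And>s. \<bar>s - t\<bar> < \<delta> \<Longrightarrow> norm (\<gamma> s - \<gamma> t - (s - t) *\<^sub>R V t) \<le> \<eta> * \<bar>s - t\<bar>"
        by auto
      define m where "m = min (min \<delta> d) (min (t - a) (b - t))"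
      have m: "0 < m" "m \<le> \<delta>" "m \<le> d" "m \<le> t - a" "m \<le> b - t"
        using \<delta>(1) d t by (auto simp: m_def)
      define h where "h = m / 3"
      have h: "0 < h" "h < \<delta>" "2 * h < d" "a \<le> t - h" "t + h \<le> b"
        using m unfolding h_def by linarith+
      let ?v = "norm (V t)"
      define R where "R = h * (?v * G t + 2 * \<eta>)"
      have pot: "\<bar>N \<bullet> rot90 (\<gamma> s) - N \<bullet> rot90 (\<gamma> t)\<bar> \<le> R" if s: "s \<in> {t - h..t + h}" for s
      proof -
        have sh: "\<bar>s - t\<bar> \<le> h" using s by auto
        then have "norm (\<gamma> s - \<gamma> t - (s - t) *\<^sub>R V t) \<le> \<eta> * \<bar>s - t\<bar>" using h by (intro \<delta>(2)) auto
        then have e: "norm (\<gamma> s - \<gamma> t - (s - t) *\<^sub>R V t) \<le> \<eta> * h" using sh \<eta>(1) by (meson mult_left_mono less_imp_le order_trans)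
        have "N \<bullet> rot90 (\<gamma> s) - N \<bullet> rot90 (\<gamma> t)
            = N \<bullet> rot90 (\<gamma> s - \<gamma> t - (s - t) *\<^sub>R V t) + (s - t) * (N \<bullet> rot90 (V t))"
          by (simp add: rot90_diff rot90_scaleR inner_diff_right)
        moreover have "\<bar>N \<bullet> rot90 (\<gamma> s - \<gamma> t - (s - t) *\<^sub>R V t)\<bar> \<le> 2 * (\<eta> * h)"
          using wulff_potential_lipschitz[OF N, of "\<gamma> s - \<gamma> t - (s - t) *\<^sub>R V t" 0] e by (simp add: dist_potential)
        moreover have "\<bar>(s - t) * (N \<bullet> rot90 (V t))\<bar> \<le> h * (?v * G t)"
          unfolding abs_mult Gt using sh potential_le_phi_dual_speed[OF N, of "V t"] by (intro mult_mono) auto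
        ultimately show ?thesis unfolding R_def by (simp add: algebra_simps abs_le_iff)
      qed
      let ?c = "N \<bullet> rot90 (\<gamma> t)"
      have R0: "0 \<le> R" using h \<eta> G0[of t] by (auto simp: R_def)
      have "potential N ` \<gamma> ` ({t - h..t + h} \<inter> {a..b}) \<subseteq> closed_segment ((?c - R) *\<^sub>R axis 1 1) ((?c + R) *\<^sub>R axis 1 1)"
      proof
        fix y assume "y \<in> potential N ` \<gamma> ` ({t - h..t + h} \<inter> {a..b})"
        then obtain s where s: "s \<in> {t - h..t + h}" "y = potential N (\<gamma> s)" by auto
        have "N \<bullet> rot90 (\<gamma> s) \<in> closed_segment (?c - R) (?c + R)"
          using pot[OF s(1)] R0 by (auto simp: closed_segment_eq_real_ivl)
        then have "(\<lambda>r. r *\<^sub>R axis 1 1) (N \<bullet> rot90 (\<gamma> s)) \<in> (\<lambda>r. r *\<^sub>R (axis 1 1 :: real^2)) ` closed_segment (?c - R) (?c + R)" by blast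
        also have "\<dots> = closed_segment ((?c - R) *\<^sub>R axis 1 1) ((?c + R) *\<^sub>R axis 1 1)"
          by (rule closed_segment_linear_image[symmetric]) (auto simp: linear_iff algebra_simps)
        finally show "y \<in> closed_segment ((?c - R) *\<^sub>R axis 1 1) ((?c + R) *\<^sub>R axis 1 1)"
          by (simp add: s potential_def)
      qed
      then have "\<kappa> {t - h..t + h} \<le> hausdorff1_outer (closed_segment ((?c - R) *\<^sub>R axis 1 1) ((?c + R) *\<^sub>R axis 1 1))"
        unfolding \<kappa>_def by (rule hausdorff1_outer_mono)
      also have "\<dots> \<le> ennreal (dist ((?c - R) *\<^sub>R axis 1 1) ((?c + R) *\<^sub>R axis 1 1 :: real^2))"
        by (rule hausdorff1_outer_segment_le)
      also have "dist ((?c - R) *\<^sub>R axis 1 1) ((?c + R) *\<^sub>R axis 1 1 :: real^2) = 2 * R"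
        using R0 by (simp add: dist_norm flip: scaleR_diff_left)
      also have "2 * R \<le> G t * dist (\<gamma> (t - h)) (\<gamma> (t + h)) + \<epsilon> * (2 * h)"
      proof -
        have "norm (\<gamma> (t + h) - \<gamma> t - h *\<^sub>R V t) \<le> \<eta> * h" using \<delta>(2)[of "t + h"] h by simp
        moreover have "norm (\<gamma> (t - h) - \<gamma> t + h *\<^sub>R V t) \<le> \<eta> * h" using \<delta>(2)[of "t - h"] h by simp
        moreover have "(2 * h) *\<^sub>R V t = (\<gamma> (t + h) - \<gamma> (t - h)) - (\<gamma> (t + h) - \<gamma> t - h *\<^sub>R V t) + (\<gamma> (t - h) - \<gamma> t + h *\<^sub>R V t)"
          by (simp add: algebra_simps scaleR_2 flip: scaleR_scaleR)
        then have "norm ((2 * h) *\<^sub>R V t) \<le> norm (\<gamma> (t + h) - \<gamma> (t - h)) + norm (\<gamma> (t + h) - \<gamma> t - h *\<^sub>R V t) + norm (\<gamma> (t - h) - \<gamma> t + h *\<^sub>R V t)"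
          using norm_triangle_ineq norm_triangle_ineq4 by (smt (verit))
        ultimately have "2 * h * ?v \<le> dist (\<gamma> (t - h)) (\<gamma> (t + h)) + 2 * \<eta> * h"
          using h by (simp add: dist_norm norm_minus_commute)
        then have "G t * (2 * h * ?v) \<le> G t * (dist (\<gamma> (t - h)) (\<gamma> (t + h)) + 2 * \<eta> * h)"
          using G0 by (intro mult_left_mono)
        moreover have "\<epsilon> * (2 * h) = G t * (2 * \<eta> * h) + 4 * \<eta> * h" unfolding \<eta>(2)[symmetric] by (simp add: algebra_simps)
        ultimately show ?thesis unfolding R_def by (simp add: algebra_simps)
      qed
      then have "ennreal (2 * R) \<le> ennreal (G t) * ennreal (dist (\<gamma> (t - h)) (\<gamma> (t + h))) + ennreal \<epsilon> * ennreal (2 * h)"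
        using G0[of t] \<epsilon> h by (simp add: ennreal_leI flip: ennreal_mult ennreal_plus)
      also have "\<dots> \<le> ennreal (G t) * emeasure ?\<mu> {t - h..t + h} + ennreal \<epsilon> * ennreal (2 * h)"
        using h by (intro add_right_mono mult_left_mono chord_le_arc_length_measure[OF ac inj]) auto
      finally show "\<exists>u v. u \<le> t \<and> t \<le> v \<and> u < v \<and> v - u < d \<and>
          \<kappa> {u..v} \<le> ennreal (G t) * emeasure ?\<mu> {u..v} + ennreal \<epsilon> * ennreal (v - u)"
        using h by (intro exI[of _ "t - h"] exI[of _ "t + h"]) auto
    qed (use G0 in auto)
    also have "\<dots> = (\<integral>\<^sup>+x. ennreal (G (?i x)) * indicator T (?i x) \<partial>restrict_space H1 ?\<Gamma>)"
      unfolding arc_length_measure_def by (rule nn_integral_distr[OF the_inv_into_measurable_H1[OF cont inj]]) simp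
    also have "\<dots> = (\<integral>\<^sup>+x. ennreal (G (?i x)) * indicator T (?i x) * indicator ?\<Gamma> x \<partial>H1)"
      using \<Gamma> by (subst nn_integral_restrict_space) auto
    also have "\<dots> \<le> (\<integral>\<^sup>+x\<in>E. ennreal (g x) \<partial>H1)"
      using inj by (intro nn_integral_mono) (auto simp: g_def T_def T0 indicator_def the_inv_into_f_f split: if_splits)
    finally show "hausdorff1_outer (potential N ` E) \<le> (\<integral>\<^sup>+x\<in>E. ennreal (g x) \<partial>H1)" .
  qed
qed

section \<open>The calibration inequality along a curve\<close>

lemmas is_curve_dom_cases = is_curve_def[THEN iffD1, THEN conjunct1]
lemmas is_curve_abs_cont_all = is_curve_def[THEN iffD1, THEN conjunct2, THEN conjunct1]
lemmas is_curve_inj_on = is_curve_def[THEN iffD1, THEN conjunct2, THEN conjunct2, THEN conjunct1]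
lemmas is_curve_closed = is_curve_def[THEN iffD1, THEN conjunct2, THEN conjunct2, THEN conjunct2]

lemma is_curve_dom:
  assumes "is_curve c"
  shows "{0<..<1} \<subseteq> dom c" "dom c \<subseteq> {0<..<1} \<union> {0, 1}"
proof -
  have "dom c = {0..1} \<or> dom c = {0..<1} \<or> dom c = {0<..<1}"
    using is_curve_dom_cases[OF assms] unfolding insert_iff empty_iff by argo
  then have "{0<..<1} \<subseteq> dom c \<and> dom c \<subseteq> {0<..<1} \<union> {0, 1}"
  proof (elim disjE)
    assume d: "dom c = {0..1}"
    show ?thesis unfolding d by (auto simp: less_le)
  next
    assume d: "dom c = {0..<1}"
    show ?thesis unfolding d by (auto simp: less_le)
  next
    assume d: "dom c = {0<..<1}"
    show ?thesis unfolding d by blast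
  qed
  then show "{0<..<1} \<subseteq> dom c" "dom c \<subseteq> {0<..<1} \<union> {0, 1}" by simp_all
qed

lemma is_curve_abs_cont: "is_curve c \<Longrightarrow> s \<le> t \<Longrightarrow> {s..t} \<subseteq> dom c \<Longrightarrow> abs_cont s t (par c)"
  using is_curve_abs_cont_all[THEN spec, THEN spec, THEN mp] by blast

text \<open>Absolute continuity is only given on compact subintervals, so a neighbourhood of each parameter inside such an interval is needed.\<close>

lemma is_curve_continuous_on:
  assumes c: "is_curve c"
  shows "continuous_on (dom c) (par c)"
  unfolding continuous_on_eq_continuous_within
proof
  fix x assume x: "x \<in> dom c"
  then have x01: "0 \<le> x" "x \<le> 1" using is_curve_dom(2)[OF c] by auto
  define a b where "a = (if x = 0 then 0 else x / 2)" and "b = (if x = 1 then 1 else (x + 1) / 2)"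
  \<comment> \<open>A neighbourhood of \<open>x\<close> in which the parameter domain coincides with \<open>{a..b}\<close>; it extends beyond 0 and 1.\<close>
  define W where "W = {(if x = 0 then -1 else x / 2) <..< (if x = 1 then 2 else (x + 1) / 2)}"
  have ab: "a \<le> x" "x \<le> b" "x \<in> W" using x01 by (auto simp: a_def b_def W_def)
  have sub: "{a..b} \<subseteq> dom c"
  proof
    fix y assume y: "y \<in> {a..b}"
    have "y = x \<or> y \<in> {0<..<1}" using y x01 by (auto simp: a_def b_def split: if_splits)
    then show "y \<in> dom c" using x is_curve_dom(1)[OF c] by auto
  qed
  have W: "dom c \<inter> W \<subseteq> {a..b}"
    using is_curve_dom(2)[OF c] x01 by (auto simp: a_def b_def W_def split: if_splits)
  have "at x within dom c = at x within {a..b}"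
    by (rule at_within_nhd[OF ab(3)]) (use sub W in \<open>auto simp: W_def\<close>)
  moreover have "continuous (at x within {a..b}) (par c)"
    using abs_cont_continuous_on[OF is_curve_abs_cont[OF c _ sub]] ab by (auto simp: continuous_on_eq_continuous_within)
  ultimately show "continuous (at x within dom c) (par c)" by simp
qed

lemma carrier_path_connected:
  assumes c: "is_curve c"
  shows "path_connected (carrier c)"
proof -
  have "dom c \<in> {{0..1}, {0..<1}, {0<..<1}}" by (rule is_curve_dom_cases[OF c])
  then have "path_connected (dom c)" by (auto intro!: convex_imp_path_connected)
  then show ?thesis unfolding carrier_def
    by (rule path_connected_continuous_image[OF is_curve_continuous_on[OF c]])
qed

text \<open>The intervals \<open>{inner_left n..inner_right n}\<close> exhaust the open unit interval; on each of them a curve is an absolutely continuous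
  injective arc, whatever it does at its ends.\<close>

definition inner_left :: "nat \<Rightarrow> real" where "inner_left n = 1 / real (n + 3)"
definition inner_right :: "nat \<Rightarrow> real" where "inner_right n = 1 - 1 / real (n + 3)"

lemma inner_bounds: "0 < inner_left n" "inner_left n < inner_right n" "inner_right n < 1"
  by (auto simp: inner_left_def inner_right_def field_simps)

lemma inner_exhaust: "t \<in> {0<..<1} \<Longrightarrow> \<exists>n. t \<in> {inner_left n<..<inner_right n}"
proof -
  assume t: "t \<in> {0<..<1}"
  then have "0 < min t (1 - t)" by simp
  then obtain n where n: "1 / real (Suc n) < min t (1 - t)" using nat_approx_posE by blast
  have "1 / real (n + 3) \<le> 1 / real (Suc n)" by (intro frac_le) auto
  then show ?thesis using n by (intro exI[of _ n]) (auto simp: inner_left_def inner_right_def)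
qed

lemma is_curve_inner:
  assumes c: "is_curve c"
  shows "abs_cont (inner_left n) (inner_right n) (par c)" "inj_on (par c) {inner_left n..inner_right n}"
    "{inner_left n..inner_right n} \<subseteq> {0<..<1}"
proof -
  show sub: "{inner_left n..inner_right n} \<subseteq> {0<..<1}" using inner_bounds[of n] by auto
  then show "abs_cont (inner_left n) (inner_right n) (par c)"
    using inner_bounds[of n] is_curve_dom(1)[OF c] by (intro is_curve_abs_cont[OF c]) auto
  have "inj_on (par c) {0<..<1}" by (rule is_curve_inj_on[OF c])
  then show "inj_on (par c) {inner_left n..inner_right n}" by (rule inj_on_subset[OF _ sub])
qed

lemma carrier_decompose:
  assumes c: "is_curve c"
  shows "carrier c \<subseteq> (\<Union>n. par c ` {inner_left n..inner_right n}) \<union> {par c 0, par c 1}"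
proof
  fix x assume "x \<in> carrier c"
  then obtain t where t: "t \<in> dom c" "x = par c t" by (auto simp: carrier_def)
  then consider "t \<in> {0<..<1}" | "t = 0" | "t = 1" using is_curve_dom(2)[OF c] by auto
  then show "x \<in> (\<Union>n. par c ` {inner_left n..inner_right n}) \<union> {par c 0, par c 1}"
  proof cases
    case 1
    then obtain n where "t \<in> {inner_left n<..<inner_right n}" using inner_exhaust by blast
    then have "t \<in> {inner_left n..inner_right n}" by auto
    then show ?thesis using t(2) by blast
  qed (use t in auto)
qed

lemma normal_par:
  assumes c: "is_curve c" and t: "t \<in> {0<..<1}"
  shows "normal c (par c t) = rot90 (sgn (vector_derivative (par c) (at t)))"
proof -
  have "inj_on (par c) {0<..<1}" by (rule is_curve_inj_on[OF c])
  then show ?thesis using t by (simp add: normal_def tangent_def the_inv_into_f_f)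
qed

text \<open>The local inequality is summed over the disjoint pieces of the curve that correspond to the exhausting intervals; the supremum of the
  minorants is a common minorant.\<close>

lemma curve_calibration:
  assumes c: "is_curve c"
  obtains g :: "real^2 \<Rightarrow> ennreal" where "g \<in> borel_measurable borel"
    "\<And>x. g x \<le> ennreal (phi_dual (normal c x))"
    "\<And>N E. N \<in> wulff \<Longrightarrow> E \<in> sets borel \<Longrightarrow> E \<subseteq> carrier c \<Longrightarrow>
       hausdorff1_outer (potential N ` E) \<le> (\<integral>\<^sup>+x\<in>E. g x \<partial>H1)"
proof -
  let ?I = "\<lambda>n. {inner_left n..inner_right n}" and ?\<gamma> = "par c"
  define P where "P n g \<longleftrightarrow> g \<in> borel_measurable borel \<and> (\<forall>x. 0 \<le> g x) \<and> (\<forall>x. x \<notin> ?\<gamma> ` ?I n \<longrightarrow> g x = 0) \<and>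
    (\<forall>t\<in>?I n. g (?\<gamma> t) \<le> phi_dual (rot90 (sgn (vector_derivative ?\<gamma> (at t))))) \<and>
    (\<forall>N E. N \<in> wulff \<longrightarrow> E \<in> sets borel \<longrightarrow> E \<subseteq> ?\<gamma> ` ?I n \<longrightarrow>
       hausdorff1_outer (potential N ` E) \<le> (\<integral>\<^sup>+x\<in>E. ennreal (g x) \<partial>H1))" for n g
  have "\<exists>g. P n g" for n
  proof (rule arc_calibration[OF is_curve_inner(1)[OF c, of n] is_curve_inner(2)[OF c, of n] inner_bounds(2)[of n]], goal_cases)
    case (1 g)
    show ?case unfolding P_def by (intro exI[of _ g] conjI allI ballI impI 1)
  qed
  then obtain h where P: "\<And>n. P n (h n)" by metis
  note P' = P[unfolded P_def]
  note h = P'[THEN conjunct1] P'[THEN conjunct2, THEN conjunct1, rule_format]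
    P'[THEN conjunct2, THEN conjunct2, THEN conjunct1, rule_format]
    P'[THEN conjunct2, THEN conjunct2, THEN conjunct2, THEN conjunct1, rule_format]
    P'[THEN conjunct2, THEN conjunct2, THEN conjunct2, THEN conjunct2, rule_format]
  note [measurable] = h(1)
  define g where "g x = (SUP n. ennreal (h n x))" for x
  have gm [measurable]: "g \<in> borel_measurable borel" unfolding g_def by measurable
  show thesis
  proof (rule that[OF gm])
    show "g x \<le> ennreal (phi_dual (normal c x))" for x
      unfolding g_def
    proof (rule SUP_least)
      fix n
      show "ennreal (h n x) \<le> ennreal (phi_dual (normal c x))"
      proof (cases "x \<in> ?\<gamma> ` ?I n")
        case True
        then obtain t where t: "t \<in> ?I n" "x = ?\<gamma> t" by blast
        then have "t \<in> {0<..<1}" using is_curve_inner(3)[OF c] by blast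
        then show ?thesis using h(4)[OF t(1)] normal_par[OF c] t(2) by (simp add: ennreal_leI)
      qed (simp add: h(3))
    qed
    fix N E assume N: "N \<in> wulff" and E: "E \<in> sets borel" "E \<subseteq> carrier c"
    define K where "K = disjointed (\<lambda>n. ?\<gamma> ` ?I n)"
    have \<Gamma>: "?\<gamma> ` ?I n \<in> sets borel" for n
      by (intro borel_closed compact_imp_closed compact_continuous_image compact_Icc
          abs_cont_continuous_on[OF is_curve_inner(1)[OF c]])
    have "range K \<subseteq> sets borel" unfolding K_def by (rule sets.range_disjointed_sets) (use \<Gamma> in blast)
    then have Km: "E \<inter> K n \<in> sets borel" for n
      using E(1) by (intro sets.Int) auto
    have disj: "disjoint_family (\<lambda>n. E \<inter> K n)"
      unfolding K_def by (rule disjoint_family_on_bisimulation[OF disjoint_family_disjointed[of "\<lambda>n. ?\<gamma> ` ?I n"]]) blast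
    have UK: "(\<Union>n. K n) = (\<Union>n. ?\<gamma> ` ?I n)" unfolding K_def by (rule UN_disjointed_eq)
    have Ksub: "K n \<subseteq> ?\<gamma> ` ?I n" for n unfolding K_def by (rule disjointed_subset)
    have "E \<subseteq> (\<Union>n. K n) \<union> {?\<gamma> 0, ?\<gamma> 1}"
      using order_trans[OF E(2) carrier_decompose[OF c]] unfolding UK .
    then have "potential N ` E \<subseteq> (\<Union>n. potential N ` (E \<inter> K n)) \<union> potential N ` {?\<gamma> 0, ?\<gamma> 1}" by auto
    then have "hausdorff1_outer (potential N ` E) \<le> hausdorff1_outer (\<Union>n. potential N ` (E \<inter> K n)) + hausdorff1_outer (potential N ` {?\<gamma> 0, ?\<gamma> 1})"
      using hausdorff1_outer_mono hausdorff1_outer_Un order_trans by blast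
    also have "hausdorff1_outer (potential N ` {?\<gamma> 0, ?\<gamma> 1}) = 0"
    proof (rule hausdorff1_potential_null[OF N])
      show "hausdorff1_outer {?\<gamma> 0, ?\<gamma> 1} = 0"
        using hausdorff1_outer_Un[of "{?\<gamma> 0}" "{?\<gamma> 1}"] by (simp add: insert_commute)
    qed
    also have "hausdorff1_outer (\<Union>n. potential N ` (E \<inter> K n)) + 0 \<le> (\<Sum>n. hausdorff1_outer (potential N ` (E \<inter> K n)))"
      using hausdorff1_outer_countably_subadditive by simp
    also have "\<dots> \<le> (\<Sum>n. emeasure (density H1 g) (E \<inter> K n))"
    proof (rule suminf_le)
      fix n
      have "hausdorff1_outer (potential N ` (E \<inter> K n)) \<le> (\<integral>\<^sup>+x\<in>E \<inter> K n. ennreal (h n x) \<partial>H1)"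
        using Ksub by (intro h(5) N Km) blast
      also have "\<dots> \<le> (\<integral>\<^sup>+x\<in>E \<inter> K n. g x \<partial>H1)"
        by (intro nn_integral_mono mult_right_mono) (auto simp: g_def intro: SUP_upper)
      also have "\<dots> = emeasure (density H1 g) (E \<inter> K n)"
        using Km by (subst emeasure_density) auto
      finally show "hausdorff1_outer (potential N ` (E \<inter> K n)) \<le> emeasure (density H1 g) (E \<inter> K n)" .
    qed auto
    also have "\<dots> = emeasure (density H1 g) (\<Union>n. E \<inter> K n)"
      using Km disj by (intro suminf_emeasure) auto
    also have "\<dots> \<le> emeasure (density H1 g) E"
      using E(1) by (intro emeasure_mono) auto
    also have "\<dots> = (\<integral>\<^sup>+x\<in>E. g x \<partial>H1)"
      using E(1) by (subst emeasure_density) auto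
    finally show "hausdorff1_outer (potential N ` E) \<le> (\<integral>\<^sup>+x\<in>E. g x \<partial>H1)" .
  qed
qed

lemma AE_curve_differentiable:
  assumes c: "is_curve c"
  shows "AE x in H1. x \<in> carrier c \<longrightarrow> (\<exists>t\<in>{0<..<1}. x = par c t \<and> par c differentiable (at t))"
proof -
  let ?I = "\<lambda>n. {inner_left n..inner_right n}" and ?\<gamma> = "par c"
  have "\<exists>Z\<in>null_sets lborel. \<forall>t\<in>{inner_left n<..<inner_right n}. t \<notin> Z \<longrightarrow> ?\<gamma> differentiable (at t)" for n
    using inner_bounds(2)[of n] by (intro abs_cont_inj_differentiable_off_null is_curve_inner[OF c]) auto
  then obtain Z where Z: "\<And>n. Z n \<in> null_sets lborel"
    "\<And>n t. t \<in> {inner_left n<..<inner_right n} \<Longrightarrow> t \<notin> Z n \<Longrightarrow> ?\<gamma> differentiable (at t)"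
    by metis
  define M where "M = (\<Union>n. ?\<gamma> ` (Z n \<inter> ?I n)) \<union> {?\<gamma> 0} \<union> {?\<gamma> 1}"
  have "?\<gamma> ` (Z n \<inter> ?I n) \<in> null_sets H1" for n
  proof -
    have b: "?\<gamma> ` (Z n \<inter> ?I n) \<in> sets borel"
      using Z(1)[of n] by (intro inj_arc_image_borel[OF abs_cont_continuous_on[OF is_curve_inner(1)[OF c]] is_curve_inner(2)[OF c]]) auto
    moreover have "hausdorff1_outer (?\<gamma> ` (Z n \<inter> ?I n)) = 0"
      using Z(1)[of n] by (intro abs_cont_null_image[OF is_curve_inner(1)[OF c]] null_set_Int2) auto
    ultimately show ?thesis using emeasure_H1[OF b] by (simp add: null_sets_def)
  qed
  moreover have "{x} \<in> null_sets H1" for x by (simp add: null_sets_def emeasure_H1)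
  ultimately have "M \<in> null_sets H1" unfolding M_def by (intro null_sets.Un null_sets_UN)
  then show ?thesis
  proof (rule AE_I')
    show "{x \<in> space H1. \<not> (x \<in> carrier c \<longrightarrow> (\<exists>t\<in>{0<..<1}. x = ?\<gamma> t \<and> ?\<gamma> differentiable (at t)))} \<subseteq> M"
    proof
      fix x assume "x \<in> {x \<in> space H1. \<not> (x \<in> carrier c \<longrightarrow> (\<exists>t\<in>{0<..<1}. x = ?\<gamma> t \<and> ?\<gamma> differentiable (at t)))}"
      then have x: "x \<in> carrier c" "\<And>t. t \<in> {0<..<1} \<Longrightarrow> x = ?\<gamma> t \<Longrightarrow> \<not> ?\<gamma> differentiable (at t)" by auto
      then obtain t where t: "t \<in> dom c" "x = ?\<gamma> t" by (auto simp: carrier_def)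
      show "x \<in> M"
      proof (cases "t \<in> {0<..<1}")
        case True
        then obtain n where n: "t \<in> {inner_left n<..<inner_right n}" using inner_exhaust by blast
        then have "t \<in> Z n" using Z(2)[OF n] x(2)[OF True t(2)] by blast
        then have "t \<in> Z n \<inter> ?I n" using n by auto
        then show ?thesis unfolding M_def t(2) by blast
      next
        case False
        then have "t = 0 \<or> t = 1" using t is_curve_dom(2)[OF c] by auto
        then show ?thesis unfolding M_def t(2) by auto
      qed
    qed
  qed
qed

section \<open>Curves that run along a half-line\<close>

text \<open>A continuous injective function on an interval is strictly monotone.\<close>

lemma continuous_inj_not_min:
  fixes s :: "real \<Rightarrow> real"
  assumes cont: "continuous_on {0<..<1} s" and inj: "inj_on s {0<..<1}"
    and t: "t \<in> {0<..<1}" and min: "\<And>u. u \<in> {0<..<1} \<Longrightarrow> s t \<le> s u"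
  shows False
proof -
  let ?a = "t / 2" and ?b = "(t + 1) / 2"
  have "(s ?a < s t \<and> s t < s ?b) \<or> (s ?b < s t \<and> s t < s ?a)"
    using t by (intro continuous_inj_imp_mono continuous_on_subset[OF cont] inj_on_subset[OF inj]) auto
  moreover have "s t \<le> s ?a" "s t \<le> s ?b" using t by (auto intro!: min)
  ultimately show False by linarith
qed

text \<open>A curve whose carrier is a half-line can only run once along it, starting from its vertex.\<close>

locale ray_curve =
  fixes c :: curve and X v :: "real^2"
  assumes c: "is_curve c" and v: "v \<noteq> 0" and ray: "carrier c = half_line X v"
begin

definition param :: "real \<Rightarrow> real" where "param t = ((par c t - X) \<bullet> v) / (v \<bullet> v)"

lemma inner_v_pos: "0 < v \<bullet> v" using v by simp

lemma par_eq: "t \<in> dom c \<Longrightarrow> par c t = X + param t *\<^sub>R v \<and> 0 \<le> param t"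
proof -
  assume "t \<in> dom c"
  then have "par c t \<in> half_line X v" using ray by (auto simp: carrier_def)
  then obtain s where "par c t = X + s *\<^sub>R v" "0 \<le> s" by (auto simp: half_line_def)
  then show ?thesis using inner_v_pos by (simp add: param_def)
qed

lemma param_surj: "0 \<le> r \<Longrightarrow> \<exists>t\<in>dom c. param t = r"
proof -
  assume "0 \<le> r"
  then have "X + r *\<^sub>R v \<in> carrier c" unfolding ray by (auto simp: half_line_def)
  then obtain t where "t \<in> dom c" "par c t = X + r *\<^sub>R v" by (auto simp: carrier_def)
  then show ?thesis using inner_v_pos by (intro bexI[of _ t]) (auto simp: param_def)
qed

lemma continuous_param: "continuous_on (dom c) param"
  unfolding param_def using inner_v_pos by (intro continuous_intros is_curve_continuous_on c) auto

lemma inj_param: "inj_on param {0<..<1}"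
proof (rule inj_onI)
  fix s t :: real assume st: "s \<in> {0<..<1}" "t \<in> {0<..<1}" "param s = param t"
  then have "s \<in> dom c" "t \<in> dom c" using is_curve_dom(1)[OF c] by auto
  then have "par c s = par c t" using par_eq[of s] par_eq[of t] st(3) by simp
  then show "s = t" using is_curve_inj_on[OF c] st by (auto dest: inj_onD)
qed

lemma continuous_param_inner: "continuous_on {0<..<1} param"
  by (rule continuous_on_subset[OF continuous_param is_curve_dom(1)[OF c]])

lemma param_inner_pos: "t \<in> {0<..<1} \<Longrightarrow> 0 < param t"
proof (rule ccontr)
  assume t: "t \<in> {0<..<1}" and "\<not> 0 < param t"
  have ge: "0 \<le> param u" if "u \<in> {0<..<1}" for u
    using par_eq[of u] is_curve_dom(1)[OF c] that by auto
  show False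
    by (rule continuous_inj_not_min[OF continuous_param_inner inj_param t]) (use ge \<open>\<not> 0 < param t\<close> in force)
qed

text \<open>A compact carrier is bounded, and a minimum of \<open>param\<close> cannot be attained at an interior parameter; so the vertex is the value at the
  parameter 0.\<close>

lemma dom_ray: "dom c = {0..<1}" and par_0: "par c 0 = X"
proof -
  have not_cpt: "dom c \<noteq> {0..1}"
  proof
    assume d: "dom c = {0..1}"
    then have "compact (param ` {0..1})" using continuous_param by (intro compact_continuous_image) auto
    then obtain B where B: "\<And>t. t \<in> {0..1} \<Longrightarrow> norm (param t) \<le> B"
      using compact_imp_bounded[of "param ` {0..1}"] unfolding bounded_iff by blast
    obtain t where t: "t \<in> {0..1}" "param t = \<bar>B\<bar> + 1" using param_surj[of "\<bar>B\<bar> + 1"] d by auto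
    show False using B[OF t(1)] t(2) by auto
  qed
  obtain t0 where t0: "t0 \<in> dom c" "param t0 = 0" using param_surj[of 0] by auto
  then have "t0 \<notin> {0<..<1}" using param_inner_pos[of t0] by auto
  then have "dom c \<noteq> {0<..<1}" using t0(1) by force
  note not_open = this
  have "dom c = {0..1} \<or> dom c = {0..<1} \<or> dom c = {0<..<1} \<or> False"
    using is_curve_dom_cases[OF c] unfolding insert_iff empty_iff .
  then show d: "dom c = {0..<1}"
  proof (elim disjE FalseE)
    assume "dom c = {0..1}"
    with not_cpt show ?thesis by contradiction
  next
    assume "dom c = {0<..<1}"
    with not_open show ?thesis by contradiction
  qed
  have "t0 = 0" using t0(1) \<open>t0 \<notin> {0<..<1}\<close> unfolding d by auto
  then show "par c 0 = X" using par_eq[OF t0(1)] t0(2) by simp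
qed

lemma param_0: "param 0 = 0"
  by (simp add: param_def par_0)

lemma param_less: "0 < s \<Longrightarrow> s < t \<Longrightarrow> t < 1 \<Longrightarrow> param s < param t"
proof -
  assume st: "0 < s" "s < t" "t < 1"
  have "inj_on param {0..t}"
  proof (rule inj_onI)
    fix x y assume xy: "x \<in> {0..t}" "y \<in> {0..t}" "param x = param y"
    show "x = y"
    proof (cases "x = 0 \<or> y = 0")
      case True
      then have "\<not> (x \<in> {0<..<1})" "\<not> (y \<in> {0<..<1})"
        using xy(3) param_0 param_inner_pos[of x] param_inner_pos[of y] by auto
      then show ?thesis using xy st by auto
    next
      case False
      then show ?thesis using xy st inj_onD[OF inj_param, of x y] by auto
    qed
  qed
  moreover have "continuous_on {0..t} param"
  proof (rule continuous_on_subset[OF continuous_param])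
    show "{0..t} \<subseteq> dom c" unfolding dom_ray using st by (simp add: subset_eq)
  qed
  ultimately have "(param 0 < param s \<and> param s < param t) \<or> (param t < param s \<and> param s < param 0)"
    by (intro continuous_inj_imp_mono) (use st in auto)
  then show ?thesis using param_inner_pos[of s] param_0 st by auto
qed

lemma vector_derivative_ray:
  assumes t: "t \<in> {0<..<1}" and diff: "par c differentiable (at t)"
  shows "\<exists>\<alpha>\<ge>0. vector_derivative (par c) (at t) = \<alpha> *\<^sub>R v"
proof -
  let ?d = "vector_derivative (par c) (at t)"
  have der: "(par c has_vector_derivative ?d) (at t)" using diff vector_derivative_works by blast
  have "((\<lambda>t. (par c t - X) \<bullet> v / (v \<bullet> v)) has_vector_derivative (?d \<bullet> v / (v \<bullet> v))) (at t)"
    using der unfolding has_vector_derivative_def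
    using v by (auto intro!: derivative_eq_intros simp: inner_diff_left field_simps)
  then have s': "(param has_real_derivative (?d \<bullet> v / (v \<bullet> v))) (at t)"
    unfolding param_def[abs_def] by (simp add: has_real_derivative_iff_has_vector_derivative)
  have "mono_on {0<..<1} param"
  proof (rule mono_onI)
    fix r s :: real assume "r \<in> {0<..<1}" "s \<in> {0<..<1}" "r \<le> s"
    then show "param r \<le> param s" using param_less[of r s] by (cases "r = s") (auto simp: less_le)
  qed
  then have nn: "0 \<le> ?d \<bullet> v / (v \<bullet> v)"
    by (rule mono_on_imp_deriv_nonneg[OF _ s']) (use t in \<open>simp add: interior_open\<close>)
  have "((\<lambda>t. X + param t *\<^sub>R v) has_vector_derivative (?d \<bullet> v / (v \<bullet> v)) *\<^sub>R v) (at t)"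
    using s' by (auto intro!: derivative_eq_intros simp: has_real_derivative_iff_has_vector_derivative)
  then have "(par c has_vector_derivative (?d \<bullet> v / (v \<bullet> v)) *\<^sub>R v) (at t)"
  proof (rule has_vector_derivative_transform_within_open[OF _ open_greaterThanLessThan t])
    fix u :: real assume "u \<in> {0<..<1}"
    then show "X + param u *\<^sub>R v = par c u" using par_eq[of u] is_curve_dom(1)[OF c] by auto
  qed
  then have "?d = (?d \<bullet> v / (v \<bullet> v)) *\<^sub>R v" by (rule vector_derivative_at)
  with nn show ?thesis by blast
qed

lemma AE_normal: "AE x in H1. x \<in> carrier c \<longrightarrow> normal c x = 0 \<or> normal c x = rot90 (sgn v)"
  using AE_curve_differentiable[OF c]
proof eventually_elim
  case (elim x)
  show ?case
  proof
    assume "x \<in> carrier c"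
    then obtain t where t: "t \<in> {0<..<1}" "x = par c t" "par c differentiable (at t)" using elim by blast
    obtain \<alpha> where \<alpha>: "0 \<le> \<alpha>" "vector_derivative (par c) (at t) = \<alpha> *\<^sub>R v"
      using vector_derivative_ray[OF t(1,3)] by blast
    have "normal c x = rot90 (sgn (\<alpha> *\<^sub>R v))" using normal_par[OF c t(1)] \<alpha>(2) t(2) by simp
    then show "normal c x = 0 \<or> normal c x = rot90 (sgn v)"
      using \<alpha>(1) by (cases "\<alpha> = 0") (auto simp: sgn_scaleR)
  qed
qed

lemma AE_phi_dual_normal_le: "AE x in H1. x \<in> carrier c \<longrightarrow> phi_dual (normal c x) \<le> phi_dual (rot90 (sgn v))"
  using AE_normal by eventually_elim (auto simp: phi_dual_nonneg)

lemma closed_half_line: "closed (carrier c)" by (rule is_curve_closed[OF c])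

text \<open>The condition on the field holds almost everywhere, and so does \<open>normal c x \<in> {0, rot90 (sgn v)}\<close>. If the asserted equality failed, the
  normal would vanish almost everywhere; then the calibration inequality would give images of measure zero, although a suitable potential
  does not vanish on \<open>v\<close>.\<close>

lemma calibrated:
  assumes cal: "AE x in H1. x \<in> carrier c \<longrightarrow> N \<bullet> normal c x = phi_dual (normal c x)"
  shows "N \<bullet> rot90 (sgn v) = phi_dual (rot90 (sgn v))"
proof (rule ccontr)
  assume ne: "N \<bullet> rot90 (sgn v) \<noteq> phi_dual (rot90 (sgn v))"
  have z: "AE x in H1. x \<in> carrier c \<longrightarrow> normal c x = 0"
    using AE_normal cal by eventually_elim (use ne in auto)
  obtain g :: "real^2 \<Rightarrow> ennreal" where g: "g \<in> borel_measurable borel"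
    "\<And>x. g x \<le> ennreal (phi_dual (normal c x))"
    "\<And>N E. N \<in> wulff \<Longrightarrow> E \<in> sets borel \<Longrightarrow> E \<subseteq> carrier c \<Longrightarrow>
       hausdorff1_outer (potential N ` E) \<le> (\<integral>\<^sup>+x\<in>E. g x \<partial>H1)"
  proof (rule curve_calibration[OF c], goal_cases)
    case (1 g)
    show thesis by (rule 1(1)) (fact 1)+
  qed
  have "AE x in H1. g x * indicator (carrier c) x = 0"
    using z
  proof eventually_elim
    case (elim x)
    then show ?case using g(2)[of x] by (cases "x \<in> carrier c") auto
  qed
  then have int0: "(\<integral>\<^sup>+x\<in>carrier c. g x \<partial>H1) = 0"
    using nn_integral_cong_AE[of "\<lambda>x. g x * indicator (carrier c) x" "\<lambda>_. 0" H1] by simp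
  obtain r y where ry: "0 < r" "y \<in> wulff" "rot90 v = r *\<^sub>R y"
    using wulff_absorbing[of "rot90 v"] by blast
  have "y \<noteq> 0" using ry v norm_rot90[of v] by auto
  then have pos: "0 < y \<bullet> rot90 v" using ry by simp
  have "hausdorff1_outer (potential y ` carrier c) = 0"
    using g(3)[OF ry(2), of "carrier c"] closed_half_line int0 by simp
  moreover have "connected (potential y ` carrier c)"
    by (intro connected_continuous_image continuous_on_potential path_connected_imp_connected carrier_path_connected c)
  then have "ennreal (dist (potential y X) (potential y (X + v))) \<le> hausdorff1_outer (potential y ` carrier c)"
  proof (rule dist_le_hausdorff1_outer_connected)
    have "X + 0 *\<^sub>R v \<in> carrier c" "X + 1 *\<^sub>R v \<in> carrier c"
      unfolding ray half_line_def by (intro CollectI exI conjI, rule refl, simp)+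
    then show "potential y X \<in> potential y ` carrier c" "potential y (X + v) \<in> potential y ` carrier c"
      by simp_all
  qed
  moreover have "dist (potential y X) (potential y (X + v)) = y \<bullet> rot90 v"
    using pos by (simp add: dist_potential rot90_minus)
  ultimately show False using pos by simp
qed

end

section \<open>Continua joining three points\<close>

text \<open>Each member lies in one path component, so a path component and its complement are finite unions of members, hence closed.\<close>

lemma path_connected_Union_finite_closed:
  fixes F :: "'a::topological_space set set"
  assumes F: "finite F" "\<And>c. c \<in> F \<Longrightarrow> closed c" "\<And>c. c \<in> F \<Longrightarrow> path_connected c"
    and conn: "connected (\<Union>F)"
  shows "path_connected (\<Union>F)"
  unfolding path_connected_component_set
proof
  fix x assume x: "x \<in> \<Union>F"
  define P where "P = path_component_set (\<Union>F) x"
  have all: "c \<subseteq> P" if c: "c \<in> F" and y: "y \<in> c" "y \<in> P" for c y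
  proof -
    have "c \<subseteq> path_component_set (\<Union>F) y"
      by (rule path_component_maximal[OF y(1) F(3)[OF c] Union_upper[OF c]])
    also have "path_component_set (\<Union>F) y = P"
      using y(2) unfolding P_def by (rule path_component_eq)
    finally show ?thesis .
  qed
  define A where "A = \<Union>{c \<in> F. c \<inter> P \<noteq> {}}"
  define B where "B = \<Union>{c \<in> F. c \<inter> P = {}}"
  have cl: "closed A" "closed B" unfolding A_def B_def using F by (auto intro!: closed_Union)
  have AP: "A \<subseteq> P"
  proof
    fix y assume "y \<in> A"
    then obtain c z where "c \<in> F" "z \<in> c" "z \<in> P" "y \<in> c" unfolding A_def by blast
    then show "y \<in> P" using all[of c z] by auto
  qed
  have BP: "B \<inter> P = {}" unfolding B_def by auto
  have cov: "\<Union>F \<subseteq> A \<union> B"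
  proof
    fix y assume "y \<in> \<Union>F"
    then obtain c where "c \<in> F" "y \<in> c" by (rule UnionE)
    then show "y \<in> A \<union> B" unfolding A_def B_def by (cases "c \<inter> P = {}") auto
  qed
  have xP: "x \<in> P" unfolding P_def using x path_component_refl[of x "\<Union>F"] by simp
  have "A \<inter> \<Union>F = {} \<or> B \<inter> \<Union>F = {}"
  proof (rule connected_closedD[OF conn _ cov cl])
    show "A \<inter> B \<inter> \<Union>F = {}" using AP BP by auto
  qed
  moreover have "x \<in> A \<inter> \<Union>F" using x xP cov BP by auto
  ultimately have "B \<inter> \<Union>F = {}" by auto
  with cov AP have "\<Union>F \<subseteq> P" by auto
  then show "path_component_set (\<Union>F) x = \<Union>F"
    unfolding P_def using path_component_subset[of "\<Union>F" x] by (rule subset_antisym[rotated])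
qed

text \<open>Join two of the points by an arc and follow a path from the third point until it hits this arc. Cutting the arc at the point \<open>Y\<close> that
  is hit gives two of the three sets, and injectivity of the arc separates them.\<close>

lemma tripod_exists:
  fixes B :: "'a::{complete_space,real_normed_vector} set"
  assumes B: "path_connected B" and P: "P 0 \<in> B" "P 1 \<in> B" "P 2 \<in> B" and ne: "P 0 \<noteq> P (1::nat)"
  shows "\<exists>Y C. Y \<in> B \<and> (\<forall>i<3. compact (C i) \<and> connected (C i) \<and> C i \<subseteq> B \<and> P i \<in> C i \<and> Y \<in> C i) \<and>
    (\<forall>i<3. \<forall>j<3. i \<noteq> j \<longrightarrow> C i \<inter> C j \<subseteq> {Y})"
proof -
  obtain g where g: "arc g" "path_image g \<subseteq> B" "pathstart g = P 0" "pathfinish g = P 1"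
    using B P ne unfolding path_connected_arcwise by blast
  obtain h where h: "path h" "path_image h \<subseteq> B" "pathstart h = P 2" "pathfinish h = P 0"
    using B P unfolding path_connected_def by blast
  have gc: "continuous_on {0..1} g" and ginj: "inj_on g {0..1}"
    using g(1) by (auto simp: arc_def path_def)
  have hc: "continuous_on {0..1} h" using h(1) by (simp add: path_def)
  define T where "T = {s \<in> {0..1}. h s \<in> path_image g}"
  have "closed (path_image g)" using g(1) arc_imp_path closed_path_image by blast
  then have clT: "closed T"
    unfolding T_def using continuous_closed_preimage[OF hc closed_atLeastAtMost]
    by (simp only: vimage_def Int_def mem_Collect_eq)
  have "h 1 = g 0" using g(3) h(4) by (simp add: pathstart_def pathfinish_def)
  then have T1: "1 \<in> T" by (auto simp: T_def path_image_def)
  have bT: "bdd_below T" by (rule bdd_belowI[of _ 0]) (auto simp: T_def)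
  define s0 where "s0 = Inf T"
  have s0: "s0 \<in> T" unfolding s0_def using T1 by (intro closed_contains_Inf bT clT) auto
  have s0_le: "s0 \<le> s" if "s \<in> T" for s unfolding s0_def by (rule cInf_lower[OF that bT])
  have s01: "0 \<le> s0" "s0 \<le> 1" using s0 by (auto simp: T_def)
  obtain t where t: "0 \<le> t" "t \<le> 1" "h s0 = g t" using s0 by (auto simp: T_def path_image_def)
  define C where "C = (\<lambda>i::nat. if i = 0 then g ` {0..t} else if i = 1 then g ` {t..1} else h ` {0..s0})"
  have sub: "{0..t} \<subseteq> {0..1}" "{t..1} \<subseteq> {0..1}" "{0..s0} \<subseteq> {0..1}" using t s01 by auto
  have compact_connected: "compact (C i) \<and> connected (C i)" for i
    unfolding C_def using sub
    by (auto intro!: compact_continuous_image connected_continuous_image continuous_on_subset[OF gc] continuous_on_subset[OF hc])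
  have CB: "C i \<subseteq> B" for i
  proof -
    have "C i \<subseteq> path_image g \<union> path_image h" unfolding C_def path_image_def using sub by auto
    then show ?thesis using g(2) h(2) by blast
  qed
  have C01: "C 0 \<inter> C 1 \<subseteq> {g t}"
  proof
    fix x assume "x \<in> C 0 \<inter> C 1"
    then obtain a b where ab: "0 \<le> a" "a \<le> t" "t \<le> b" "b \<le> 1" "x = g a" "g a = g b" by (auto simp: C_def)
    then have "a = b" using inj_onD[OF ginj, of a b] t by auto
    then show "x \<in> {g t}" using ab by simp
  qed
  have C2: "C 2 \<inter> path_image g \<subseteq> {g t}"
  proof
    fix x assume "x \<in> C 2 \<inter> path_image g"
    then obtain s where s: "0 \<le> s" "s \<le> s0" "x = h s" "h s \<in> path_image g" by (auto simp: C_def)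
    then have "s \<in> T" using s01 by (auto simp: T_def)
    then have "s = s0" using s0_le[of s] s(2) by simp
    then show "x \<in> {g t}" using s(3) t(3) by simp
  qed
  have Cg: "C 0 \<subseteq> path_image g" "C 1 \<subseteq> path_image g" unfolding C_def path_image_def using sub by auto
  have cases3: "i = 0 \<or> i = 1 \<or> i = 2" if "i < 3" for i :: nat using that by auto
  have "C i \<inter> C j \<subseteq> {g t}" if "i < 3" "j < 3" "i \<noteq> j" for i j
    using cases3[OF that(1)] cases3[OF that(2)] that(3) C01 C2 Cg by (elim disjE) blast+
  moreover have "P i \<in> C i \<and> g t \<in> C i" if "i < 3" for i
  proof -
    have m: "g 0 \<in> g ` {0..t}" "g t \<in> g ` {0..t}" "g t \<in> g ` {t..1}" "g 1 \<in> g ` {t..1}"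
      using t(1,2) by (simp_all add: imageI)
    have mh: "h 0 \<in> h ` {0..s0}" "h s0 \<in> h ` {0..s0}"
      using s01 by (simp_all add: imageI)
    show ?thesis using cases3[OF that]
    proof (elim disjE)
      assume "i = 0" then show ?thesis using g(3) m by (simp add: C_def pathstart_def)
    next
      assume "i = 1" then show ?thesis using g(4) m by (simp add: C_def pathfinish_def)
    next
      assume "i = 2" then show ?thesis using h(3) mh t(3) by (simp add: C_def pathstart_def)
    qed
  qed
  moreover have "g t \<in> B" using g(2) t by (auto simp: path_image_def)
  ultimately show ?thesis using compact_connected CB by (intro exI[of _ "g t"] exI[of _ C]) auto
qed

text \<open>The radial projection onto the ball is a continuous retraction, and by hypothesis it maps \<open>A\<close> into \<open>A\<close>.\<close>

lemma path_connected_Int_cball_of_radial: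
  fixes A :: "'a::real_normed_vector set"
  assumes A: "path_connected A" and R: "0 < R"
    and rad: "\<And>x. x \<in> A \<Longrightarrow> R < dist X x \<Longrightarrow> X + (R / dist X x) *\<^sub>R (x - X) \<in> A"
  shows "path_connected (A \<inter> cball X R)"
proof -
  define \<rho> where "\<rho> x = X + (R / max R (dist X x)) *\<^sub>R (x - X)" for x
  have "continuous_on A \<rho>" unfolding \<rho>_def using R by (intro continuous_intros) auto
  then have "path_connected (\<rho> ` A)" by (rule path_connected_continuous_image[OF _ A])
  moreover have "\<rho> ` A = A \<inter> cball X R"
  proof (intro equalityI subsetI)
    fix y assume "y \<in> \<rho> ` A"
    then obtain x where x: "x \<in> A" "y = \<rho> x" by blast
    show "y \<in> A \<inter> cball X R"
    proof (cases "R < dist X x")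
      case True
      then have "y = X + (R / dist X x) *\<^sub>R (x - X)" by (simp add: x \<rho>_def)
      moreover have "dist X (X + (R / dist X x) *\<^sub>R (x - X)) = R"
        using True R by (auto simp: dist_norm norm_minus_commute)
      ultimately show ?thesis using rad[OF x(1) True] by simp
    next
      case False
      then have "y = x" using R by (simp add: x \<rho>_def max_def)
      then show ?thesis using x False by simp
    qed
  next
    fix x assume x: "x \<in> A \<inter> cball X R"
    then have "max R (dist X x) = R" by simp
    then have "\<rho> x = x" using R by (simp add: \<rho>_def)
    then show "x \<in> \<rho> ` A" using x by (metis IntD1 image_eqI)
  qed
  ultimately show ?thesis by simp
qed

section \<open>Minimality of calibrated triods\<close>

lemma hausdorff1_outer_image_list_le:
  assumes "E \<subseteq> (\<Union>c\<in>set L. K c)"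
  shows "hausdorff1_outer (f ` E) \<le> (\<Sum>c\<leftarrow>L. hausdorff1_outer (f ` (E \<inter> K c)))"
  using assms
proof (induction L arbitrary: E)
  case (Cons c L)
  have "f ` E \<subseteq> f ` (E \<inter> K c) \<union> f ` (E - K c)" by blast
  then have "hausdorff1_outer (f ` E) \<le> hausdorff1_outer (f ` (E \<inter> K c)) + hausdorff1_outer (f ` (E - K c))"
    using hausdorff1_outer_mono hausdorff1_outer_Un order_trans by blast
  also have "hausdorff1_outer (f ` (E - K c)) \<le> (\<Sum>c'\<leftarrow>L. hausdorff1_outer (f ` ((E - K c) \<inter> K c')))"
    using Cons.prems by (intro Cons.IH) auto
  also have "\<dots> \<le> (\<Sum>c'\<leftarrow>L. hausdorff1_outer (f ` (E \<inter> K c')))"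
    by (intro sum_list_mono hausdorff1_outer_mono image_mono) auto
  finally show ?case by (simp add: add_left_mono)
qed simp

lemma sum_sum_list_swap:
  "(\<Sum>i\<in>I. \<Sum>c\<leftarrow>L. f i c) = (\<Sum>c\<leftarrow>L. \<Sum>i\<in>I. f i c :: 'b::comm_monoid_add)"
  by (induction L) (auto simp: sum.distrib)

lemma phi_dual_rot90_sgn_scaleR_le: "phi_dual (rot90 (sgn (r *\<^sub>R v))) \<le> phi_dual (rot90 (sgn v))"
  by (cases r "0::real" rule: linorder_cases)
     (auto simp: sgn_scaleR rot90_minus phi_dual_minus phi_dual_nonneg)

lemma potential_half_line_lipschitz:
  assumes N: "N \<in> wulff" and xy: "x \<in> half_line X v" "y \<in> half_line X v"
  shows "dist (potential N x) (potential N y) \<le> phi_dual (rot90 (sgn v)) * dist x y"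
proof -
  obtain s t where "x = X + s *\<^sub>R v" "y = X + t *\<^sub>R v" using xy by (auto simp: half_line_def)
  then have "x - y = (s - t) *\<^sub>R v" by (simp add: scaleR_diff_left)
  then have "phi_dual (rot90 (sgn (x - y))) \<le> phi_dual (rot90 (sgn v))"
    using phi_dual_rot90_sgn_scaleR_le by simp
  then have "norm (x - y) * phi_dual (rot90 (sgn (x - y))) \<le> norm (x - y) * phi_dual (rot90 (sgn v))"
    by (rule mult_left_mono) simp
  then show ?thesis
    using potential_le_phi_dual_speed[OF N, of "x - y"] by (simp add: dist_potential dist_norm[of x y] mult.commute)
qed

text \<open>On a half-line a potential has the Lipschitz constant that the dual norm of the normal allows. On the part where the competitor coincides with the triod this bounds
  the potential in terms of the triod itself.\<close>

lemma hausdorff1_outer_potential_half_line: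
  assumes "N \<in> wulff" "E \<subseteq> half_line X v"
  shows "hausdorff1_outer (potential N ` E) \<le> ennreal (phi_dual (rot90 (sgn v))) * hausdorff1_outer E"
proof (rule hausdorff1_outer_lipschitz_image[OF phi_dual_nonneg])
  fix x y assume "x \<in> E" "y \<in> E"
  then show "dist (potential N x) (potential N y) \<le> phi_dual (rot90 (sgn v)) * dist x y"
    using assms by (intro potential_half_line_lipschitz) auto
qed

lemma half_line_Int_cball:
  assumes v: "v \<noteq> 0" and R: "0 \<le> R"
  shows "half_line X v \<inter> cball X R \<subseteq> closed_segment X (X + R *\<^sub>R sgn v)"
proof
  fix x assume x: "x \<in> half_line X v \<inter> cball X R"
  then obtain s where s: "0 \<le> s" "x = X + s *\<^sub>R v" by (auto simp: half_line_def)
  have d: "s * norm v \<le> R" using x s by (simp add: dist_norm)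
  show "x \<in> closed_segment X (X + R *\<^sub>R sgn v)"
  proof (cases "R = 0")
    case True
    then have "s = 0" using d s v by (simp add: mult_le_0_iff)
    then show ?thesis using s by simp
  next
    case False
    define u where "u = s * norm v / R"
    have "0 \<le> u" "u \<le> 1" using d s R False by (auto simp: u_def)
    moreover have "(u * R) *\<^sub>R sgn v = s *\<^sub>R v"
      using False v by (simp add: u_def sgn_div_norm)
    then have "x = (1 - u) *\<^sub>R X + u *\<^sub>R (X + R *\<^sub>R sgn v)"
      using s by (simp add: algebra_simps)
    ultimately show ?thesis by (auto simp: closed_segment_def)
  qed
qed

text \<open>The directions \<open>v i\<close> of the three half-lines from \<open>X\<close> and the constant values \<open>n i\<close> of the Cahn--Hoffman field.\<close>

locale calibrated_triod =
  fixes S :: "curve list" and X :: "real^2" and v n :: "nat \<Rightarrow> real^2"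
  assumes len: "length S = 3"
    and net: "network S"
    and ray: "\<And>i. i < 3 \<Longrightarrow> ray_curve (S ! i) X (v i)"
    and distinct_rays: "carrier (S ! 0) \<noteq> carrier (S ! 1)"
    and n_wulff: "\<And>i. i < 3 \<Longrightarrow> n i \<in> wulff"
    and balance: "(\<Sum>i<3. n i) = 0"
    and n_cal: "\<And>i. i < 3 \<Longrightarrow> n i \<bullet> rot90 (sgn (v i)) = phi_dual (rot90 (sgn (v i)))"
begin

definition tension :: "nat \<Rightarrow> real" where "tension i = phi_dual (rot90 (sgn (v i)))"

definition tip :: "real \<Rightarrow> nat \<Rightarrow> real^2" where "tip R i = X + R *\<^sub>R sgn (v i)"

lemma v_nonzero: "i < 3 \<Longrightarrow> v i \<noteq> 0" using ray_curve.v[OF ray] .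
lemma carrier_ray: "i < 3 \<Longrightarrow> carrier (S ! i) = half_line X (v i)" using ray_curve.ray[OF ray] .
lemma is_curve_ray: "i < 3 \<Longrightarrow> is_curve (S ! i)" using ray_curve.c[OF ray] .

lemma carrier_borel: "i < 3 \<Longrightarrow> carrier (S ! i) \<in> sets borel"
  by (intro borel_closed is_curve_closed is_curve_ray)

lemma support_eq: "support S = (\<Union>i<3. carrier (S ! i))"
proof -
  have "set S = (!) S ` {..<3}" by (auto simp: set_conv_nth len)
  then show ?thesis by (simp add: support_def)
qed

lemma tip_in_ray: "i < 3 \<Longrightarrow> 0 \<le> R \<Longrightarrow> tip R i \<in> carrier (S ! i)"
  by (auto simp: carrier_ray half_line_def tip_def sgn_div_norm intro!: exI[of _ "R / norm (v i)"] simp: divide_inverse)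

lemma dist_tip: "i < 3 \<Longrightarrow> 0 \<le> R \<Longrightarrow> dist X (tip R i) = R"
  by (simp add: tip_def dist_norm norm_sgn v_nonzero)

lemma tip_0_neq_tip_1:
  assumes R: "0 < R"
  shows "tip R 0 \<noteq> tip R 1"
proof
  assume "tip R 0 = tip R 1"
  then have eq: "sgn (v 0) = sgn (v 1)" using R by (simp add: tip_def)
  have "half_line X u \<subseteq> half_line X w" if "sgn u = sgn w" "u \<noteq> 0" "w \<noteq> 0" for u w :: "real^2"
  proof
    fix x assume "x \<in> half_line X u"
    then obtain s where s: "0 \<le> s" "x = X + s *\<^sub>R u" by (auto simp: half_line_def)
    have "u = norm u *\<^sub>R sgn u" using that(2) by (simp add: sgn_div_norm)
    also have "\<dots> = (norm u / norm w) *\<^sub>R w" unfolding that(1) by (simp add: sgn_div_norm divide_inverse)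
    finally have "x = X + (s * (norm u / norm w)) *\<^sub>R w" using s(2) by (metis scaleR_scaleR)
    then show "x \<in> half_line X w" using s(1) unfolding half_line_def
      by (intro CollectI exI[of _ "s * (norm u / norm w)"]) auto
  qed
  then have "half_line X (v 0) = half_line X (v 1)" using eq v_nonzero by (simp add: subset_antisym)
  then show False using distinct_rays carrier_ray by simp
qed

text \<open>The balance of the \<open>n i\<close> makes the sum independent of the point \<open>Y\<close>.\<close>

lemma sum_balance:
  "(\<Sum>i<3. n i \<bullet> rot90 (tip R i - Y)) = (\<Sum>i<3. R * tension i)"
proof -
  have "n i \<bullet> rot90 (tip R i - Y) = R * tension i + n i \<bullet> rot90 (X - Y)" if "i < 3" for i
  proof -
    have "tip R i - Y = R *\<^sub>R sgn (v i) + (X - Y)" by (simp add: tip_def)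
    show ?thesis
      unfolding \<open>tip R i - Y = _\<close> rot90_add rot90_scaleR inner_add_right inner_scaleR_right n_cal[OF that] tension_def
      by (rule refl)
  qed
  then have "(\<Sum>i<3. n i \<bullet> rot90 (tip R i - Y)) = (\<Sum>i<3. R * tension i) + (\<Sum>i<3. n i \<bullet> rot90 (X - Y))"
    by (simp add: sum.distrib)
  also have "(\<Sum>i<3. n i \<bullet> rot90 (X - Y)) = 0" by (simp add: balance flip: inner_sum_left)
  finally show ?thesis by simp
qed

lemma polygonal: "polygonal_network S"
  unfolding polygonal_network_def
proof (intro conjI net exI)
  show "finite (carrier ` set S)" by simp
  show "support S = \<Union> (carrier ` set S)" by (simp add: support_def)
  show "\<forall>A\<in>carrier ` set S. (\<exists>a b. a \<noteq> b \<and> A = closed_segment a b) \<or> (\<exists>a v. v \<noteq> 0 \<and> A = half_line a v)"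
    using len carrier_ray v_nonzero by (fastforce simp: in_set_conv_nth)
qed

text \<open>Almost everywhere the normal is either zero or the one of the half-line, and \<open>phi_dual 0 = 0\<close>.\<close>

lemma phi_length_le:
  assumes U: "open U"
  shows "phi_length S U \<le> (\<Sum>i<3. ennreal (tension i) * hausdorff1_outer (carrier (S ! i) \<inter> U))"
proof -
  have "(\<integral>\<^sup>+x\<in>U \<inter> carrier (S ! i). ennreal (phi_dual (normal (S ! i) x)) \<partial>H1)
      \<le> ennreal (tension i) * hausdorff1_outer (carrier (S ! i) \<inter> U)" if i: "i < 3" for i
  proof -
    have b: "U \<inter> carrier (S ! i) \<in> sets borel" using carrier_borel[OF i] U by auto
    have "(\<integral>\<^sup>+x\<in>U \<inter> carrier (S ! i). ennreal (phi_dual (normal (S ! i) x)) \<partial>H1)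
        \<le> (\<integral>\<^sup>+x\<in>U \<inter> carrier (S ! i). ennreal (tension i) \<partial>H1)"
    proof (rule nn_integral_mono_AE)
      show "AE x in H1. ennreal (phi_dual (normal (S ! i) x)) * indicator (U \<inter> carrier (S ! i)) x
          \<le> ennreal (tension i) * indicator (U \<inter> carrier (S ! i)) x"
        using ray_curve.AE_phi_dual_normal_le[OF ray[OF i]]
        by eventually_elim (auto simp: tension_def indicator_def intro: ennreal_leI)
    qed
    also have "\<dots> = ennreal (tension i) * hausdorff1_outer (U \<inter> carrier (S ! i))"
      using b by (simp add: nn_integral_cmult_indicator emeasure_H1)
    finally show ?thesis by (simp add: Int_commute)
  qed
  then show ?thesis
    unfolding phi_length_def sum_list_sum_nth using len by (auto simp: atLeast0LessThan intro!: sum_mono)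
qed

lemma ray_length_split:
  assumes i: "i < 3" and R: "0 \<le> R" and U: "open U" "U \<subseteq> cball X R"
  shows "hausdorff1_outer (carrier (S ! i) \<inter> U) + hausdorff1_outer (carrier (S ! i) \<inter> cball X R - U) \<le> ennreal R"
proof -
  let ?C = "carrier (S ! i)"
  have b: "?C \<inter> U \<in> sets borel" "?C \<inter> cball X R - U \<in> sets borel"
    using carrier_borel[OF i] U by auto
  have "emeasure H1 (?C \<inter> U) + emeasure H1 (?C \<inter> cball X R - U) = emeasure H1 ((?C \<inter> U) \<union> (?C \<inter> cball X R - U))"
    using b by (intro plus_emeasure) auto
  also have "(?C \<inter> U) \<union> (?C \<inter> cball X R - U) = ?C \<inter> cball X R" using U by auto
  also have "emeasure H1 (?C \<inter> cball X R) = hausdorff1_outer (?C \<inter> cball X R)"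
    using carrier_borel[OF i] by (intro emeasure_H1) auto
  also have "\<dots> \<le> hausdorff1_outer (closed_segment X (tip R i))"
    unfolding carrier_ray[OF i] tip_def by (intro hausdorff1_outer_mono half_line_Int_cball v_nonzero i R)
  also have "\<dots> \<le> ennreal R"
    using hausdorff1_outer_segment_le[of X "tip R i"] dist_tip[OF i R] by simp
  finally show ?thesis using b by (simp add: emeasure_H1)
qed

text \<open>The quantity \<open>b\<close> bounds the \<open>\<phi>\<close>-length of the part of the triod in the ball outside \<open>U\<close>. It is added on both sides, so that the lower
  bound for the three continua can be used in the whole ball, and it is cancelled at the end, being finite.\<close>

lemma phi_length_le_competitor:
  assumes U: "open U" "bounded U" and A: "network A"
    and same: "\<And>x. x \<notin> U \<Longrightarrow> x \<in> support S \<longleftrightarrow> x \<in> support A"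
  shows "phi_length S U \<le> phi_length A U"
proof -
  obtain R where R: "0 < R" "U \<subseteq> ball X R"
    using bounded_subset_ballD[OF U(2)] by blast
  then have Ucb: "U \<subseteq> cball X R" by auto
  have tip_U: "tip R i \<notin> U" if "i < 3" for i using dist_tip[OF that, of R] R by auto
  have curvesA: "is_curve c" if "c \<in> set A" for c using A that by (simp add: network_def)
  have tipA: "tip R i \<in> support A" if "i < 3" for i
  proof -
    have "tip R i \<in> support S" using tip_in_ray[OF that, of R] R that by (auto simp: support_eq)
    then show ?thesis using same[OF tip_U[OF that]] by simp
  qed
  have pcA: "path_connected (support A)"
    unfolding support_def
    by (rule path_connected_Union_finite_closed)
       (use A curvesA in \<open>auto simp: network_def support_def intro: is_curve_closed carrier_path_connected\<close>)
  have pcB: "path_connected (support A \<inter> cball X R)"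
  proof (rule path_connected_Int_cball_of_radial[OF pcA R(1)])
    fix x assume x: "x \<in> support A" "R < dist X x"
    then have "x \<notin> U" using R by auto
    then obtain i where i: "i < 3" "x \<in> carrier (S ! i)" using same x by (auto simp: support_eq)
    then obtain s where s: "0 \<le> s" "x = X + s *\<^sub>R v i" by (auto simp: carrier_ray half_line_def)
    have d: "dist X x = s * norm (v i)" using s by (simp add: dist_norm)
    then have "0 < s" using x R s by (metis less_trans less_eq_real_def mult_zero_left order.asym)
    then have "(R / dist X x) *\<^sub>R (x - X) = R *\<^sub>R sgn (v i)"
      unfolding d using s by (simp add: sgn_div_norm divide_inverse mult.commute)
    then have "X + (R / dist X x) *\<^sub>R (x - X) = tip R i" by (simp add: tip_def)
    then show "X + (R / dist X x) *\<^sub>R (x - X) \<in> support A" using tipA[OF i(1)] by simp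
  qed
  have tipB: "tip R i \<in> support A \<inter> cball X R" if "i < 3" for i
    using tipA[OF that] dist_tip[OF that, of R] R by simp
  have "\<exists>Y C. Y \<in> support A \<inter> cball X R \<and>
    (\<forall>i<3. compact (C i) \<and> connected (C i) \<and> C i \<subseteq> support A \<inter> cball X R \<and> tip R i \<in> C i \<and> Y \<in> C i) \<and>
    (\<forall>i<3. \<forall>j<3. i \<noteq> j \<longrightarrow> C i \<inter> C j \<subseteq> {Y})"
    by (rule tripod_exists[OF pcB tipB tipB tipB tip_0_neq_tip_1[OF R(1)]]) simp_all
  then obtain Y C where YC0: "\<forall>i<3. compact (C i) \<and> connected (C i) \<and> C i \<subseteq> support A \<inter> cball X R \<and> tip R i \<in> C i \<and> Y \<in> C i"
    and YC1: "\<forall>i<3. \<forall>j<3. i \<noteq> j \<longrightarrow> C i \<inter> C j \<subseteq> {Y}"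
    by (elim exE conjE)
  have YC: "compact (C i)" "connected (C i)" "C i \<subseteq> support A \<inter> cball X R" "tip R i \<in> C i" "Y \<in> C i"
    if "i < 3" for i using YC0[rule_format, OF that] by blast+
  note YC6 = YC1[rule_format]
  \<comment> \<open>Without their common point the continua are disjoint, and a point has no length.\<close>
  define D where "D i = C i - {Y}" for i
  have Db: "D i \<in> sets borel" if "i < 3" for i
    unfolding D_def using YC(1)[OF that] by (intro sets.Diff borel_closed compact_imp_closed) auto
  have Dsub: "D i \<subseteq> support A \<inter> cball X R" if "i < 3" for i using YC(3)[OF that] by (auto simp: D_def)
  have Ddisj: "disjoint_family_on D {..<3}"
    unfolding disjoint_family_on_def D_def using YC6 by fastforce
  let ?\<kappa> = "\<lambda>i E. hausdorff1_outer (potential (n i) ` E)"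
  have split: "ennreal (n i \<bullet> rot90 (tip R i - Y)) \<le> ?\<kappa> i (D i \<inter> U) + ?\<kappa> i (D i - U)" if i: "i < 3" for i
  proof -
    have "ennreal (n i \<bullet> rot90 (tip R i - Y)) \<le> ennreal (dist (potential (n i) (tip R i)) (potential (n i) Y))"
      unfolding dist_potential by (intro ennreal_leI) simp
    also have "\<dots> \<le> ?\<kappa> i (C i)"
    proof (rule dist_le_hausdorff1_outer_connected)
      show "connected (potential (n i) ` C i)"
        by (intro connected_continuous_image continuous_on_potential YC(2) i)
    qed (use YC(4,5) i in auto)
    also have "\<dots> \<le> ?\<kappa> i {Y} + (?\<kappa> i (D i \<inter> U) + ?\<kappa> i (D i - U))"
    proof -
      have "potential (n i) ` C i \<subseteq> potential (n i) ` {Y} \<union> (potential (n i) ` (D i \<inter> U) \<union> potential (n i) ` (D i - U))"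
        by (auto simp: D_def)
      then show ?thesis
        using hausdorff1_outer_mono hausdorff1_outer_Un add_left_mono order_trans by meson
    qed
    finally show ?thesis by simp
  qed
  have inside: "(\<Sum>i<3. ?\<kappa> i (D i \<inter> U)) \<le> phi_length A U"
  proof -
    have "\<exists>g. \<forall>c\<in>set A. g c \<in> borel_measurable borel \<and> (\<forall>x. g c x \<le> ennreal (phi_dual (normal c x))) \<and>
       (\<forall>N\<in>wulff. \<forall>E\<in>sets borel. E \<subseteq> carrier c \<longrightarrow> hausdorff1_outer (potential N ` E) \<le> (\<integral>\<^sup>+x\<in>E. g c x \<partial>H1))"
    proof (rule bchoice, rule ballI)
      fix c assume "c \<in> set A"
      show "\<exists>g. g \<in> borel_measurable borel \<and> (\<forall>x. g x \<le> ennreal (phi_dual (normal c x))) \<and>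
       (\<forall>N\<in>wulff. \<forall>E\<in>sets borel. E \<subseteq> carrier c \<longrightarrow> hausdorff1_outer (potential N ` E) \<le> (\<integral>\<^sup>+x\<in>E. g x \<partial>H1))"
      proof (rule curve_calibration[OF curvesA[OF \<open>c \<in> set A\<close>]], goal_cases)
        case (1 g)
        show ?case by (intro exI[of _ g] conjI allI ballI impI 1)
      qed
    qed
    then obtain g where G: "\<forall>c\<in>set A. g c \<in> borel_measurable borel \<and> (\<forall>x. g c x \<le> ennreal (phi_dual (normal c x))) \<and>
       (\<forall>N\<in>wulff. \<forall>E\<in>sets borel. E \<subseteq> carrier c \<longrightarrow> hausdorff1_outer (potential N ` E) \<le> (\<integral>\<^sup>+x\<in>E. g c x \<partial>H1))"
      by (elim exE)
    have g: "g c \<in> borel_measurable borel" "g c x \<le> ennreal (phi_dual (normal c x))"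
      "N \<in> wulff \<Longrightarrow> E \<in> sets borel \<Longrightarrow> E \<subseteq> carrier c \<Longrightarrow>
         hausdorff1_outer (potential N ` E) \<le> (\<integral>\<^sup>+x\<in>E. g c x \<partial>H1)" if "c \<in> set A" for c x N E
      using G that by blast+
    have "(\<Sum>i<3. ?\<kappa> i (D i \<inter> U)) \<le> (\<Sum>i<3. \<Sum>c\<leftarrow>A. ?\<kappa> i (D i \<inter> U \<inter> carrier c))"
    proof (intro sum_mono hausdorff1_outer_image_list_le)
      fix i :: nat assume "i \<in> {..<3}"
      then show "D i \<inter> U \<subseteq> (\<Union>c\<in>set A. carrier c)" using Dsub[of i] by (auto simp: support_def)
    qed
    also have "\<dots> = (\<Sum>c\<leftarrow>A. \<Sum>i<3. ?\<kappa> i (D i \<inter> U \<inter> carrier c))" by (rule sum_sum_list_swap)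
    also have "\<dots> \<le> phi_length A U"
      unfolding phi_length_def
    proof (rule sum_list_mono)
      fix c assume c: "c \<in> set A"
      have cb: "carrier c \<in> sets borel" by (intro borel_closed is_curve_closed curvesA c)
      have Ub: "U \<in> sets borel" using U(1) by simp
      note [measurable] = g(1)[OF c]
      have "(\<Sum>i<3. ?\<kappa> i (D i \<inter> U \<inter> carrier c)) \<le> (\<Sum>i<3. emeasure (density H1 (g c)) (D i \<inter> U \<inter> carrier c))"
      proof (rule sum_mono)
        fix i :: nat assume "i \<in> {..<3}"
        then have i: "i < 3" by simp
        have b: "D i \<inter> U \<inter> carrier c \<in> sets borel" using Db[OF i] Ub cb by auto
        have "?\<kappa> i (D i \<inter> U \<inter> carrier c) \<le> (\<integral>\<^sup>+x\<in>D i \<inter> U \<inter> carrier c. g c x \<partial>H1)"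
          by (rule g(3)[OF c n_wulff[OF i] b]) blast
        also have "\<dots> = emeasure (density H1 (g c)) (D i \<inter> U \<inter> carrier c)"
          using b by (subst emeasure_density) auto
        finally show "?\<kappa> i (D i \<inter> U \<inter> carrier c) \<le> emeasure (density H1 (g c)) (D i \<inter> U \<inter> carrier c)" .
      qed
      also have "\<dots> = emeasure (density H1 (g c)) (\<Union>i<3. D i \<inter> U \<inter> carrier c)"
      proof (rule sum_emeasure)
        show "(\<lambda>i. D i \<inter> U \<inter> carrier c) ` {..<3} \<subseteq> sets (density H1 (g c))"
          using Db Ub cb by auto
        show "disjoint_family_on (\<lambda>i. D i \<inter> U \<inter> carrier c) {..<3}"
          by (rule disjoint_family_on_bisimulation[OF Ddisj]) blast
      qed simp
      also have "\<dots> \<le> emeasure (density H1 (g c)) (U \<inter> carrier c)"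
        using Ub cb by (intro emeasure_mono) auto
      also have "\<dots> = (\<integral>\<^sup>+x\<in>U \<inter> carrier c. g c x \<partial>H1)"
        using Ub cb by (subst emeasure_density) auto
      also have "\<dots> \<le> (\<integral>\<^sup>+x\<in>U \<inter> carrier c. ennreal (phi_dual (normal c x)) \<partial>H1)"
        by (intro nn_integral_mono mult_right_mono g(2)[OF c]) simp
      finally show "(\<Sum>i<3. ?\<kappa> i (D i \<inter> U \<inter> carrier c)) \<le> (\<integral>\<^sup>+x\<in>U \<inter> carrier c. ennreal (phi_dual (normal c x)) \<partial>H1)" .
    qed
    finally show ?thesis .
  qed
  define b where "b = (\<Sum>j<3. ennreal (tension j) * hausdorff1_outer (carrier (S ! j) \<inter> cball X R - U))"
  have outside: "(\<Sum>i<3. ?\<kappa> i (D i - U)) \<le> b"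
  proof -
    let ?E = "\<lambda>i j. (D i - U) \<inter> carrier (S ! j)"
    have Eb: "?E i j \<in> sets borel" if "i < 3" "j < 3" for i j
      using Db[OF that(1)] carrier_borel[OF that(2)] U(1) by auto
    have "?\<kappa> i (D i - U) \<le> (\<Sum>j<3. ennreal (tension j) * emeasure H1 (?E i j))" if i: "i < 3" for i
    proof -
      have "D i - U \<subseteq> support S" using Dsub[OF i] same by auto
      then have "D i - U \<subseteq> (\<Union>j\<in>set [0..<3]. carrier (S ! j))"
        unfolding support_eq set_upt atLeast0LessThan .
      then have "?\<kappa> i (D i - U) \<le> (\<Sum>j\<leftarrow>[0..<3]. ?\<kappa> i (?E i j))"
        by (rule hausdorff1_outer_image_list_le)
      also have "\<dots> = (\<Sum>j<3. ?\<kappa> i (?E i j))"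
        by (simp only: interv_sum_list_conv_sum_set_nat set_upt atLeast0LessThan)
      also have "\<dots> \<le> (\<Sum>j<3. ennreal (tension j) * emeasure H1 (?E i j))"
      proof (rule sum_mono)
        fix j :: nat assume "j \<in> {..<3}"
        then have j: "j < 3" by simp
        have "?\<kappa> i (?E i j) \<le> ennreal (tension j) * hausdorff1_outer (?E i j)"
          unfolding tension_def
          by (rule hausdorff1_outer_potential_half_line[OF n_wulff[OF i]]) (use carrier_ray[OF j] in auto)
        then show "?\<kappa> i (?E i j) \<le> ennreal (tension j) * emeasure H1 (?E i j)"
          by (simp add: emeasure_H1[OF Eb[OF i j]])
      qed
      finally show ?thesis .
    qed
    then have "(\<Sum>i<3. ?\<kappa> i (D i - U)) \<le> (\<Sum>i<3. \<Sum>j<3. ennreal (tension j) * emeasure H1 (?E i j))"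
      by (intro sum_mono) auto
    also have "\<dots> = (\<Sum>j<3. \<Sum>i<3. ennreal (tension j) * emeasure H1 (?E i j))" by (rule sum.swap)
    also have "\<dots> = (\<Sum>j<3. ennreal (tension j) * (\<Sum>i<3. emeasure H1 (?E i j)))" by (simp add: sum_distrib_left)
    also have "\<dots> \<le> b"
      unfolding b_def
    proof (intro sum_mono mult_left_mono)
      fix j :: nat assume "j \<in> {..<3}"
      then have j: "j < 3" by simp
      have cb: "carrier (S ! j) \<inter> cball X R - U \<in> sets borel" using carrier_borel[OF j] U(1) by auto
      have "(\<Sum>i<3. emeasure H1 (?E i j)) = emeasure H1 (\<Union>i<3. ?E i j)"
      proof (rule sum_emeasure)
        show "(\<lambda>i. ?E i j) ` {..<3} \<subseteq> sets H1" using Eb j by auto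
        show "disjoint_family_on (\<lambda>i. ?E i j) {..<3}"
          by (rule disjoint_family_on_bisimulation[OF Ddisj]) blast
      qed simp
      also have "\<dots> \<le> emeasure H1 (carrier (S ! j) \<inter> cball X R - U)"
      proof (rule emeasure_mono)
        show "(\<Union>i<3. ?E i j) \<subseteq> carrier (S ! j) \<inter> cball X R - U" using Dsub by auto
      qed (use cb in simp)
      also have "\<dots> = hausdorff1_outer (carrier (S ! j) \<inter> cball X R - U)" by (rule emeasure_H1[OF cb])
      finally show "(\<Sum>i<3. emeasure H1 (?E i j)) \<le> hausdorff1_outer (carrier (S ! j) \<inter> cball X R - U)" .
    qed simp
    finally show ?thesis .
  qed
  have T0: "0 \<le> tension i" for i by (simp add: tension_def phi_dual_nonneg)
  have split_le: "ennreal (tension i) * hausdorff1_outer (carrier (S ! i) \<inter> U) +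
      ennreal (tension i) * hausdorff1_outer (carrier (S ! i) \<inter> cball X R - U) \<le> ennreal (R * tension i)" if i: "i < 3" for i
  proof -
    have "ennreal (tension i) * (hausdorff1_outer (carrier (S ! i) \<inter> U) + hausdorff1_outer (carrier (S ! i) \<inter> cball X R - U))
        \<le> ennreal (tension i) * ennreal R"
      using R by (intro mult_left_mono ray_length_split[OF i _ U(1) Ucb]) auto
    also have "\<dots> = ennreal (R * tension i)" using R T0 by (simp add: ennreal_mult mult.commute)
    finally show ?thesis by (simp add: distrib_left)
  qed
  have "phi_length S U + b \<le> (\<Sum>i<3. ennreal (tension i) * hausdorff1_outer (carrier (S ! i) \<inter> U)) + b"
    by (intro add_right_mono phi_length_le U)
  also have "\<dots> \<le> (\<Sum>i<3. ennreal (R * tension i))"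
    unfolding b_def sum.distrib[symmetric] by (intro sum_mono split_le) simp
  also have "\<dots> = ennreal (\<Sum>i<3. R * tension i)" using R T0 by (intro sum_ennreal) simp
  also have "\<dots> = ennreal (\<Sum>i<3. n i \<bullet> rot90 (tip R i - Y))" by (simp only: sum_balance)
  also have "\<dots> \<le> ennreal (\<Sum>i<3. max 0 (n i \<bullet> rot90 (tip R i - Y)))"
    by (intro ennreal_leI sum_mono) simp
  also have "\<dots> = (\<Sum>i<3. ennreal (n i \<bullet> rot90 (tip R i - Y)))"
  proof -
    have "ennreal (\<Sum>i<3. max 0 (n i \<bullet> rot90 (tip R i - Y))) = (\<Sum>i<3. ennreal (max 0 (n i \<bullet> rot90 (tip R i - Y))))"
      by (rule sum_ennreal[symmetric]) simp
    also have "\<dots> = (\<Sum>i<3. ennreal (n i \<bullet> rot90 (tip R i - Y)))"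
      by (intro sum.cong refl) (simp add: max_def ennreal_neg)
    finally show ?thesis .
  qed
  also have "\<dots> \<le> (\<Sum>i<3. ?\<kappa> i (D i \<inter> U) + ?\<kappa> i (D i - U))"
    by (intro sum_mono split) simp
  also have "\<dots> \<le> phi_length A U + b"
    unfolding sum.distrib by (intro add_mono inside outside)
  finally have le: "phi_length S U + b \<le> phi_length A U + b" .
  have "b \<le> (\<Sum>i<3. ennreal (R * tension i))"
    unfolding b_def
    by (intro sum_mono order_trans[OF _ split_le]) auto
  also have "\<dots> < top" by simp
  finally have "b < top" .
  then show ?thesis using le by (auto simp: ennreal_add_left_cancel_le add.commute[of _ b])
qed

end

text \<open>All three curves start at \<open>X\<close>, so the balance condition at this junction is the vanishing of the plain sum of the constants.\<close>

lemma critical_triod_calibrated: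
  assumes triod: "conical_triod S" and crit: "critical S"
  shows "\<exists>X v n. calibrated_triod S X v n"
proof -
  have net: "network S" and len: "length S = 3" and dist: "distinct (map carrier S)"
    using triod by (auto simp: conical_triod_def)
  obtain X where X: "\<And>c. c \<in> set S \<Longrightarrow> \<exists>v. v \<noteq> 0 \<and> carrier c = half_line X v"
    using triod unfolding conical_triod_def by blast
  have "\<forall>i. \<exists>v. i < 3 \<longrightarrow> v \<noteq> 0 \<and> carrier (S ! i) = half_line X v"
    using X len by (metis nth_mem)
  then obtain v where v: "\<And>i. i < 3 \<Longrightarrow> v i \<noteq> 0" "\<And>i. i < 3 \<Longrightarrow> carrier (S ! i) = half_line X (v i)"
    by metis
  have ray: "ray_curve (S ! i) X (v i)" if "i < 3" for i
  proof
    show "is_curve (S ! i)" using net len that by (simp add: network_def)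
  qed (use v that in auto)
  obtain N where N: "CH_field S N" and const: "\<And>i. i < 3 \<Longrightarrow> N i constant_on carrier (S ! i)"
    using crit len unfolding critical_def by auto
  have Xc: "X \<in> carrier (S ! i)" if "i < 3" for i
    unfolding v(2)[OF that] half_line_def by (intro CollectI exI[of _ 0]) simp
  have Nx: "N i x = N i X" if "i < 3" "x \<in> carrier (S ! i)" for i x
    using const[OF that(1)] that(2) Xc[OF that(1)] unfolding constant_on_def by metis
  have CH: "N i ` carrier (S ! i) \<subseteq> frontier wulff"
      "AE x in H1. x \<in> carrier (S ! i) \<longrightarrow> N i x \<bullet> normal (S ! i) x = phi_dual (normal (S ! i) x)" if "i < 3" for i
    using N len that unfolding CH_field_def by auto
  have wulff: "N i X \<in> wulff" if "i < 3" for i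
  proof -
    have "N i X \<in> frontier wulff" using CH(1)[OF that] Xc[OF that] by blast
    then show ?thesis using compact_imp_closed[OF compact_wulff] frontier_subset_closed by blast
  qed
  have "X \<in> junctions S"
  proof -
    have "S ! 0 \<in> set S" using len by simp
    moreover have "X \<in> endpoints (S ! 0)"
      using ray_curve.par_0[OF ray, of 0] ray_curve.dom_ray[OF ray, of 0]
      by (auto simp: endpoints_def intro!: image_eqI[of _ _ 0])
    ultimately show ?thesis by (auto simp: junctions_def)
  qed
  then have bal: "(\<Sum>i | i < length S \<and> 0 \<in> dom (S ! i) \<and> par (S ! i) 0 = X. N i X) -
        (\<Sum>i | i < length S \<and> 1 \<in> dom (S ! i) \<and> par (S ! i) 1 = X. N i X) = 0"
    using N unfolding CH_field_def by blast
  have starts: "{i. i < length S \<and> 0 \<in> dom (S ! i) \<and> par (S ! i) 0 = X} = {..<3}"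
    using ray_curve.par_0[OF ray] ray_curve.dom_ray[OF ray] len by auto
  have ends: "{i. i < length S \<and> 1 \<in> dom (S ! i) \<and> par (S ! i) 1 = X} = {}"
    using ray_curve.dom_ray[OF ray] len by auto
  have balance: "(\<Sum>i<3. N i X) = 0" using bal unfolding starts ends by simp
  have "calibrated_triod S X v (\<lambda>i. N i X)"
  proof (rule calibrated_triod.intro)
    show "carrier (S ! 0) \<noteq> carrier (S ! 1)"
      using nth_eq_iff_index_eq[OF dist, of 0 1] len by simp
    fix i :: nat assume i: "i < 3"
    have "AE x in H1. x \<in> carrier (S ! i) \<longrightarrow> N i X \<bullet> normal (S ! i) x = phi_dual (normal (S ! i) x)"
      using CH(2)[OF i] by eventually_elim (use Nx[OF i] in auto)
    then show "N i X \<bullet> rot90 (sgn (v i)) = phi_dual (rot90 (sgn (v i)))"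
      by (rule ray_curve.calibrated[OF ray[OF i]])
  qed (use len net ray wulff balance in auto)
  then show ?thesis by blast
qed

theorem theorem2p13:
  fixes S :: "curve list"
  assumes "conical_triod S" and "critical S"
  shows "phi_minimal S"
proof -
  obtain X v n where "calibrated_triod S X v n"
    using critical_triod_calibrated[OF assms] by blast
  then interpret calibrated_triod S X v n .
  show ?thesis
    unfolding phi_minimal_def local_minimizer_def
  proof (intro allI impI conjI polygonal)
    fix U :: "(real^2) set" and A
    assume U: "open U \<and> bounded U"
    then show "open U" by simp
    assume A: "network A \<and> compact (closure (sym_diff (support S) (support A))) \<and>
          closure (sym_diff (support S) (support A)) \<subseteq> U"
    have "x \<in> support S \<longleftrightarrow> x \<in> support A" if "x \<notin> U" for x
      using that A closure_subset[of "sym_diff (support S) (support A)"] by auto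
    then show "phi_length S U \<le> phi_length A U"
      using U A by (intro phi_length_le_competitor) auto
  qed
qed

end
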